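(* Let $\eta$ be a non-self-crossing curve in $\mathbf{H}$ from $0$ to $\infty$. Suppose that $\varphi \colon \mathbf{H} \to \mathbf{H}$ is a homeomorphism which is conformal in $\mathbf{H} \setminus \eta$, and that the image $\widetilde\eta=\varphi(\eta)$ is a non-self-crossing curve in $\mathbf{H}$ from $0$ to $\infty$. If $\eta$ has the "bounded number of crossings" property and has zero Lebesgue measure, and if $\varphi(\eta)$ has the "non-self-tracing" property and has upper Minkowski dimension $d<2$, then $\varphi$ is a conformal automorphism of $\mathbf{H}$.
   Context: $\mathbf{H}=\{z\in\mathbf{C}:\mathrm{Im}\, z>0\}$; $B(z,r)$ is the open Euclidean disc. A curve in $\mathbf{H}$ from $0$ to $\infty$ is a continuous map $\eta\colon[0,\infty)\to\overline{\mathbf{H}}$ with $\eta(0)=0$ and $\lim_{t\to\infty}\eta(t)=\infty$; $\eta$ also denotes its trace. Non-self-crossing means that the curve may touch itself but does not cross itself (in the usual sense: up to reparametrization it is a locally uniform limit of injective curves). "Conformal in $\mathbf{H}\setminus\eta$" means holomorphic and injective there. $\varphi(\eta)$ denotes the curve $\widetilde\eta$ with $\widetilde\eta(t)=\varphi(\eta(t))$ whenever $\eta(t)\in\mathbf{H}$ and $\widetilde\eta(t)\in\mathbf{R}$ whenever $\eta(t)\in\mathbf{R}$. The upper Minkowski dimension of an unbounded set is the supremum of the upper Minkowski dimensions of its bounded subsets. Notation for a curve $\eta$: (1) For $t>0$, $\delta>0$, let $\tau$ (resp. $\sigma$) be the first (resp. last) time after (resp. before) $t$ that $\eta$ reaches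 $\partial B(\eta(t),\delta)$; the excursion $\eta(t;\delta)$ is $\eta[\sigma,\tau]$. (2) For $z\in\mathbf{H}$ and $0<\varepsilon<\delta$: if $\eta(t)\in B(z,\varepsilon)$ for some $t$, let $\tau$ (resp. $\sigma$) be the first (resp. last) time after (resp. before) $t$ that $\eta$ reaches $\partial B(z,\delta)$; then $\eta[\sigma,\tau]$ is called an excursion of $\eta$ between $\partial B(z,\varepsilon)$ and $\partial B(z,\delta)$ (also called an excursion between $\partial B(z,\delta)$ and $\partial B(z,\varepsilon)$). There are finitely many such excursions (time intervals $[\sigma,\tau]$). Bounded number of crossings: for any compact rectangle $K\subseteq\mathbf{H}$ and any $\beta\in(0,1)$ there exist $M>0$ and $\varepsilon_0>0$ such that for all $\varepsilon\in(0,\varepsilon_0)$ and all $z\in K$, the number of excursions of $\eta$ between $\partial B(z,\varepsilon^\beta)$ and $\partial B(z,\varepsilon)$ is at most $M$. Non-self-tracing: for any compact rectangle $K\subseteq\mathbf{H}$ and any $\alpha>\xi>1$ there exists $\delta_0>0$ such that for any $\delta\in(0,\delta_0)$ and any $t>0$ with $\eta(t)\in K$ one can find a point $y$ such that: (i) $B(y,\delta^\alpha)\subseteq B(\eta(t),\delta)\setminus\eta$ and $B(y,2\delta^\alpha)\cap\eta\neq\emptyset$; (ii) letting $O$ be the connected component of $B(\eta(t),\delta)\setminus\eta$ containing $y$, for any point $a\in\partial O\setminus\eta(t;\delta)$, any path contained in $O\cup\{a\}$ which connects $y$ to $a$ must exit the ball $B(y,\delta^\xi)$. *)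

theory Defs
  imports "HOL-Analysis.Analysis"
begin

definition upper_half_plane :: "complex set" where
  "upper_half_plane = {z. Im z > 0}"


section \<open>Curves\<close>

text \<open>A curve is a function on the reals of which only the values on \<open>{0..}\<close> matter.\<close>

definition curve_trace :: "(real \<Rightarrow> complex) \<Rightarrow> complex set" where
  "curve_trace \<eta> = \<eta> ` {0..}"

definition curve_from_0_to_infinity :: "(real \<Rightarrow> complex) \<Rightarrow> bool" where
  "curve_from_0_to_infinity \<eta> \<longleftrightarrow>
     continuous_on {0..} \<eta> \<and> curve_trace \<eta> \<subseteq> closure upper_half_plane \<and>
     \<eta> 0 = 0 \<and> filterlim \<eta> at_infinity at_top"

definition reparametrization :: "(real \<Rightarrow> real) \<Rightarrow> bool" where
  "reparametrization \<theta> \<longleftrightarrow>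
     continuous_on {0..} \<theta> \<and> strict_mono_on {0..} \<theta> \<and> \<theta> ` {0..} = {0..}"

text \<open>The approximating injective curves are themselves curves from \<open>0\<close> to \<open>\<infinity>\<close> in the closed
  half-plane. Locally uniform convergence on \<open>{0..}\<close> is uniform convergence on each \<open>{0..T}\<close>.\<close>

definition non_self_crossing :: "(real \<Rightarrow> complex) \<Rightarrow> bool" where
  "non_self_crossing \<eta> \<longleftrightarrow>
     (\<exists>\<theta> \<gamma>. reparametrization \<theta> \<and>
        (\<forall>n::nat. curve_from_0_to_infinity (\<gamma> n) \<and> inj_on (\<gamma> n) {0..}) \<and>
        (\<forall>T. uniform_limit {0..T} \<gamma> (\<eta> \<circ> \<theta>) sequentially))"

text \<open>On time intervals that \<open>\<eta>\<close> spends on the real line, the image curve is only required to be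
  real, so it need not be determined by \<open>\<phi>\<close> and \<open>\<eta>\<close>; hence a relation.\<close>

definition is_image_curve ::
    "(complex \<Rightarrow> complex) \<Rightarrow> (real \<Rightarrow> complex) \<Rightarrow> (real \<Rightarrow> complex) \<Rightarrow> bool" where
  "is_image_curve \<phi> \<eta> \<eta>' \<longleftrightarrow>
     (\<forall>t\<ge>0. (\<eta> t \<in> upper_half_plane \<longrightarrow> \<eta>' t = \<phi> (\<eta> t)) \<and> (\<eta> t \<in> \<real> \<longrightarrow> \<eta>' t \<in> \<real>))"


section \<open>Excursions\<close>

definition first_hit_after :: "(real \<Rightarrow> complex) \<Rightarrow> complex \<Rightarrow> real \<Rightarrow> real \<Rightarrow> real" where
  "first_hit_after \<eta> z \<delta> t = Inf {s. t \<le> s \<and> \<eta> s \<in> sphere z \<delta>}"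

text \<open>The time \<open>0\<close> is inserted only to fix the value when the circle is not reached before \<open>t\<close>. This
  can happen only if \<open>\<eta> 0 = 0\<close> lies inside the circle, which is excluded for circles of small
  radius around the points of a fixed compact subset of the half-plane.\<close>

definition last_hit_before :: "(real \<Rightarrow> complex) \<Rightarrow> complex \<Rightarrow> real \<Rightarrow> real \<Rightarrow> real" where
  "last_hit_before \<eta> z \<delta> t = Sup (insert 0 {s. 0 \<le> s \<and> s \<le> t \<and> \<eta> s \<in> sphere z \<delta>})"

definition excursion_at :: "(real \<Rightarrow> complex) \<Rightarrow> real \<Rightarrow> real \<Rightarrow> complex set" where
  "excursion_at \<eta> t \<delta> =
     \<eta> ` {last_hit_before \<eta> (\<eta> t) \<delta> t .. first_hit_after \<eta> (\<eta> t) \<delta> t}"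

text \<open>Excursions between the circles of radii \<open>\<epsilon> < \<delta>\<close> around \<open>z\<close>, as pairs of end points
  of time intervals.\<close>

definition excursions_between ::
    "(real \<Rightarrow> complex) \<Rightarrow> complex \<Rightarrow> real \<Rightarrow> real \<Rightarrow> (real \<times> real) set" where
  "excursions_between \<eta> z \<epsilon> \<delta> =
     {(last_hit_before \<eta> z \<delta> t, first_hit_after \<eta> z \<delta> t) |t. 0 \<le> t \<and> \<eta> t \<in> ball z \<epsilon>}"

definition bounded_number_of_crossings :: "(real \<Rightarrow> complex) \<Rightarrow> bool" where
  "bounded_number_of_crossings \<eta> \<longleftrightarrow>
     (\<forall>a b. cbox a b \<subseteq> upper_half_plane \<longrightarrow> (\<forall>\<beta>. 0 < \<beta> \<and> \<beta> < 1 \<longrightarrow>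
        (\<exists>M::nat. \<exists>\<epsilon>\<^sub>0::real. M > 0 \<and> \<epsilon>\<^sub>0 > 0 \<and>
          (\<forall>\<epsilon> z. 0 < \<epsilon> \<and> \<epsilon> < \<epsilon>\<^sub>0 \<and> z \<in> cbox a b \<longrightarrow>
             finite (excursions_between \<eta> z \<epsilon> (\<epsilon> powr \<beta>)) \<and>
             card (excursions_between \<eta> z \<epsilon> (\<epsilon> powr \<beta>)) \<le> M))))"

definition non_self_tracing :: "(real \<Rightarrow> complex) \<Rightarrow> bool" where
  "non_self_tracing \<eta> \<longleftrightarrow>
     (\<forall>a b. cbox a b \<subseteq> upper_half_plane \<longrightarrow> (\<forall>\<alpha> \<xi>. \<alpha> > \<xi> \<and> \<xi> > 1 \<longrightarrow>
        (\<exists>\<delta>\<^sub>0>0. \<forall>\<delta> t. 0 < \<delta> \<and> \<delta> < \<delta>\<^sub>0 \<and> t > 0 \<and> \<eta> t \<in> cbox a b \<longrightarrow>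
          (\<exists>y. ball y (\<delta> powr \<alpha>) \<subseteq> ball (\<eta> t) \<delta> - curve_trace \<eta> \<and>
               ball y (2 * \<delta> powr \<alpha>) \<inter> curve_trace \<eta> \<noteq> {} \<and>
               (let C = connected_component_set (ball (\<eta> t) \<delta> - curve_trace \<eta>) y in
                \<forall>x \<in> frontier C - excursion_at \<eta> t \<delta>. \<forall>p.
                  path p \<and> path_image p \<subseteq> C \<union> {x} \<and> pathstart p = y \<and> pathfinish p = x \<longrightarrow>
                  \<not> path_image p \<subseteq> ball y (\<delta> powr \<xi>))))))"


section \<open>Upper Minkowski dimension\<close>

definition covering_number :: "'a::metric_space set \<Rightarrow> real \<Rightarrow> nat" where
  "covering_number A \<epsilon> = (LEAST n. \<exists>C. finite C \<and> card C = n \<and> A \<subseteq> (\<Union>c\<in>C. ball c \<epsilon>))"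

text \<open>Meant for totally bounded sets, where the covering numbers are finite.\<close>

definition upper_minkowski_dim_bounded :: "'a::metric_space set \<Rightarrow> ereal" where
  "upper_minkowski_dim_bounded A =
     Limsup (at_right 0) (\<lambda>\<epsilon>. ereal (ln (real (covering_number A \<epsilon>)) / ln (1 / \<epsilon>)))"

definition upper_minkowski_dim :: "'a::metric_space set \<Rightarrow> ereal" where
  "upper_minkowski_dim A =
     (if bounded A then upper_minkowski_dim_bounded A
      else (SUP B\<in>{B. B \<subseteq> A \<and> bounded B}. upper_minkowski_dim_bounded B))"


section \<open>Conformal maps\<close>

definition conformal_on :: "complex set \<Rightarrow> (complex \<Rightarrow> complex) \<Rightarrow> bool" where
  "conformal_on S f \<longleftrightarrow> f holomorphic_on S \<and> inj_on f S"

definition conformal_automorphism :: "complex set \<Rightarrow> (complex \<Rightarrow> complex) \<Rightarrow> bool" where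
  "conformal_automorphism S f \<longleftrightarrow> conformal_on S f \<and> f ` S = S"

end

theory Submission
  imports Defs "HOL-Complex_Analysis.Complex_Analysis" "HOL-Real_Asymp.Real_Asymp"
begin

text \<open>Write \<open>E\<close> for the trace of \<open>\<eta>\<close>. By Morera's theorem, \<open>\<phi>\<close> is holomorphic if its integrals around
  rectangles vanish (\<open>Morera_rectangle\<close>). By Fubini's theorem this holds if, on almost every
  horizontal and almost every vertical line, the increments of \<open>\<phi>\<close> are the integrals of its
  derivative off \<open>E\<close> (\<open>vanishing_rectangle_integral_off_thin_set\<close>). The derivative is square
  integrable, because the integral of \<open>\<bar>\<phi>'\<bar>\<^sup>2\<close> is the area of the image, and \<open>E\<close> is a null set; so
  the increments can be wrong only if \<open>\<phi>\<close> maps the intersections of many lines with \<open>E\<close> to sets of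
  positive length. To exclude this, it suffices to cover the part of \<open>E\<close> in a rectangle by finitely
  many pieces \<open>D j\<close> whose images have diameter at most \<open>w\<close>, with \<open>\<Sum>j. w * diameter (D j)\<close> as small
  as desired: this sum bounds the average, over the lines in a coordinate direction, of \<open>w\<close> times
  the number of pieces that the line meets (\<open>AE_line_small_cover\<close>).

  The cover comes from cutting \<open>\<eta>\<close> into successive pieces during which the image curve \<open>\<eta>'\<close> moves
  by \<open>4 * \<delta>\<close>, so that \<open>w = 8 * \<delta>\<close>. Two counts make the sum small.

  The first one bounds the number \<open>N\<close> of pieces by \<open>O(\<delta> powr (-s))\<close> with some \<open>s < 2\<close>
  (\<open>card_excursion_times_le\<close>). To each piece belongs an excursion of \<open>\<eta>'\<close> at scale \<open>\<delta>\<close>, and these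
  excursions are disjoint in time. The non-self-tracing property provides for each of them a point
  \<open>y\<close> at a distance comparable to \<open>\<delta> powr \<alpha>\<close> from \<open>\<eta>'\<close> such that every point of \<open>\<eta>'\<close> that is
  reached from \<open>y\<close> by a path off \<open>\<eta>'\<close> that stays within the much larger distance \<open>\<delta> powr \<xi>\<close> of
  \<open>y\<close> is visited by the excursion. The points \<open>y\<close> lie in \<open>O(\<delta> powr (-(\<alpha> * d)))\<close> cells of size \<open>\<delta> powr \<alpha>\<close>, because
  \<open>\<eta>'\<close> has dimension less than \<open>d\<close>. All excursions with \<open>y\<close> in the same cell see the same points, so
  they all visit the same two distinct points \<open>a\<close> and \<open>b\<close>. Then \<open>\<eta>\<close> travels between the preimages of
  \<open>a\<close> and \<open>b\<close> during each of these excursions, and the bound on the number of crossings limits how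
  often this happens (\<open>card_common_points_le\<close>).

  The second one says that \<open>O(r powr (-p))\<close> pieces have diameter at least \<open>r\<close>, for every \<open>p > 2\<close>,
  since too many large pieces would cross the same small annulus (\<open>card_large_pieces_le\<close>). So the
  \<open>j\<close>-th largest diameter is \<open>O(j powr (-1/p))\<close>, the sum of the diameters is \<open>O(N powr (1 - 1/p))\<close>,
  and \<open>\<delta>\<close> times this sum is \<open>O(\<delta> powr (1 - s * (1 - 1/p)))\<close>. The exponent is positive once \<open>p\<close> is
  close to \<open>2\<close> (\<open>small_weighted_cover\<close>).\<close>

section \<open>Recovering a function from its derivative off a thin set\<close>

text \<open>Off \<open>K\<close> the function moves by at most the integral of \<open>\<bar>f'\<bar>\<close>, and on \<open>D j\<close> by at most \<open>w j\<close>. Walk from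
  \<open>a\<close> to the right up to the first point of \<open>K\<close>, and jump from there to the last point of a piece
  that contains it. This piece is not met again, so the walk ends after at most \<open>card J\<close> jumps.\<close>

lemma norm_diff_le_finite_cover:
  fixes f f' :: "real \<Rightarrow> complex"
  assumes "finite J" and "closed K" and "a \<le> b"
    and "continuous_on {a..b} f"
    and "\<And>x. x \<in> {a<..<b} - K \<Longrightarrow> (f has_vector_derivative f' x) (at x)"
    and "(\<lambda>x. norm (f' x)) integrable_on {a..b}"
    and "\<And>j. j \<in> J \<Longrightarrow> closed (D j)"
    and "K \<inter> {a<..<b} \<subseteq> (\<Union>j\<in>J. D j)"
    and "\<And>j x y. j \<in> J \<Longrightarrow> x \<in> D j \<inter> {a..b} \<Longrightarrow> y \<in> D j \<inter> {a..b} \<Longrightarrow> norm (f x - f y) \<le> w j"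
    and "\<And>j. j \<in> J \<Longrightarrow> 0 \<le> w j"
  shows "norm (f b - f a) \<le> (\<Sum>j\<in>J. w j) + integral {a..b} (\<lambda>x. norm (f' x))"
  using assms
proof (induction "card J" arbitrary: J a rule: less_induct)
  case (less J a)
  let ?g = "\<lambda>x. norm (f' x)"
  have free: "norm (f q - f p) \<le> integral {p..q} ?g"
    if "a \<le> p" "p \<le> q" "q \<le> b" "K \<inter> {p<..<q} = {}" for p q
  proof -
    have "(f' has_integral (f q - f p)) {p..q}"
    proof (rule fundamental_theorem_of_calculus_interior)
      show "continuous_on {p..q} f"
        using less.prems(4) that by (auto elim: continuous_on_subset)
      show "(f has_vector_derivative f' x) (at x)" if "x \<in> {p<..<q}" for x
        using \<open>a \<le> p\<close> \<open>q \<le> b\<close> \<open>K \<inter> {p<..<q} = {}\<close> that by (intro less.prems(5)) auto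
    qed fact
    moreover have "?g integrable_on {p..q}"
      using less.prems(6) that by (auto intro: integrable_subinterval_real)
    ultimately show ?thesis
      using integral_norm_bound_integral[of f' "{p..q}" ?g] by (auto simp: has_integral_iff)
  qed
  show ?case
  proof (cases "K \<inter> {a<..<b} = {}")
    case True
    then show ?thesis
      using free[of a b] less.prems(3) sum_nonneg[of J w] less.prems(10) by fastforce
  next
    case False
    let ?X = "K \<inter> {a<..<b}"
    \<comment> \<open>The jump goes from \<open>p\<close> to \<open>q\<close>. If points of \<open>K\<close> accumulate at \<open>a\<close> from the right, then \<open>p = a\<close>;
      closedness of the pieces gives a piece containing \<open>p\<close> even then.\<close>
    define p where "p = Inf ?X"
    have bdd: "bdd_below ?X" by (auto intro!: bdd_belowI[of _ a])
    have "p \<in> closure ?X"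
      unfolding p_def using closure_contains_Inf[OF False bdd] .
    moreover have "closed (\<Union>j\<in>J. D j)"
      using less.prems(1,7) by auto
    ultimately have "p \<in> (\<Union>j\<in>J. D j)"
      using less.prems(8) closure_minimal by blast
    then obtain i where i: "i \<in> J" "p \<in> D i" by auto
    have pab: "p \<in> {a..b}"
      using \<open>p \<in> closure ?X\<close> closure_minimal[of ?X "{a..b}"] closed_atLeastAtMost[of a b] by force
    define Y where "Y = D i \<inter> {a..b}"
    define q where "q = Sup Y"
    have "compact Y" unfolding Y_def using less.prems(7)[OF i(1)] by (simp add: closed_Int_compact)
    have "p \<in> Y" using i pab by (simp add: Y_def)
    have q: "q \<in> Y" "\<And>y. y \<in> Y \<Longrightarrow> y \<le> q"
      unfolding q_def using \<open>compact Y\<close> \<open>p \<in> Y\<close>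
      by (auto intro!: closed_contains_Sup cSup_upper
            simp: compact_imp_closed compact_imp_bounded bounded_imp_bdd_above)
    have qab: "q \<in> {a..b}" "p \<le> q" using q(1) q(2)[OF \<open>p \<in> Y\<close>] by (auto simp: Y_def)
    have Kp: "K \<inter> {a<..<p} = {}"
    proof -
      have False if "x \<in> K" "a < x" "x < p" for x
      proof -
        have "x \<in> ?X" using that pab by auto
        then have "p \<le> x" unfolding p_def using bdd by (rule cInf_lower)
        then show False using that by simp
      qed
      then show ?thesis by auto
    qed
    have 1: "norm (f p - f a) \<le> integral {a..p} ?g"
      using free[of a p] pab Kp by auto
    have 2: "norm (f q - f p) \<le> w i"
      using less.prems(9)[OF i(1), of q p] q(1) \<open>p \<in> Y\<close> by (auto simp: Y_def)
    have 3: "norm (f b - f q) \<le> (\<Sum>j\<in>J - {i}. w j) + integral {q..b} ?g"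
    proof (rule less.hyps)
      show "card (J - {i}) < card J" using less.prems(1) i(1) by (rule card_Diff1_less)
      show "finite (J - {i})" "closed K" "q \<le> b" using less.prems qab by auto
      show "continuous_on {q..b} f"
        using less.prems(4) qab by (auto elim: continuous_on_subset)
      show "(f has_vector_derivative f' x) (at x)" if "x \<in> {q<..<b} - K" for x
        using that qab by (intro less.prems(5)) auto
      show "?g integrable_on {q..b}"
        using less.prems(6) qab by (auto intro: integrable_subinterval_real)
      show "closed (D j)" "0 \<le> w j" if "j \<in> J - {i}" for j using that less.prems by auto
      show "norm (f x - f y) \<le> w j"
        if "j \<in> J - {i}" "x \<in> D j \<inter> {q..b}" "y \<in> D j \<inter> {q..b}" for j x y
        using that qab by (intro less.prems(9)) auto
      show "K \<inter> {q<..<b} \<subseteq> (\<Union>j\<in>J - {i}. D j)"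
      proof
        fix x assume x: "x \<in> K \<inter> {q<..<b}"
        then obtain j where j: "j \<in> J" "x \<in> D j" using less.prems(8) qab by fastforce
        moreover have "x \<notin> D i" using q(2)[of x] x qab by (auto simp: Y_def)
        ultimately show "x \<in> (\<Union>j\<in>J - {i}. D j)" by auto
      qed
    qed
    have gint: "?g integrable_on {u..v}" if "a \<le> u" "v \<le> b" for u v
      using less.prems(6) that by (auto intro: integrable_subinterval_real)
    have "integral {a..p} ?g + integral {p..b} ?g = integral {a..b} ?g"
      using pab gint by (intro Henstock_Kurzweil_Integration.integral_combine) auto
    moreover have "integral {p..q} ?g + integral {q..b} ?g = integral {p..b} ?g"
      using pab qab gint by (intro Henstock_Kurzweil_Integration.integral_combine) auto
    moreover have "0 \<le> integral {p..q} ?g"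
      using pab qab gint by (intro integral_nonneg) auto
    moreover have "(\<Sum>j\<in>J. w j) = w i + (\<Sum>j\<in>J - {i}. w j)"
      using less.prems(1) i(1) by (simp add: sum.remove)
    moreover have "norm (f b - f a) \<le> norm (f b - f q) + norm (f q - f p) + norm (f p - f a)"
      using norm_triangle_ineq[of "f b - f q" "f q - f p"]
        norm_triangle_ineq[of "f b - f p" "f p - f a"] by simp
    ultimately show ?thesis using 1 2 3 by linarith
  qed
qed

text \<open>Since the sums of the \<open>w j\<close> can be made arbitrarily small, the increments of \<open>f\<close> are bounded by the
  integrals of \<open>\<bar>f'\<bar>\<close>. Hence the increments of \<open>G\<close>, the difference of \<open>f\<close> and the indefinite
  integral of \<open>f'\<close>, are bounded by twice these integrals; moreover \<open>G\<close> is constant on intervals free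
  of \<open>K\<close>. So its increments are at most twice the integral of \<open>\<bar>f'\<bar>\<close> over any neighbourhood of \<open>K\<close>, which tends to \<open>0\<close> when the
  neighbourhood shrinks to the null set \<open>K\<close>.\<close>

lemma integral_derivative_off_small_image:
  fixes f f' :: "real \<Rightarrow> complex"
  assumes "closed K" and "negligible K" and "a \<le> b"
    and contf: "continuous_on {a..b} f"
    and der: "\<And>x. x \<in> {a<..<b} - K \<Longrightarrow> (f has_vector_derivative f' x) (at x)"
    and int: "f' absolutely_integrable_on {a..b}"
    and cover: "\<And>e. e > 0 \<Longrightarrow> \<exists>J D w. finite (J::'j set) \<and> (\<forall>j\<in>J. closed (D j) \<and> 0 \<le> w j \<and>
        (\<forall>x\<in>D j \<inter> {a..b}. \<forall>y\<in>D j \<inter> {a..b}. norm (f x - f y) \<le> w j)) \<and>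
        K \<inter> {a<..<b} \<subseteq> (\<Union>j\<in>J. D j) \<and> (\<Sum>j\<in>J. w j) < e"
  shows "integral {a..b} f' = f b - f a"
proof -
  let ?g = "\<lambda>x. norm (f' x)"
  have gint: "?g integrable_on {a..b}" and fint: "f' integrable_on {a..b}"
    using int by (auto simp: absolutely_integrable_on_def)
  have gsub: "?g integrable_on {c..d}" and fsub: "f' integrable_on {c..d}"
    if "a \<le> c" "d \<le> b" for c d
    using gint fint that by (auto intro: integrable_subinterval_real)
  have bound: "norm (f d - f c) \<le> integral {c..d} ?g" if cd: "a \<le> c" "c \<le> d" "d \<le> b" for c d
  proof (rule field_le_epsilon)
    fix e :: real assume "e > 0"
    from cover[OF this] obtain J :: "'j set" and D w where J: "finite J"
      "\<forall>j\<in>J. closed (D j) \<and> 0 \<le> w j \<and>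
        (\<forall>x\<in>D j \<inter> {a..b}. \<forall>y\<in>D j \<inter> {a..b}. norm (f x - f y) \<le> w j)"
      "K \<inter> {a<..<b} \<subseteq> (\<Union>j\<in>J. D j)" "(\<Sum>j\<in>J. w j) < e"
      by (elim exE conjE) (rule that)
    have "norm (f d - f c) \<le> (\<Sum>j\<in>J. w j) + integral {c..d} ?g"
    proof (rule norm_diff_le_finite_cover[OF J(1) \<open>closed K\<close> \<open>c \<le> d\<close>])
      show "continuous_on {c..d} f" using contf cd by (auto elim: continuous_on_subset)
      show "K \<inter> {c<..<d} \<subseteq> (\<Union>j\<in>J. D j)" using J(3) cd by fastforce
    qed (use cd J gsub der in auto)
    then show "norm (f d - f c) \<le> integral {c..d} ?g + e" using J(4) by simp
  qed
  define G where "G x = f x - integral {a..x} f'" for x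
  have Gdiff: "G d - G c = (f d - f c) - integral {c..d} f'" if "a \<le> c" "c \<le> d" "d \<le> b" for c d
    unfolding G_def
    using Henstock_Kurzweil_Integration.integral_combine[of a c d f'] that fsub[of a d] by (simp add: algebra_simps)
  define U where "U n = {x. infdist x K < inverse (real (Suc n))}" for n
  have openU: "open (U n)" for n
    unfolding U_def by (intro open_Collect_less continuous_intros)
  define h where "h n x = (if x \<in> U n then ?g x else 0)" for n x
  have hint: "h n integrable_on {a..b}" for n
  proof -
    have "f' absolutely_integrable_on (U n \<inter> {a..b})"
      using int openU by (intro set_integrable_subset[OF int]) auto
    then have "?g integrable_on (U n \<inter> {a..b})" by (auto simp: absolutely_integrable_on_def)
    then show ?thesis
      unfolding h_def using integrable_restrict_Int[of "U n" ?g "{a..b}"] by simp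
  qed
  have hsub: "h n integrable_on {c..d}" if "a \<le> c" "d \<le> b" for n c d
    using that by (intro integrable_subinterval_real[OF hint]) auto
  show ?thesis
  proof (cases "K = {}")
    case True
    then have "(f' has_integral (f b - f a)) {a..b}"
      using der contf \<open>a \<le> b\<close> by (intro fundamental_theorem_of_calculus_interior) auto
    then show ?thesis by blast
  next
    case False
    have K_U: "K \<subseteq> U n" for n by (auto simp: U_def)
    have est: "norm (G b - G a) \<le> 2 * integral {a..b} (h n)" for n
    proof -
      define P where "P c d \<longleftrightarrow> (a \<le> c \<and> d \<le> b \<and> c \<le> d \<longrightarrow> norm (G d - G c) \<le> 2 * integral {c..d} (h n))" for c d
      \<comment> \<open>The estimate adds up over adjacent intervals, so it is enough to have it near each point.\<close>
      have "P a b" using \<open>a \<le> b\<close>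
      proof (induction rule: Bolzano)
        case (trans c d e)
        show ?case unfolding P_def
        proof
          assume ce: "a \<le> c \<and> e \<le> b \<and> c \<le> e"
          have "integral {c..d} (h n) + integral {d..e} (h n) = integral {c..e} (h n)"
            using trans ce hsub by (intro Henstock_Kurzweil_Integration.integral_combine) auto
          moreover have "norm (G e - G c) \<le> norm (G e - G d) + norm (G d - G c)"
            using norm_triangle_ineq[of "G e - G d" "G d - G c"] by simp
          ultimately show "norm (G e - G c) \<le> 2 * integral {c..e} (h n)"
            using trans ce unfolding P_def by auto
        qed
      next
        case (local x)
        show ?case
        proof (cases "x \<in> K")
          case True
          then obtain r where r: "r > 0" "ball x r \<subseteq> U n"
            using openU K_U by (metis open_contains_ball subsetD)
          show ?thesis
          proof (intro exI[of _ r] conjI allI impI)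
            fix c d assume cd: "c \<le> x \<and> x \<le> d \<and> d - c < r"
            then have sub: "{c..d} \<subseteq> U n" using r by (force simp: dist_real_def)
            show "P c d" unfolding P_def
            proof
              assume ce: "a \<le> c \<and> d \<le> b \<and> c \<le> d"
              have "integral {c..d} (h n) = integral {c..d} ?g"
                using sub by (intro integral_cong) (auto simp: h_def)
              moreover have "norm (integral {c..d} f') \<le> integral {c..d} ?g"
                using ce fsub gsub by (intro integral_norm_bound_integral) auto
              ultimately show "norm (G d - G c) \<le> 2 * integral {c..d} (h n)"
                using bound[of c d] ce Gdiff[of c d] norm_triangle_ineq4[of "f d - f c" "integral {c..d} f'"]
                by simp
            qed
          qed (use r in auto)
        next
          case False
          then obtain r where r: "r > 0" "ball x r \<inter> K = {}"
            using \<open>closed K\<close> by (metis Compl_iff disjoint_eq_subset_Compl inf_commute open_Compl open_contains_ball)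
          show ?thesis
          proof (intro exI[of _ r] conjI allI impI)
            fix c d assume cd: "c \<le> x \<and> x \<le> d \<and> d - c < r"
            then have sub: "{c..d} \<inter> K = {}" using r by (force simp: dist_real_def)
            show "P c d" unfolding P_def
            proof
              assume ce: "a \<le> c \<and> d \<le> b \<and> c \<le> d"
              have "(f' has_integral (f d - f c)) {c..d}"
              proof (rule fundamental_theorem_of_calculus_interior)
                show "continuous_on {c..d} f" using contf ce by (auto elim: continuous_on_subset)
                show "(f has_vector_derivative f' y) (at y)" if "y \<in> {c<..<d}" for y
                proof (rule der)
                  have "y \<in> {c..d}" using that by auto
                  then show "y \<in> {a<..<b} - K" using sub that ce by (auto simp: disjoint_iff)
                qed
              qed (use ce in auto)
              then have "G d - G c = 0" using Gdiff[of c d] ce by (simp add: has_integral_iff)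
              moreover have "0 \<le> integral {c..d} (h n)"
                using ce hsub by (intro integral_nonneg) (auto simp: h_def)
              ultimately show "norm (G d - G c) \<le> 2 * integral {c..d} (h n)" by simp
            qed
          qed (use r in auto)
        qed
      qed
      then show ?thesis using \<open>a \<le> b\<close> by (simp add: P_def)
    qed
    have "(\<lambda>n. integral {a..b} (h n)) \<longlonglongrightarrow> integral {a..b} (\<lambda>x. if x \<in> K then ?g x else 0)"
    proof (rule dominated_convergence(2)[OF hint gint])
      show "norm (h n x) \<le> ?g x" for n x by (simp add: h_def)
      fix x
      show "(\<lambda>n. h n x) \<longlonglongrightarrow> (if x \<in> K then ?g x else 0)"
      proof (cases "x \<in> K")
        case True then show ?thesis using K_U by (auto simp: h_def subset_iff)
      next
        case False
        then have "infdist x K > 0"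
          using \<open>closed K\<close> \<open>K \<noteq> {}\<close> in_closed_iff_infdist_zero infdist_nonneg by (metis less_eq_real_def)
        then have "\<forall>\<^sub>F n in sequentially. inverse (real (Suc n)) < infdist x K"
          using LIMSEQ_inverse_real_of_nat by (rule order_tendstoD(2)[rotated])
        then have "\<forall>\<^sub>F n in sequentially. h n x = 0"
          by eventually_elim (auto simp: h_def U_def)
        then show ?thesis using False by (simp add: tendsto_eventually)
      qed
    qed
    moreover have "integral {a..b} (\<lambda>x. if x \<in> K then ?g x else 0) = integral {a..b} (\<lambda>x. 0)"
      using \<open>negligible K\<close> by (intro integral_spike[of K]) auto
    ultimately have "(\<lambda>n. 2 * integral {a..b} (h n)) \<longlonglongrightarrow> 0"
      by (auto intro: tendsto_mult_right_zero)
    then have "norm (G b - G a) \<le> 0"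
      by (rule LIMSEQ_le_const) (use est in auto)
    then show ?thesis using Gdiff[of a b] \<open>a \<le> b\<close> by (simp add: algebra_simps)
  qed
qed

section \<open>Morera's theorem for rectangles\<close>

lemma indefinite_integral_increment_near:
  fixes f :: "real \<Rightarrow> complex"
  assumes cont: "continuous_on {a..b} f" and xy: "x \<in> {a..b}" "y \<in> {a..b}"
    and close: "\<And>s. s \<in> closed_segment x y \<Longrightarrow> norm (f s - c) \<le> \<epsilon>"
  shows "norm (integral {a..x} f - integral {a..y} f - of_real (x - y) * c) \<le> \<epsilon> * \<bar>x - y\<bar>"
proof -
  have main: "norm (integral {a..v} f - integral {a..u} f - of_real (v - u) * c) \<le> \<epsilon> * (v - u)"
    if uv: "a \<le> u" "u \<le> v" "v \<le> b" "\<And>s. s \<in> {u..v} \<Longrightarrow> norm (f s - c) \<le> \<epsilon>" for u v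
  proof -
    have int: "f integrable_on {p..q}" if "a \<le> p" "q \<le> b" for p q
      using cont that by (intro integrable_continuous_interval) (auto elim: continuous_on_subset)
    have "integral {a..u} f + integral {u..v} f = integral {a..v} f"
      using uv int by (intro Henstock_Kurzweil_Integration.integral_combine) auto
    moreover have "integral {u..v} (\<lambda>s. f s - c) = integral {u..v} f - of_real (v - u) * c"
      using uv Henstock_Kurzweil_Integration.integral_diff[OF int[of u v] integrable_const_ivl[of c]]
      by (simp add: scaleR_conv_of_real)
    ultimately have "integral {a..v} f - integral {a..u} f - of_real (v - u) * c = integral {u..v} (\<lambda>s. f s - c)"
      by (metis add_diff_cancel_left')
    also have "norm \<dots> \<le> integral {u..v} (\<lambda>s. \<epsilon>)"
      using uv int[of u v] by (intro integral_norm_bound_integral) (auto intro: Henstock_Kurzweil_Integration.integrable_diff)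
    also have "\<dots> = \<epsilon> * (v - u)" using uv(2) by simp
    finally show ?thesis .
  qed
  show ?thesis
  proof (cases "y \<le> x")
    case True
    then have "closed_segment x y = {y..x}" by (simp add: closed_segment_eq_real_ivl closed_segment_commute)
    then show ?thesis using main[of y x] True xy close by simp
  next
    case False
    then have "closed_segment x y = {x..y}" by (simp add: closed_segment_eq_real_ivl)
    then have "norm (integral {a..y} f - integral {a..x} f - of_real (y - x) * c) \<le> \<epsilon> * (y - x)"
      using main[of x y] False xy close by simp
    moreover have "integral {a..x} f - integral {a..y} f - of_real (x - y) * c
        = - (integral {a..y} f - integral {a..x} f - of_real (y - x) * c)"
      by (simp add: algebra_simps)
    ultimately show ?thesis using False by (simp only: norm_minus_cancel) simp
  qed
qed

text \<open>The contour integral of \<open>f\<close> around the rectangle with lower left corner \<open>p\<close> and upper right corner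
  \<open>q\<close> is zero, written with the real integrals to which Fubini's theorem applies.\<close>

definition vanishing_rectangle_integral :: "(complex \<Rightarrow> complex) \<Rightarrow> complex \<Rightarrow> complex \<Rightarrow> bool" where
  "vanishing_rectangle_integral f p q \<longleftrightarrow>
     \<i> * integral {Im p..Im q} (\<lambda>y. f (Complex (Re q) y) - f (Complex (Re p) y)) =
     integral {Re p..Re q} (\<lambda>x. f (Complex x (Im q)) - f (Complex x (Im p)))"

text \<open>Integrating \<open>f\<close> from a fixed corner, first horizontally and then vertically, defines a function \<open>F\<close>;
  by the hypothesis the other order gives the same \<open>F\<close>. The first description shows that \<open>F\<close> has
  vertical derivative \<open>\<i> * f\<close> and the second one that it has horizontal derivative \<open>f\<close>, so \<open>F' = f\<close>.\<close>

lemma Morera_rectangle: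
  fixes f :: "complex \<Rightarrow> complex"
  assumes "open \<Omega>" and cont: "continuous_on \<Omega> f"
    and rect: "\<And>p q. Re p \<le> Re q \<Longrightarrow> Im p \<le> Im q \<Longrightarrow> cbox p q \<subseteq> \<Omega> \<Longrightarrow> vanishing_rectangle_integral f p q"
  shows "f holomorphic_on \<Omega>"
proof -
  have "\<exists>U. open U \<and> z \<in> U \<and> f holomorphic_on U" if "z \<in> \<Omega>" for z
  proof -
    obtain p q where pq: "z \<in> box p q" "cbox p q \<subseteq> \<Omega>"
      using open_contains_cbox[OF \<open>open \<Omega>\<close>, of z] \<open>z \<in> \<Omega>\<close> \<open>open \<Omega>\<close> open_contains_cbox by metis
    define F where "F w = integral {Re p..Re w} (\<lambda>s. f (Complex s (Im p)))
        + \<i> * integral {Im p..Im w} (\<lambda>t. f (Complex (Re w) t))" for w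
    have conth: "continuous_on {Re p..Re q} (\<lambda>s. f (Complex s y))" if "y \<in> {Im p..Im q}" for y
      using pq(2) that
      by (intro continuous_on_compose2[OF cont]) (auto simp: in_cbox_complex_iff subset_iff Complex_eq intro!: continuous_intros)
    have contv: "continuous_on {Im p..Im q} (\<lambda>t. f (Complex x t))" if "x \<in> {Re p..Re q}" for x
      using pq(2) that
      by (intro continuous_on_compose2[OF cont]) (auto simp: in_cbox_complex_iff subset_iff Complex_eq intro!: continuous_intros)
    have F_alt: "F w = integral {Re p..Re w} (\<lambda>s. f (Complex s (Im w)))
        + \<i> * integral {Im p..Im w} (\<lambda>t. f (Complex (Re p) t))" if w: "w \<in> cbox p q" for w
    proof -
      have w': "Re p \<le> Re w" "Re w \<le> Re q" "Im p \<le> Im w" "Im w \<le> Im q"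
        using w by (auto simp: in_cbox_complex_iff)
      have "cbox p w \<subseteq> \<Omega>" using pq(2) w' by (auto simp: in_cbox_complex_iff subset_iff)
      then have "vanishing_rectangle_integral f p w" using rect w' by blast
      moreover have h: "(\<lambda>s. f (Complex s y)) integrable_on {Re p..Re w}" if "y \<in> {Im p..Im q}" for y
        using continuous_on_subset[OF conth[OF that]] w' by (intro integrable_continuous_interval) auto
      moreover have v: "(\<lambda>t. f (Complex x t)) integrable_on {Im p..Im w}" if "x \<in> {Re p..Re q}" for x
        using continuous_on_subset[OF contv[OF that]] w' by (intro integrable_continuous_interval) auto
      ultimately show ?thesis
        using h[of "Im p"] h[of "Im w"] v[of "Re p"] v[of "Re w"] w'
        unfolding F_def vanishing_rectangle_integral_def by (simp add: Henstock_Kurzweil_Integration.integral_diff algebra_simps)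
    qed
    have "(F has_field_derivative f w0) (at w0)" if w0: "w0 \<in> box p q" for w0
      unfolding has_field_derivative_def has_derivative_at_alt
    proof (intro conjI allI impI)
      show "bounded_linear ((*) (f w0))" by (rule bounded_linear_mult_right)
      fix e :: real assume "e > 0"
      have "w0 \<in> \<Omega>" using w0 pq(2) box_subset_cbox by blast
      then have "isCont f w0" using cont \<open>open \<Omega>\<close> by (simp add: continuous_on_eq_continuous_at)
      then obtain d1 where d1: "d1 > 0" "\<And>w. dist w w0 < d1 \<Longrightarrow> dist (f w) (f w0) < e / 2"
        using \<open>e > 0\<close> unfolding continuous_at_eps_delta by (metis half_gt_zero)
      obtain d2 where d2: "d2 > 0" "ball w0 d2 \<subseteq> box p q" using w0 open_contains_ball open_box by blast
      define d where "d = min d1 d2"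
      have "norm (F w - F w0 - f w0 * (w - w0)) \<le> e * norm (w - w0)" if w: "norm (w - w0) < d" for w
      proof -
        \<comment> \<open>Go from \<open>w0\<close> to \<open>w\<close> horizontally to \<open>v\<close> and then vertically.\<close>
        define v where "v = Complex (Re w) (Im w0)"
        have "w \<in> ball w0 d2" using w by (simp add: d_def dist_norm norm_minus_commute)
        then have wbox: "w \<in> box p q" using d2(2) by blast
        have box: "Re w \<in> {Re p..Re q}" "Im w \<in> {Im p..Im q}" "Re w0 \<in> {Re p..Re q}" "Im w0 \<in> {Im p..Im q}"
          using wbox w0 by (auto simp: in_box_complex_iff)
        then have vbox: "v \<in> cbox p q" "w0 \<in> cbox p q" by (auto simp: v_def in_cbox_complex_iff)
        have near: "norm (f (Complex s t) - f w0) \<le> e / 2"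
          if "\<bar>s - Re w0\<bar> \<le> \<bar>Re w - Re w0\<bar>" "\<bar>t - Im w0\<bar> \<le> \<bar>Im w - Im w0\<bar>" for s t
        proof -
          have "norm (Complex s t - w0) \<le> norm (w - w0)"
            unfolding cmod_def using that by (intro real_sqrt_le_mono add_mono) (auto simp: abs_le_square_iff)
          then show ?thesis using d1(2)[of "Complex s t"] w by (simp add: d_def dist_norm less_imp_le)
        qed
        have seg: "\<bar>s - y\<bar> \<le> \<bar>x - y\<bar>" if "s \<in> closed_segment x y" for s x y :: real
          using that by (auto simp: closed_segment_eq_real_ivl split: if_splits)
        have "norm (F w - F v - of_real (Im w - Im w0) * (\<i> * f w0)) \<le> e / 2 * \<bar>Im w - Im w0\<bar>"
        proof -
          have "norm (integral {Im p..Im w} (\<lambda>t. f (Complex (Re w) t)) - integral {Im p..Im w0} (\<lambda>t. f (Complex (Re w) t))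
              - of_real (Im w - Im w0) * f w0) \<le> e / 2 * \<bar>Im w - Im w0\<bar>"
            using box by (intro indefinite_integral_increment_near[OF contv] near seg) auto
          moreover have "F w - F v - of_real (Im w - Im w0) * (\<i> * f w0) =
             \<i> * (integral {Im p..Im w} (\<lambda>t. f (Complex (Re w) t)) - integral {Im p..Im w0} (\<lambda>t. f (Complex (Re w) t))
              - of_real (Im w - Im w0) * f w0)"
            by (simp add: F_def v_def algebra_simps)
          ultimately show ?thesis by (simp only: norm_mult norm_ii mult_1)
        qed
        moreover have "norm (F v - F w0 - of_real (Re w - Re w0) * f w0) \<le> e / 2 * \<bar>Re w - Re w0\<bar>"
        proof -
          have "norm (integral {Re p..Re w} (\<lambda>s. f (Complex s (Im w0))) - integral {Re p..Re w0} (\<lambda>s. f (Complex s (Im w0)))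
              - of_real (Re w - Re w0) * f w0) \<le> e / 2 * \<bar>Re w - Re w0\<bar>"
            using box by (intro indefinite_integral_increment_near[OF conth] near seg) auto
          then show ?thesis unfolding F_alt[OF vbox(1)] F_alt[OF vbox(2)] by (simp add: v_def)
        qed
        moreover have "F w - F w0 - f w0 * (w - w0) = (F w - F v - of_real (Im w - Im w0) * (\<i> * f w0))
            + (F v - F w0 - of_real (Re w - Re w0) * f w0)"
        proof -
          have "w - w0 = of_real (Re w - Re w0) + \<i> * of_real (Im w - Im w0)" by (simp add: complex_eq_iff)
          show ?thesis unfolding \<open>w - w0 = _\<close> by (simp add: algebra_simps)
        qed
        ultimately have "norm (F w - F w0 - f w0 * (w - w0)) \<le> e / 2 * \<bar>Im w - Im w0\<bar> + e / 2 * \<bar>Re w - Re w0\<bar>"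
          by (metis norm_triangle_le add_mono)
        also have "\<dots> \<le> e / 2 * norm (w - w0) + e / 2 * norm (w - w0)"
          using abs_Re_le_cmod[of "w - w0"] abs_Im_le_cmod[of "w - w0"] \<open>e > 0\<close>
          by (intro add_mono mult_left_mono) auto
        finally show ?thesis by simp
      qed
      then show "\<exists>d>0. \<forall>w. norm (w - w0) < d \<longrightarrow> norm (F w - F w0 - f w0 * (w - w0)) \<le> e * norm (w - w0)"
        using d1(1) d2(1) by (intro exI[of _ d]) (auto simp: d_def)
    qed
    then have "f holomorphic_on box p q" by (intro derivative_is_holomorphic[OF open_box]) auto
    then show ?thesis using pq(1) open_box by blast
  qed
  then show ?thesis
    using holomorphic_on_open \<open>open \<Omega>\<close> by (metis (no_types, lifting) field_differentiable_at_within field_differentiable_def holomorphic_on_def holomorphic_on_imp_differentiable_at)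
qed

section \<open>Square integrability of the derivative of an injective holomorphic map\<close>

lemma lborel_complex_prod:
  "distr (lborel :: (real \<times> real) measure) borel (\<lambda>(x, y). Complex x y) = (lborel :: complex measure)"
proof (rule lborel_eqI[symmetric])
  have [measurable]: "(\<lambda>(x, y). Complex x y) \<in> borel_measurable borel"
    unfolding split_beta' Complex_eq by (intro borel_measurable_continuous_onI continuous_intros)
  fix l u :: complex assume le: "\<And>b. b \<in> Basis \<Longrightarrow> l \<bullet> b \<le> u \<bullet> b"
  have le': "Re l \<le> Re u" "Im l \<le> Im u"
    using le[of 1] le[of \<i>] by (auto simp: Basis_complex_def inner_complex_def)
  have "(\<lambda>(x, y). Complex x y) -` box l u = box (Re l, Im l) (Re u, Im u)"
    by (auto simp: in_box_complex_iff box_prod)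
  then have "emeasure (distr lborel borel (\<lambda>(x, y). Complex x y)) (box l u) = emeasure lborel (box (Re l, Im l) (Re u, Im u))"
    by (subst emeasure_distr) auto
  also have "\<dots> = ennreal ((Re u - Re l) * (Im u - Im l))"
    using le' by (subst emeasure_lborel_box) (auto simp: Basis_prod_def prod.union_disjoint inner_prod_def)
  also have "(Re u - Re l) * (Im u - Im l) = (\<Prod>b\<in>Basis. (u - l) \<bullet> b)"
    by (simp add: Basis_complex_def inner_complex_def)
  finally show "emeasure (distr lborel borel (\<lambda>(x, y). Complex x y)) (box l u) = ennreal (\<Prod>b\<in>Basis. (u - l) \<bullet> b)" .
qed simp

definition complex_of_vec :: "real^2 \<Rightarrow> complex" where
  "complex_of_vec v = Complex (v $ 1) (v $ 2)"

definition vec_of_complex :: "complex \<Rightarrow> real^2" where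
  "vec_of_complex z = vector [Re z, Im z]"

lemma complex_vec_inverse [simp]:
  "complex_of_vec (vec_of_complex z) = z" "vec_of_complex (complex_of_vec v) = v"
  by (auto simp: complex_of_vec_def vec_of_complex_def vec_eq_iff forall_2)

lemma bounded_linear_complex_of_vec: "bounded_linear complex_of_vec"
  by (intro linear_conv_bounded_linear[THEN iffD1] linearI)
     (auto simp: complex_of_vec_def complex_eq_iff)

lemma bounded_linear_vec_of_complex: "bounded_linear vec_of_complex"
  by (intro linear_conv_bounded_linear[THEN iffD1] linearI)
     (auto simp: vec_of_complex_def vec_eq_iff forall_2)

lemma lborel_complex_vec:
  "distr (lborel :: (real^2) measure) borel complex_of_vec = (lborel :: complex measure)"
proof (rule lborel_eqI[symmetric])
  have [measurable]: "complex_of_vec \<in> borel_measurable borel"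
    by (intro borel_measurable_continuous_onI linear_continuous_on bounded_linear_complex_of_vec)
  fix l u :: complex assume le: "\<And>b. b \<in> Basis \<Longrightarrow> l \<bullet> b \<le> u \<bullet> b"
  have le': "Re l \<le> Re u" "Im l \<le> Im u"
    using le[of 1] le[of \<i>] by (auto simp: Basis_complex_def inner_complex_def)
  have "complex_of_vec -` box l u = box (vec_of_complex l) (vec_of_complex u)"
    by (auto simp: in_box_complex_iff mem_box_cart forall_2 complex_of_vec_def vec_of_complex_def)
  then have "emeasure (distr lborel borel complex_of_vec) (box l u) = emeasure lborel (box (vec_of_complex l) (vec_of_complex u))"
    by (subst emeasure_distr) auto
  also have "\<dots> = ennreal ((Re u - Re l) * (Im u - Im l))"
    using le' by (subst emeasure_lborel_box)
      (auto simp: Basis_vec_def vec_of_complex_def inner_axis UNION_singleton_eq_range prod.reindex inj_on_def axis_eq_axis UNIV_2)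
  also have "(Re u - Re l) * (Im u - Im l) = (\<Prod>b\<in>Basis. (u - l) \<bullet> b)"
    by (simp add: Basis_complex_def inner_complex_def)
  finally show "emeasure (distr lborel borel complex_of_vec) (box l u) = ennreal (\<Prod>b\<in>Basis. (u - l) \<bullet> b)" .
qed simp

lemma Jacobian_complex_multiplication:
  "\<bar>det (matrix (\<lambda>h. vec_of_complex (d * complex_of_vec h)))\<bar> = (norm d)\<^sup>2"
proof -
  have "det (matrix (\<lambda>h. vec_of_complex (d * complex_of_vec h))) = Re d * Re d + Im d * Im d"
    unfolding det_2 matrix_def by (simp add: vec_of_complex_def complex_of_vec_def axis_def)
  also have "\<dots> = (norm d)\<^sup>2"
    unfolding cmod_power2 power2_eq_square[of "Re d"] power2_eq_square[of "Im d"] ..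
  finally show ?thesis by simp
qed

text \<open>The Jacobian determinant of \<open>f\<close> as a map of the real plane is \<open>\<bar>f'\<bar>\<^sup>2\<close>, so by the change of variables
  formula its integral over \<open>S\<close> is the area of \<open>f ` S\<close>, which is finite.\<close>

lemma integrable_norm_deriv_squared:
  fixes f f' :: "complex \<Rightarrow> complex"
  assumes S: "S \<in> sets borel" and inj: "inj_on f S"
    and der: "\<And>z. z \<in> S \<Longrightarrow> (f has_field_derivative f' z) (at z within S)"
    and cont: "continuous_on S f'"
    and im: "f ` S \<in> sets borel" "bounded (f ` S)"
  shows "integrable lborel (\<lambda>z. indicator S z * (norm (f' z))\<^sup>2)"
proof -
  let ?T = complex_of_vec and ?V = vec_of_complex
  define S' where "S' = ?T -` S"
  define g where "g = ?V \<circ> f \<circ> ?T"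
  define g' where "g' v = (\<lambda>h. ?V (f' (?T v) * ?T h))" for v
  have [measurable]: "?T \<in> borel_measurable borel" "?V \<in> borel_measurable borel"
    by (intro borel_measurable_continuous_onI linear_continuous_on bounded_linear_complex_of_vec bounded_linear_vec_of_complex)+
  have [measurable]: "S' \<in> sets borel"
    using measurable_sets[of ?T borel borel S] S by (simp add: S'_def)
  then have "S' \<in> sets lebesgue" by simp
  moreover have "(g has_derivative g' v) (at v within S')" if "v \<in> S'" for v
  proof -
    have "?T v \<in> S" using that by (simp add: S'_def)
    have "(f has_derivative (*) (f' (?T v))) (at (?T v) within S)"
      using der[OF \<open>?T v \<in> S\<close>] by (simp add: has_field_derivative_def)
    then have f: "(f has_derivative (*) (f' (?T v))) (at (?T v) within ?T ` S')"
      by (rule has_derivative_subset) (auto simp: S'_def)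
    have T: "(?T has_derivative ?T) (at v within S')"
      by (intro bounded_linear_imp_has_derivative bounded_linear_complex_of_vec)
    have V: "(?V has_derivative ?V) (at (f (?T v)))"
      by (intro bounded_linear_imp_has_derivative bounded_linear_vec_of_complex)
    have "((f \<circ> ?T) has_derivative ((*) (f' (?T v)) \<circ> ?T)) (at v within S')"
      using diff_chain_within[OF T f] .
    then have "((\<lambda>x. ?V ((f \<circ> ?T) x)) has_derivative (\<lambda>x. ?V (((*) (f' (?T v)) \<circ> ?T) x))) (at v within S')"
      using bounded_linear.has_derivative[OF bounded_linear_vec_of_complex] by blast
    then show ?thesis by (simp add: g_def g'_def o_def)
  qed
  moreover have "inj_on g S'"
    using inj unfolding g_def S'_def inj_on_def by (metis comp_apply complex_vec_inverse vimage_eq)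
  ultimately have iff: "g ` S' \<in> lmeasurable \<longleftrightarrow> (\<lambda>x. \<bar>det (matrix (g' x))\<bar>) absolutely_integrable_on S'"
    by (rule measurable_differentiable_image_alt)
  have gS: "g ` S' = ?T -` (f ` S)"
  proof -
    have "?T ` S' = S" unfolding S'_def by (metis complex_vec_inverse(1) surjI surj_image_vimage_eq)
    then have "g ` S' = ?V ` f ` S" unfolding g_def by (metis image_comp)
    also have "\<dots> = ?T -` (f ` S)" by (auto simp: image_iff) (metis complex_vec_inverse(2))
    finally show ?thesis .
  qed
  have "g ` S' \<in> sets borel"
    unfolding gS using measurable_sets[of ?T borel borel "f ` S"] im(1) by simp
  moreover have "bounded (g ` S')"
  proof -
    have "g ` S' = ?V ` (f ` S)" unfolding gS by (auto simp: image_iff) (metis complex_vec_inverse(2))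
    then show ?thesis using bounded_linear_image[OF im(2) bounded_linear_vec_of_complex] by simp
  qed
  ultimately have "g ` S' \<in> lmeasurable" by (intro bounded_set_imp_lmeasurable) auto
  then have int: "integrable lebesgue (\<lambda>v. indicator S' v *\<^sub>R \<bar>det (matrix (g' v))\<bar>)"
    using iff by (simp add: set_integrable_def)
  have eq: "indicator S' v *\<^sub>R \<bar>det (matrix (g' v))\<bar> = indicator S (?T v) * (norm (f' (?T v)))\<^sup>2" for v
    unfolding g'_def Jacobian_complex_multiplication by (simp add: S'_def indicator_def)
  have meas: "(\<lambda>z. indicator S z * (norm (f' z))\<^sup>2) \<in> borel_measurable borel"
  proof -
    have "continuous_on S (\<lambda>z. (norm (f' z))\<^sup>2)" by (intro continuous_intros cont)
    from borel_measurable_continuous_on_indicator[OF S this] show ?thesis by simp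
  qed
  have "integrable lebesgue (\<lambda>v. indicator S (?T v) * (norm (f' (?T v)))\<^sup>2)" using int unfolding eq .
  then have "integrable lborel (\<lambda>v. indicator S (?T v) * (norm (f' (?T v)))\<^sup>2)"
    using measurable_compose[OF _ meas, of ?T lborel] by (subst (asm) integrable_completion) auto
  then have "integrable (distr lborel borel ?T) (\<lambda>z. indicator S z * (norm (f' z))\<^sup>2)"
    using meas by (subst integrable_distr_eq) auto
  then show ?thesis by (simp add: lborel_complex_vec)
qed

section \<open>Fundamental theorem of calculus on almost every line\<close>

lemma line_integral_of_derivative:
  fixes \<phi> d\<phi> :: "complex \<Rightarrow> complex" and z0 u :: complex and E :: "complex set"
  defines "\<gamma> \<equiv> \<lambda>s. z0 + of_real s * u"
  defines "g \<equiv> \<lambda>s. if \<gamma> s \<in> E then 0 else d\<phi> (\<gamma> s)"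
  assumes "a \<le> b" and "closed E" and null: "negligible {s. \<gamma> s \<in> E}"
    and cont: "continuous_on (\<gamma> ` {a..b}) \<phi>"
    and der: "\<And>s. s \<in> {a..b} \<Longrightarrow> \<gamma> s \<notin> E \<Longrightarrow> (\<phi> has_field_derivative d\<phi> (\<gamma> s)) (at (\<gamma> s))"
    and int: "integrable lborel (\<lambda>s. indicator {a..b} s *\<^sub>R g s)"
    and cover: "\<And>e. e > 0 \<Longrightarrow> \<exists>J D w. finite (J::'j set) \<and>
        (\<forall>j\<in>J. closed (D j) \<and> 0 \<le> w j \<and> (\<forall>x\<in>D j. \<forall>y\<in>D j. norm (\<phi> x - \<phi> y) \<le> w j)) \<and>
        \<gamma> ` {a..b} \<inter> E \<subseteq> (\<Union>j\<in>J. D j) \<and> (\<Sum>j\<in>J. w j) < e"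
  shows "(LINT s|lborel. indicator {a..b} s *\<^sub>R (u * g s)) = \<phi> (\<gamma> b) - \<phi> (\<gamma> a)"
proof -
  have cont\<gamma>: "continuous_on UNIV \<gamma>" unfolding \<gamma>_def by (intro continuous_intros)
  have abs: "g absolutely_integrable_on {a..b}"
    unfolding set_integrable_def using int by (rule integrable_completion[THEN iffD2, rotated]) (use int in auto)
  then have abs': "(\<lambda>s. u * g s) absolutely_integrable_on {a..b}"
    by (rule set_integrable_mult_right)
  have "integral {a..b} (\<lambda>s. u * g s) = (\<phi> \<circ> \<gamma>) b - (\<phi> \<circ> \<gamma>) a"
  proof (rule integral_derivative_off_small_image[where K = "\<gamma> -` E" and 'j = 'j])
    show "closed (\<gamma> -` E)" using \<open>closed E\<close> cont\<gamma> by (rule closed_vimage)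
    show "negligible (\<gamma> -` E)" using null by (simp add: vimage_def)
    show "continuous_on {a..b} (\<phi> \<circ> \<gamma>)"
      using cont cont\<gamma> by (intro continuous_on_compose) (auto elim: continuous_on_subset)
    show "((\<phi> \<circ> \<gamma>) has_vector_derivative u * g s) (at s)" if "s \<in> {a<..<b} - \<gamma> -` E" for s
    proof -
      have "(\<phi> has_field_derivative d\<phi> (\<gamma> s)) (at (\<gamma> s))" using that by (intro der) auto
      moreover have "(\<gamma> has_vector_derivative u) (at s)"
        unfolding \<gamma>_def by (auto intro!: derivative_eq_intros)
      ultimately have "((\<phi> \<circ> \<gamma>) has_vector_derivative u * d\<phi> (\<gamma> s)) (at s)"
        using field_vector_diff_chain_at by blast
      then show ?thesis using that by (simp add: g_def)
    qed
    fix e :: real assume "e > 0"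
    from cover[OF this] obtain J :: "'j set" and D w where J: "finite J"
      "\<forall>j\<in>J. closed (D j) \<and> 0 \<le> w j \<and> (\<forall>x\<in>D j. \<forall>y\<in>D j. norm (\<phi> x - \<phi> y) \<le> w j)"
      "\<gamma> ` {a..b} \<inter> E \<subseteq> (\<Union>j\<in>J. D j)" "(\<Sum>j\<in>J. w j) < e"
      by (elim exE conjE) (rule that)
    show "\<exists>J D w. finite (J::'j set) \<and> (\<forall>j\<in>J. closed (D j) \<and> 0 \<le> w j \<and>
        (\<forall>x\<in>D j \<inter> {a..b}. \<forall>y\<in>D j \<inter> {a..b}. norm ((\<phi> \<circ> \<gamma>) x - (\<phi> \<circ> \<gamma>) y) \<le> w j)) \<and>
        \<gamma> -` E \<inter> {a<..<b} \<subseteq> (\<Union>j\<in>J. D j) \<and> (\<Sum>j\<in>J. w j) < e"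
    proof (intro exI[of _ J] exI[of _ "\<lambda>j. \<gamma> -` D j"] exI[of _ w] conjI ballI)
      show "closed (\<gamma> -` D j)" if "j \<in> J" for j
        using J(2) that cont\<gamma> by (intro closed_vimage) auto
      show "\<gamma> -` E \<inter> {a<..<b} \<subseteq> (\<Union>j\<in>J. \<gamma> -` D j)"
      proof
        fix s assume "s \<in> \<gamma> -` E \<inter> {a<..<b}"
        then have "\<gamma> s \<in> \<gamma> ` {a..b} \<inter> E" by auto
        then show "s \<in> (\<Union>j\<in>J. \<gamma> -` D j)" using J(3) by blast
      qed
    qed (use J(1,2,4) in auto)
  qed (use \<open>a \<le> b\<close> abs' in auto)
  moreover have "integral {a..b} (\<lambda>s. u * g s) = (LINT s:{a..b}|lebesgue. u * g s)"
    using abs' by (rule set_lebesgue_integral_eq_integral(2)[symmetric])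
  moreover have "(LINT s:{a..b}|lebesgue. u * g s) = (LINT s|lborel. indicator {a..b} s *\<^sub>R (u * g s))"
  proof -
    have "(\<lambda>s. u * (indicator {a..b} s *\<^sub>R g s)) \<in> borel_measurable lborel"
      using borel_measurable_integrable[OF int] by (rule borel_measurable_times[OF borel_measurable_const])
    then have "(\<lambda>s. indicator {a..b} s *\<^sub>R (u * g s)) \<in> borel_measurable lborel"
      by (simp only: mult_scaleR_right)
    then show ?thesis unfolding set_lebesgue_integral_def by (rule integral_completion)
  qed
  ultimately show ?thesis by simp
qed

text \<open>For \<open>\<pi> = Re\<close> or \<open>\<pi> = Im\<close>, the levels \<open>y\<close> of \<open>\<pi>\<close> that meet \<open>D j\<close> form a set of measure at most the
  diameter of \<open>D j\<close>. So the total weight \<open>h y\<close> of the pieces of a cover that meet level \<open>y\<close> has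
  integral at most \<open>\<Sum>j\<in>J. w * diameter (D j)\<close>. For a sequence of covers along which these sums tend
  to \<open>0\<close>, the pointwise infimum of the functions \<open>h\<close> has integral \<open>0\<close> and vanishes almost everywhere.\<close>

lemma AE_line_small_cover:
  fixes \<pi> :: "complex \<Rightarrow> real" and \<phi> :: "complex \<Rightarrow> complex"
  assumes lip: "\<And>x y. \<bar>\<pi> x - \<pi> y\<bar> \<le> dist x y"
    and cover: "\<And>e. e > 0 \<Longrightarrow> \<exists>(J::'j set) D w. finite J \<and> 0 \<le> w \<and>
      (\<forall>j\<in>J. compact (D j) \<and> (\<forall>x\<in>D j. \<forall>y\<in>D j. norm (\<phi> x - \<phi> y) \<le> w)) \<and>
      K \<subseteq> (\<Union>j\<in>J. D j) \<and> (\<Sum>j\<in>J. w * diameter (D j)) < e"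
  shows "AE y in lborel. \<forall>e>0. \<exists>(J::'j set) D w. finite J \<and>
      (\<forall>j\<in>J. closed (D j) \<and> 0 \<le> w j \<and> (\<forall>x\<in>D j. \<forall>z\<in>D j. norm (\<phi> x - \<phi> z) \<le> w j)) \<and>
      K \<inter> \<pi> -` {y} \<subseteq> (\<Union>j\<in>J. D j) \<and> (\<Sum>j\<in>J. w j) < e"
proof -
  have "\<forall>n. \<exists>(J::'j set) D w. finite J \<and> 0 \<le> w \<and>
      (\<forall>j\<in>J. compact (D j) \<and> (\<forall>x\<in>D j. \<forall>y\<in>D j. norm (\<phi> x - \<phi> y) \<le> w)) \<and>
      K \<subseteq> (\<Union>j\<in>J. D j) \<and> (\<Sum>j\<in>J. w * diameter (D j)) < inverse (real (Suc n))"
    by (intro allI cover) simp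
  then obtain J :: "nat \<Rightarrow> 'j set" and D w where J: "\<And>n. finite (J n)" "\<And>n. 0 \<le> w n"
    "\<And>n j. j \<in> J n \<Longrightarrow> compact (D n j)"
    "\<And>n j x y. j \<in> J n \<Longrightarrow> x \<in> D n j \<Longrightarrow> y \<in> D n j \<Longrightarrow> norm (\<phi> x - \<phi> y) \<le> w n"
    "\<And>n. K \<subseteq> (\<Union>j\<in>J n. D n j)" "\<And>n. (\<Sum>j\<in>J n. w n * diameter (D n j)) < inverse (real (Suc n))"
    by metis
  have cont: "continuous_on A \<pi>" for A
    unfolding continuous_on_iff using lip by (metis dist_real_def le_less_trans)
  have comp: "compact (\<pi> ` D n j)" if "j \<in> J n" for n j
    using J(3)[OF that] cont by (intro compact_continuous_image)
  have em: "emeasure lborel (\<pi> ` D n j) \<le> ennreal (diameter (D n j))" if j: "j \<in> J n" for n j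
  proof (cases "D n j = {}")
    case False
    obtain x where x: "x \<in> D n j" "\<And>z. z \<in> D n j \<Longrightarrow> \<pi> x \<le> \<pi> z"
      using continuous_attains_inf[OF J(3)[OF j] False cont] by blast
    obtain y where y: "y \<in> D n j" "\<And>z. z \<in> D n j \<Longrightarrow> \<pi> z \<le> \<pi> y"
      using continuous_attains_sup[OF J(3)[OF j] False cont] by blast
    have "emeasure lborel (\<pi> ` D n j) \<le> emeasure lborel {\<pi> x..\<pi> y}"
      using x(2) y(2) by (intro emeasure_mono) auto
    also have "\<dots> = ennreal (\<pi> y - \<pi> x)" using x(2) y(1) by simp
    also have "\<dots> \<le> ennreal (diameter (D n j))"
      using lip[of y x] diameter_bounded_bound[OF compact_imp_bounded[OF J(3)[OF j]] y(1) x(1)]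
      by (intro ennreal_leI) linarith
    finally show ?thesis .
  qed simp
  define h where "h n y = (\<Sum>j\<in>J n. ennreal (w n) * indicator (\<pi> ` D n j) y)" for n y
  have im[measurable]: "\<pi> ` D n j \<in> sets borel" if "j \<in> J n" for n j
    using comp[OF that] by (intro borel_closed compact_imp_closed)
  have ind: "(\<lambda>y. ennreal (w n) * indicator (\<pi> ` D n j) y) \<in> borel_measurable lborel" if "j \<in> J n" for n j
    using im[OF that] by simp
  have meas: "h n \<in> borel_measurable lborel" for n
    unfolding h_def using ind by (rule borel_measurable_sum)
  have bound: "(\<integral>\<^sup>+ y. (INF n. h n y) \<partial>lborel) \<le> ennreal (inverse (real (Suc n)))" for n
  proof -
    have "(\<integral>\<^sup>+ y. (INF n. h n y) \<partial>lborel) \<le> (\<integral>\<^sup>+ y. h n y \<partial>lborel)"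
      by (intro nn_integral_mono INF_lower) simp
    also have "\<dots> = (\<Sum>j\<in>J n. \<integral>\<^sup>+ y. ennreal (w n) * indicator (\<pi> ` D n j) y \<partial>lborel)"
      unfolding h_def using ind by (rule nn_integral_sum)
    also have "\<dots> = (\<Sum>j\<in>J n. ennreal (w n) * emeasure lborel (\<pi> ` D n j))"
      using im by (intro sum.cong nn_integral_cmult_indicator refl) auto
    also have "\<dots> \<le> (\<Sum>j\<in>J n. ennreal (w n) * ennreal (diameter (D n j)))"
      using em by (intro sum_mono mult_left_mono) auto
    also have "\<dots> = ennreal (\<Sum>j\<in>J n. w n * diameter (D n j))"
      using J(2) diameter_ge_0[OF compact_imp_bounded[OF J(3)]]
      by (subst sum_ennreal[symmetric]) (auto simp: ennreal_mult)
    also have "\<dots> \<le> ennreal (inverse (real (Suc n)))" using J(6)[of n] by (intro ennreal_leI) simp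
    finally show ?thesis .
  qed
  have "(\<integral>\<^sup>+ y. (INF n. h n y) \<partial>lborel) \<le> 0"
  proof (rule LIMSEQ_le_const)
    have "(\<lambda>n. ennreal (inverse (real (Suc n)))) \<longlonglongrightarrow> ennreal 0"
      by (intro tendsto_ennrealI LIMSEQ_inverse_real_of_nat)
    then show "(\<lambda>n. ennreal (inverse (real (Suc n)))) \<longlonglongrightarrow> 0" by simp
  qed (use bound in auto)
  then have "(\<integral>\<^sup>+ y. (INF n. h n y) \<partial>lborel) = 0" by simp
  then have "AE y in lborel. (INF n. h n y) = 0"
    using meas by (subst (asm) nn_integral_0_iff_AE) auto
  then show ?thesis
  proof eventually_elim
    case (elim y)
    show ?case
    proof (intro allI impI)
      fix e :: real assume "e > 0"
      then have "(INF n. h n y) < ennreal e" using elim by simp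
      then obtain n where n: "h n y < ennreal e" by (auto simp: INF_less_iff)
      define J' where "J' = {j \<in> J n. y \<in> \<pi> ` D n j}"
      have "h n y = (\<Sum>j\<in>J n. if y \<in> \<pi> ` D n j then ennreal (w n) else 0)"
        unfolding h_def by (intro sum.cong) (auto simp: indicator_def)
      also have "\<dots> = (\<Sum>j\<in>J'. ennreal (w n))"
        unfolding J'_def by (rule sum.inter_filter[OF J(1), symmetric])
      also have "\<dots> = ennreal (\<Sum>j\<in>J'. w n)" using J(2) by (intro sum_ennreal) auto
      finally have less: "(\<Sum>j\<in>J'. w n) < e"
        using n J(2) \<open>e > 0\<close> by (simp add: ennreal_less_iff sum_nonneg)
      show "\<exists>(J::'j set) D w. finite J \<and>
        (\<forall>j\<in>J. closed (D j) \<and> 0 \<le> w j \<and> (\<forall>x\<in>D j. \<forall>z\<in>D j. norm (\<phi> x - \<phi> z) \<le> w j)) \<and>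
        K \<inter> \<pi> -` {y} \<subseteq> (\<Union>j\<in>J. D j) \<and> (\<Sum>j\<in>J. w j) < e"
      proof (intro exI[of _ J'] exI[of _ "D n"] exI[of _ "\<lambda>_. w n"] conjI ballI)
        show "K \<inter> \<pi> -` {y} \<subseteq> (\<Union>j\<in>J'. D n j)" using J(5)[of n] by (fastforce simp: J'_def)
      qed (use J less in \<open>auto simp: J'_def intro: compact_imp_closed\<close>)
    qed
  qed
qed

text \<open>Extended by zero, \<open>d\<phi>\<close> becomes a function \<open>G\<close> that is integrable over the rectangle because it is
  square integrable. On almost every horizontal line its integral is the increment of \<open>\<phi>\<close> between the
  two vertical sides, and \<open>\<i>\<close> times its integral over almost every vertical line is the increment
  between the two horizontal sides. Integrating both in the other variable gives the two sides of the
  claim, by Fubini's theorem.\<close>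

lemma vanishing_rectangle_integral_off_thin_set:
  fixes \<phi> d\<phi> :: "complex \<Rightarrow> complex"
  assumes pq: "Re p \<le> Re q" "Im p \<le> Im q"
    and cont: "continuous_on (cbox p q) \<phi>" and inj: "inj_on \<phi> (cbox p q)"
    and "closed E" and null: "E \<in> null_sets lborel"
    and der: "\<And>z. z \<in> cbox p q - E \<Longrightarrow> (\<phi> has_field_derivative d\<phi> z) (at z)"
    and contd: "continuous_on (cbox p q - E) d\<phi>"
    and cover: "\<And>e. e > 0 \<Longrightarrow> \<exists>(J::'j set) D w. finite J \<and> 0 \<le> w \<and>
      (\<forall>j\<in>J. compact (D j) \<and> (\<forall>x\<in>D j. \<forall>y\<in>D j. norm (\<phi> x - \<phi> y) \<le> w)) \<and>
      cbox p q \<inter> E \<subseteq> (\<Union>j\<in>J. D j) \<and> (\<Sum>j\<in>J. w * diameter (D j)) < e"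
  shows "vanishing_rectangle_integral \<phi> p q"
proof -
  define B where "B = cbox p q - E"
  define G where "G z = indicator B z *\<^sub>R d\<phi> z" for z
  have [measurable]: "B \<in> sets borel" using \<open>closed E\<close> by (simp add: B_def)
  have "\<phi> ` B = \<phi> ` cbox p q - \<phi> ` (cbox p q \<inter> E)"
    using inj by (auto simp: B_def inj_on_def)
  moreover have "compact (\<phi> ` cbox p q)" using cont by (intro compact_continuous_image) auto
  moreover have "compact (\<phi> ` (cbox p q \<inter> E))"
    using continuous_on_subset[OF cont] \<open>closed E\<close> by (intro compact_continuous_image compact_Int_closed) auto
  ultimately have im: "\<phi> ` B \<in> sets borel" "bounded (\<phi> ` B)"
    by (auto simp: compact_imp_closed compact_imp_bounded intro: bounded_diff)
  have sq: "integrable lborel (\<lambda>z. indicator B z * (norm (d\<phi> z))\<^sup>2)"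
  proof (rule integrable_norm_deriv_squared[OF _ _ _ _ im])
    show "inj_on \<phi> B" using inj by (rule inj_on_subset) (auto simp: B_def)
    show "(\<phi> has_field_derivative d\<phi> z) (at z within B)" if "z \<in> B" for z
      using der[of z] that by (auto simp: B_def intro: has_field_derivative_at_within)
    show "continuous_on B d\<phi>" using contd by (simp add: B_def)
  qed simp
  have measG [measurable]: "G \<in> borel_measurable borel"
    unfolding G_def using \<open>B \<in> sets borel\<close> contd
    by (intro borel_measurable_continuous_on_indicator) (simp_all only: B_def)
  have intG: "integrable lborel G"
  proof (rule Bochner_Integration.integrable_bound)
    have "integrable lborel (indicator (cbox p q) :: complex \<Rightarrow> real)"
      using emeasure_bounded_finite[OF bounded_cbox, of p q] by (intro integrable_real_indicator) auto
    then show "integrable lborel (\<lambda>z. indicator (cbox p q) z + indicator B z * (norm (d\<phi> z))\<^sup>2 :: real)"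
      using sq by (rule Bochner_Integration.integrable_add)
    have "norm (G z) \<le> norm (indicator (cbox p q) z + indicator B z * (norm (d\<phi> z))\<^sup>2 :: real)" for z
    proof -
      \<comment> \<open>From \<open>0 \<le> (x - 1/2)\<^sup>2\<close> for \<open>x = norm (d\<phi> z)\<close>.\<close>
      have "norm (d\<phi> z) \<le> 1 + (norm (d\<phi> z))\<^sup>2"
        using sum_power2_ge_zero[of "norm (d\<phi> z) - 1/2" 0] by (simp add: power2_eq_square algebra_simps)
      then show ?thesis by (auto simp: G_def B_def indicator_def)
    qed
    then show "AE z in lborel. norm (G z) \<le> norm (indicator (cbox p q) z + indicator B z * (norm (d\<phi> z))\<^sup>2 :: real)"
      by simp
  qed simp
  have Tmeas [measurable]: "(\<lambda>(x, y). Complex x y) \<in> borel_measurable (lborel \<Otimes>\<^sub>M lborel)"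
  proof -
    have "(\<lambda>(x, y). Complex x y) \<in> borel_measurable borel"
      unfolding split_beta' Complex_eq by (intro borel_measurable_continuous_onI continuous_intros)
    then show ?thesis by (simp add: lborel_prod)
  qed
  have "integrable (distr (lborel \<Otimes>\<^sub>M lborel) borel (\<lambda>(x, y). Complex x y)) G"
    using intG by (simp add: lborel_prod lborel_complex_prod)
  then have int2: "integrable (lborel \<Otimes>\<^sub>M lborel) (\<lambda>(x, y). G (Complex x y))"
    by (subst (asm) integrable_distr_eq) (auto simp: split_beta')
  have "AE z in distr (lborel \<Otimes>\<^sub>M lborel) borel (\<lambda>(x, y). Complex x y). z \<notin> E"
    using null by (simp add: lborel_prod lborel_complex_prod AE_not_in)
  then have AE2: "AE z in lborel \<Otimes>\<^sub>M lborel. Complex (fst z) (snd z) \<notin> E"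
  proof (subst (asm) AE_distr_iff)
    have "{z. z \<notin> E} = - E" by auto
    then show "{x \<in> space borel. x \<notin> E} \<in> sets borel" using \<open>closed E\<close> by simp
  qed (auto simp: split_beta')
  have AEx: "AE x in lborel. AE y in lborel. Complex x y \<notin> E"
    using lborel_pair.AE_pair[OF AE2] by simp
  have "{z \<in> space (lborel \<Otimes>\<^sub>M lborel). Complex (fst z) (snd z) \<notin> E} \<in> sets (lborel \<Otimes>\<^sub>M lborel)"
  proof -
    have "(\<lambda>(x, y). Complex x y) -` (- E) \<inter> space (lborel \<Otimes>\<^sub>M lborel) \<in> sets (lborel \<Otimes>\<^sub>M lborel)"
      by (rule measurable_sets[OF Tmeas]) (use \<open>closed E\<close> in auto)
    also have "(\<lambda>(x, y). Complex x y) -` (- E) \<inter> space (lborel \<Otimes>\<^sub>M lborel) =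
        {z \<in> space (lborel \<Otimes>\<^sub>M lborel). Complex (fst z) (snd z) \<notin> E}"
      by (auto simp: split_beta')
    finally show ?thesis .
  qed
  then have AEy: "AE y in lborel. AE x in lborel. Complex x y \<notin> E"
    using AEx by (subst lborel_pair.AE_commute[symmetric]) simp_all
  have negl: "negligible {s. \<gamma> s \<in> E}"
    if "AE s in lborel. \<gamma> s \<notin> E" "continuous_on UNIV \<gamma>" for \<gamma> :: "real \<Rightarrow> complex"
  proof -
    have "closed (\<gamma> -` E)" using \<open>closed E\<close> that(2) by (rule closed_vimage)
    then have "\<gamma> -` E \<in> sets lborel" by simp
    then have "\<gamma> -` E \<in> null_sets lborel" using that(1) by (subst AE_iff_null_sets) auto
    then show ?thesis by (simp add: negligible_iff_null_sets null_sets_completionI vimage_def)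
  qed
  have line_cover: "AE y in lborel. \<forall>e>0. \<exists>(J::'j set) D w. finite J \<and>
      (\<forall>j\<in>J. closed (D j) \<and> 0 \<le> w j \<and> (\<forall>x\<in>D j. \<forall>z\<in>D j. norm (\<phi> x - \<phi> z) \<le> w j)) \<and>
      cbox p q \<inter> E \<inter> \<pi> -` {y} \<subseteq> (\<Union>j\<in>J. D j) \<and> (\<Sum>j\<in>J. w j) < e"
    if "\<And>x y. \<bar>\<pi> x - \<pi> y\<bar> \<le> dist x y" for \<pi> :: "complex \<Rightarrow> real"
    by (rule AE_line_small_cover[OF that cover])
  have line: "(LINT s|lborel. u * G (z0 + of_real s * u)) = \<phi> (z0 + of_real b * u) - \<phi> (z0 + of_real a * u)"
    if "a \<le> b" and sub: "\<And>s. z0 + of_real s * u \<in> cbox p q \<longleftrightarrow> s \<in> {a..b}"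
      and AE: "AE s in lborel. z0 + of_real s * u \<notin> E"
      and int: "integrable lborel (\<lambda>s. G (z0 + of_real s * u))"
      and cov: "\<forall>e>0. \<exists>(J::'j set) D w. finite J \<and>
        (\<forall>j\<in>J. closed (D j) \<and> 0 \<le> w j \<and> (\<forall>x\<in>D j. \<forall>z\<in>D j. norm (\<phi> x - \<phi> z) \<le> w j)) \<and>
        cbox p q \<inter> E \<inter> L \<subseteq> (\<Union>j\<in>J. D j) \<and> (\<Sum>j\<in>J. w j) < e"
      and L: "\<And>s. z0 + of_real s * u \<in> L"
    for a b z0 u L
  proof -
    define \<gamma> where "\<gamma> s = z0 + of_real s * u" for s
    define g where "g s = (if \<gamma> s \<in> E then 0 else d\<phi> (\<gamma> s))" for s
    have Gg: "G (\<gamma> s) = indicator {a..b} s *\<^sub>R g s" for s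
      using sub[of s] by (auto simp: G_def B_def g_def \<gamma>_def indicator_def)
    have \<gamma>_sub: "\<gamma> ` {a..b} \<subseteq> cbox p q" unfolding \<gamma>_def using sub by blast
    have "(LINT s|lborel. indicator {a..b} s *\<^sub>R (u * g s)) = \<phi> (\<gamma> b) - \<phi> (\<gamma> a)"
      unfolding g_def \<gamma>_def
    proof (rule line_integral_of_derivative[where 'j = 'j, OF \<open>a \<le> b\<close> \<open>closed E\<close>], fold \<gamma>_def)
      show "negligible {s. \<gamma> s \<in> E}"
        using AE unfolding \<gamma>_def by (intro negl continuous_intros)
      show "continuous_on (\<gamma> ` {a..b}) \<phi>" using cont \<gamma>_sub by (rule continuous_on_subset)
      show "(\<phi> has_field_derivative d\<phi> (\<gamma> s)) (at (\<gamma> s))" if "s \<in> {a..b}" "\<gamma> s \<notin> E" for s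
        using der \<gamma>_sub that by blast
      show "integrable lborel (\<lambda>s. indicator {a..b} s *\<^sub>R (if \<gamma> s \<in> E then 0 else d\<phi> (\<gamma> s)))"
        using int unfolding \<gamma>_def[symmetric] Gg unfolding g_def .
      fix e :: real assume "e > 0"
      from cov[rule_format, OF this] obtain J :: "'j set" and D w where J: "finite J"
        "\<forall>j\<in>J. closed (D j) \<and> 0 \<le> w j \<and> (\<forall>x\<in>D j. \<forall>z\<in>D j. norm (\<phi> x - \<phi> z) \<le> w j)"
        "cbox p q \<inter> E \<inter> L \<subseteq> (\<Union>j\<in>J. D j)" "(\<Sum>j\<in>J. w j) < e"
        by (elim exE conjE) (rule that)
      have "\<gamma> ` {a..b} \<inter> E \<subseteq> cbox p q \<inter> E \<inter> L"
        using \<gamma>_sub L unfolding \<gamma>_def by blast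
      with J(3) have "\<gamma> ` {a..b} \<inter> E \<subseteq> (\<Union>j\<in>J. D j)" by (rule order_trans[rotated])
      with J(1,2,4) show "\<exists>(J::'j set) D w. finite J \<and>
        (\<forall>j\<in>J. closed (D j) \<and> 0 \<le> w j \<and> (\<forall>x\<in>D j. \<forall>z\<in>D j. norm (\<phi> x - \<phi> z) \<le> w j)) \<and>
        \<gamma> ` {a..b} \<inter> E \<subseteq> (\<Union>j\<in>J. D j) \<and> (\<Sum>j\<in>J. w j) < e"
        by (intro exI[of _ J] exI[of _ D] exI[of _ w] conjI)
    qed
    then show ?thesis unfolding \<gamma>_def[symmetric] Gg by (simp only: mult_scaleR_right)
  qed
  let ?H = "\<lambda>y. \<phi> (Complex (Re q) y) - \<phi> (Complex (Re p) y)"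
  let ?V = "\<lambda>x. \<phi> (Complex x (Im q)) - \<phi> (Complex x (Im p))"
  have zero: "G z = 0" if "z \<notin> cbox p q" for z using that by (simp add: G_def B_def)
  have Im_cover: "\<bar>Im x - Im y\<bar> \<le> dist x y" and Re_cover: "\<bar>Re x - Re y\<bar> \<le> dist x y" for x y
    using abs_Im_le_cmod[of "x - y"] abs_Re_le_cmod[of "x - y"] by (simp_all add: dist_norm)
  have hor: "AE y in lborel. (LINT x|lborel. G (Complex x y)) = indicator {Im p..Im q} y *\<^sub>R ?H y"
    using AEy lborel_pair.AE_integrable_snd[OF int2] line_cover[OF Im_cover]
  proof eventually_elim
    case (elim y)
    have eq: "Complex 0 y + of_real s * 1 = Complex s y" for s by (simp add: complex_eq_iff)
    show ?case
    proof (cases "y \<in> {Im p..Im q}")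
      case True
      have "(LINT s|lborel. 1 * G (Complex 0 y + of_real s * 1)) =
          \<phi> (Complex 0 y + of_real (Re q) * 1) - \<phi> (Complex 0 y + of_real (Re p) * 1)"
        by (rule line[where L = "Im -` {y}"], unfold eq)
           (use True pq elim in \<open>auto simp: in_cbox_complex_iff\<close>)
      then show ?thesis using True unfolding eq by simp
    next
      case False
      then have "G (Complex x y) = 0" for x by (intro zero) (auto simp: in_cbox_complex_iff)
      then show ?thesis using False by simp
    qed
  qed
  have ver: "AE x in lborel. \<i> * (LINT y|lborel. G (Complex x y)) = indicator {Re p..Re q} x *\<^sub>R ?V x"
    using AEx lborel_pair.AE_integrable_fst[OF int2] line_cover[OF Re_cover]
  proof eventually_elim
    case (elim x)
    have eq: "of_real x + of_real s * \<i> = Complex x s" for s by (simp add: complex_eq_iff)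
    show ?case
    proof (cases "x \<in> {Re p..Re q}")
      case True
      have "(LINT s|lborel. \<i> * G (of_real x + of_real s * \<i>)) =
          \<phi> (of_real x + of_real (Im q) * \<i>) - \<phi> (of_real x + of_real (Im p) * \<i>)"
        by (rule line[where L = "Re -` {x}"], unfold eq)
           (use True pq elim in \<open>auto simp: in_cbox_complex_iff\<close>)
      then show ?thesis using True unfolding eq by simp
    next
      case False
      then have "G (Complex x y) = 0" for y by (intro zero) (auto simp: in_cbox_complex_iff)
      then show ?thesis using False by simp
    qed
  qed
  have contH: "continuous_on {Im p..Im q} ?H" and contV: "continuous_on {Re p..Re q} ?V"
    using pq by (auto simp: Complex_eq in_cbox_complex_iff
      intro!: continuous_intros continuous_on_compose2[OF cont])
  have "integral {Im p..Im q} ?H = (LINT y|lborel. indicator {Im p..Im q} y *\<^sub>R ?H y)"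
    using set_borel_integral_eq_integral(2)[OF borel_integrable_atLeastAtMost'[OF contH]]
    by (simp add: set_lebesgue_integral_def)
  also have "\<dots> = (LINT y|lborel. LINT x|lborel. G (Complex x y))"
  proof (rule integral_cong_AE)
    show "(\<lambda>y. indicator {Im p..Im q} y *\<^sub>R ?H y) \<in> borel_measurable lborel"
      using borel_measurable_continuous_on_indicator[OF _ contH] by simp
    show "(\<lambda>y. LINT x|lborel. G (Complex x y)) \<in> borel_measurable lborel"
      using lborel_pair.integrable_snd[OF int2] by (rule borel_measurable_integrable)
  qed (use hor in eventually_elim, simp)
  also have "\<dots> = (LINT x|lborel. LINT y|lborel. G (Complex x y))"
    using lborel_pair.Fubini_integral[OF int2] .
  finally have "\<i> * integral {Im p..Im q} ?H = (LINT x|lborel. \<i> * (LINT y|lborel. G (Complex x y)))" by simp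
  also have "\<dots> = (LINT x|lborel. indicator {Re p..Re q} x *\<^sub>R ?V x)"
  proof (rule integral_cong_AE)
    show "(\<lambda>x. indicator {Re p..Re q} x *\<^sub>R ?V x) \<in> borel_measurable lborel"
      using borel_measurable_continuous_on_indicator[OF _ contV] by simp
    show "(\<lambda>x. \<i> * (LINT y|lborel. G (Complex x y))) \<in> borel_measurable lborel"
      using borel_measurable_integrable[OF lborel_pair.integrable_fst[OF int2]] by simp
  qed (rule ver)
  also have "\<dots> = integral {Re p..Re q} ?V"
    using set_borel_integral_eq_integral(2)[OF borel_integrable_atLeastAtMost'[OF contV]]
    by (simp add: set_lebesgue_integral_def)
  finally show ?thesis by (simp add: vanishing_rectangle_integral_def)
qed

section \<open>Hitting times and crossings\<close>

lemma first_hit_after_properties: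
  fixes \<eta> :: "real \<Rightarrow> complex"
  assumes cont: "continuous_on {0..} \<eta>" and "0 \<le> t" "t \<le> v"
    and t: "dist (\<eta> t) z < r" and v: "r \<le> dist (\<eta> v) z"
  shows "t < first_hit_after \<eta> z r t" "first_hit_after \<eta> z r t \<le> v"
    and "dist (\<eta> (first_hit_after \<eta> z r t)) z = r"
    and "\<And>s. t \<le> s \<Longrightarrow> s < first_hit_after \<eta> z r t \<Longrightarrow> dist (\<eta> s) z < r"
proof -
  let ?X = "{s. t \<le> s \<and> \<eta> s \<in> sphere z r}"
  let ?\<tau> = "first_hit_after \<eta> z r t"
  have contd: "continuous_on {0..} (\<lambda>s. dist (\<eta> s) z)"
    using cont by (intro continuous_intros)
  have hit: "\<exists>s'\<in>?X. s' \<le> s" if hs: "t \<le> s" "r \<le> dist (\<eta> s) z" for s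
  proof -
    have "continuous_on {t..s} (\<lambda>s. dist (\<eta> s) z)"
      using contd \<open>0 \<le> t\<close> by (auto elim: continuous_on_subset)
    then obtain x where "t \<le> x" "x \<le> s" "dist (\<eta> x) z = r"
      using IVT'[of "\<lambda>s. dist (\<eta> s) z" t r s] t hs by auto
    then show ?thesis by (auto simp: dist_commute)
  qed
  have "closed ({0..} \<inter> \<eta> -` sphere z r)"
    using cont by (intro continuous_closed_preimage) auto
  then have "closed ({t..} \<inter> ({0..} \<inter> \<eta> -` sphere z r))"
    by (rule closed_Int[rotated]) (rule closed_real_atLeast closed_real_atMost)
  moreover have "?X = {t..} \<inter> ({0..} \<inter> \<eta> -` sphere z r)" using \<open>0 \<le> t\<close> by auto
  ultimately have "closed ?X" by simp
  have bdd: "bdd_below ?X" by (auto intro!: bdd_belowI[of _ t])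
  have "?X \<noteq> {}" using hit[OF \<open>t \<le> v\<close> v] by auto
  then have \<tau>: "?\<tau> \<in> ?X"
    unfolding first_hit_after_def using \<open>closed ?X\<close> bdd by (intro closed_contains_Inf)
  have low: "?\<tau> \<le> s" if "s \<in> ?X" for s
    unfolding first_hit_after_def using that bdd by (intro cInf_lower)
  show "dist (\<eta> ?\<tau>) z = r" using \<tau> by (auto simp: dist_commute)
  then show "t < ?\<tau>" using \<tau> t by (cases "t = ?\<tau>") auto
  show "?\<tau> \<le> v" using hit[OF \<open>t \<le> v\<close> v] low by force
  show "dist (\<eta> s) z < r" if "t \<le> s" "s < ?\<tau>" for s
    using hit[of s] low that by (meson leD not_le order.trans)
qed

lemma last_hit_before_properties:
  fixes \<eta> :: "real \<Rightarrow> complex"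
  assumes cont: "continuous_on {0..} \<eta>" and "0 \<le> v" "v \<le> t"
    and t: "dist (\<eta> t) z < r" and v: "r \<le> dist (\<eta> v) z"
  shows "last_hit_before \<eta> z r t < t" "v \<le> last_hit_before \<eta> z r t"
    and "dist (\<eta> (last_hit_before \<eta> z r t)) z = r"
    and "\<And>s. s \<le> t \<Longrightarrow> last_hit_before \<eta> z r t < s \<Longrightarrow> dist (\<eta> s) z < r"
proof -
  let ?X = "{s. 0 \<le> s \<and> s \<le> t \<and> \<eta> s \<in> sphere z r}"
  let ?\<sigma> = "last_hit_before \<eta> z r t"
  have contd: "continuous_on {0..} (\<lambda>s. dist (\<eta> s) z)"
    using cont by (intro continuous_intros)
  have hit: "\<exists>s'\<in>?X. s \<le> s'" if hs: "0 \<le> s" "s \<le> t" "r \<le> dist (\<eta> s) z" for s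
  proof -
    have "continuous_on {s..t} (\<lambda>s. dist (\<eta> s) z)"
      using contd that by (auto elim: continuous_on_subset)
    then obtain x where "s \<le> x" "x \<le> t" "dist (\<eta> x) z = r"
      using IVT2'[of "\<lambda>s. dist (\<eta> s) z" t r s] t hs by auto
    then show ?thesis using hs by (intro bexI[of _ x]) (auto simp: dist_commute)
  qed
  have "closed ({0..} \<inter> \<eta> -` sphere z r)"
    using cont by (intro continuous_closed_preimage) auto
  then have "closed ({..t} \<inter> ({0..} \<inter> \<eta> -` sphere z r))"
    by (rule closed_Int[rotated]) (rule closed_real_atLeast closed_real_atMost)
  moreover have "?X = {..t} \<inter> ({0..} \<inter> \<eta> -` sphere z r)" by auto
  ultimately have "closed ?X" by simp
  have bdd: "bdd_above ?X" by (auto intro!: bdd_aboveI[of _ t])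
  have ne: "?X \<noteq> {}" using hit[OF \<open>0 \<le> v\<close> \<open>v \<le> t\<close> v] by auto
  have "Sup ?X \<in> ?X" using ne \<open>closed ?X\<close> bdd by (intro closed_contains_Sup)
  moreover have "?\<sigma> = Sup ?X"
    unfolding last_hit_before_def using ne bdd calculation
    by (subst cSup_insert) (auto simp: sup_real_def max_def)
  ultimately have \<sigma>: "?\<sigma> \<in> ?X" by simp
  have up: "s \<le> ?\<sigma>" if "s \<in> ?X" for s
    unfolding \<open>?\<sigma> = Sup ?X\<close> using that bdd by (intro cSup_upper)
  show "dist (\<eta> ?\<sigma>) z = r" using \<sigma> by (auto simp: dist_commute)
  then show "?\<sigma> < t" using \<sigma> t by (cases "t = ?\<sigma>") auto
  show "v \<le> ?\<sigma>" using hit[OF \<open>0 \<le> v\<close> \<open>v \<le> t\<close> v] up by force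
  show "dist (\<eta> s) z < r" if "s \<le> t" "?\<sigma> < s" for s
    using hit[of s] up that \<sigma> by (smt (verit) mem_Collect_eq)
qed

text \<open>Start at the first point of \<open>S\<close>, stop at its \<open>\<tau>\<close>, start again at the next point of \<open>S\<close>, and so on.
  Each round takes at least time \<open>c\<close>, so the bounded set \<open>S\<close> is exhausted after finitely many rounds.\<close>

lemma greedy_nonoverlapping_cover:
  fixes S :: "real set" and \<tau> :: "real \<Rightarrow> real"
  assumes "closed S" and T: "\<And>t. t \<in> S \<Longrightarrow> t \<le> T" and "c > 0"
    and step: "\<And>t. t \<in> S \<Longrightarrow> t + c \<le> \<tau> t"
  obtains P where "finite P" "P \<subseteq> S \<inter> {x..}" "S \<inter> {x..} \<subseteq> (\<Union>t\<in>P. {t..\<tau> t})"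
    "\<And>t u. t \<in> P \<Longrightarrow> u \<in> P \<Longrightarrow> t < u \<Longrightarrow> \<tau> t \<le> u"
proof -
  have claim: "\<exists>P. finite P \<and> P \<subseteq> S \<inter> {x..} \<and> S \<inter> {x..} \<subseteq> (\<Union>t\<in>P. {t..\<tau> t}) \<and>
          (\<forall>t\<in>P. \<forall>u\<in>P. t < u \<longrightarrow> \<tau> t \<le> u)"
    if "T < x + real n * c" for n x
    using that
  proof (induction n arbitrary: x)
    case 0
    then show ?case using T by (intro exI[of _ "{}"]) force
  next
    case (Suc n)
    show ?case
    proof (cases "S \<inter> {x..} = {}")
      case True then show ?thesis by (intro exI[of _ "{}"]) auto
    next
      case False
      define t where "t = Inf (S \<inter> {x..})"
      have bdd: "bdd_below (S \<inter> {x..})" by auto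
      have t: "t \<in> S \<inter> {x..}"
        unfolding t_def using False \<open>closed S\<close> bdd by (intro closed_contains_Inf) auto
      have low: "t \<le> s" if "s \<in> S \<inter> {x..}" for s
        unfolding t_def using that bdd by (rule cInf_lower)
      have "T < \<tau> t + real n * c" using Suc.prems step[of t] t by (auto simp: algebra_simps)
      from Suc.IH[OF this] obtain P where P: "finite P" "P \<subseteq> S \<inter> {\<tau> t..}"
        "S \<inter> {\<tau> t..} \<subseteq> (\<Union>t\<in>P. {t..\<tau> t})" "\<forall>t\<in>P. \<forall>u\<in>P. t < u \<longrightarrow> \<tau> t \<le> u"
        by blast
      have "t < \<tau> t" using step[of t] t \<open>c > 0\<close> by auto
      show ?thesis
      proof (intro exI[of _ "insert t P"] conjI)
        show "insert t P \<subseteq> S \<inter> {x..}" using t P(2) \<open>t < \<tau> t\<close> by fastforce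
        show "S \<inter> {x..} \<subseteq> (\<Union>t\<in>insert t P. {t..\<tau> t})"
        proof
          fix s assume s: "s \<in> S \<inter> {x..}"
          show "s \<in> (\<Union>t\<in>insert t P. {t..\<tau> t})"
          proof (cases "s \<le> \<tau> t")
            case True then show ?thesis using low[OF s] by auto
          next
            case False then have "s \<in> S \<inter> {\<tau> t..}" using s by auto
            then show ?thesis using P(3) by blast
          qed
        qed
        show "\<forall>t'\<in>insert t P. \<forall>u\<in>insert t P. t' < u \<longrightarrow> \<tau> t' \<le> u"
          using P(2,4) \<open>t < \<tau> t\<close> by fastforce
      qed (use P(1) in auto)
    qed
  qed
  obtain n :: nat where "(T - x) / c < real n" using reals_Archimedean2 by blast
  then have "T < x + real n * c" using \<open>c > 0\<close> by (simp add: field_simps)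
  from claim[OF this] show ?thesis using that by blast
qed

text \<open>If \<open>\<eta>\<close> is in the small ball at time \<open>t j\<close> and outside the large one at a later time \<open>s j\<close> of the same
  interval, then the excursion at time \<open>t j\<close> ends in the interior of the interval; if \<open>s j\<close> is
  earlier, it begins there. Within each of the two classes, excursions that belong to different
  intervals are therefore different; the factor \<open>2\<close> counts the classes.\<close>

lemma card_nonoverlapping_crossings_le:
  fixes \<eta> :: "real \<Rightarrow> complex" and l u :: "'i \<Rightarrow> real"
  assumes cont: "continuous_on {0..} \<eta>" and "finite P" and "\<epsilon> < r"
    and nonover: "\<And>j k. j \<in> P \<Longrightarrow> k \<in> P \<Longrightarrow> j \<noteq> k \<Longrightarrow> u j \<le> l k \<or> u k \<le> l j"
    and l: "\<And>j. j \<in> P \<Longrightarrow> 0 \<le> l j"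
    and inner: "\<And>j. j \<in> P \<Longrightarrow> \<exists>t\<in>{l j..u j}. \<eta> t \<in> ball z \<epsilon>"
    and outer: "\<And>j. j \<in> P \<Longrightarrow> \<exists>s\<in>{l j..u j}. r < dist (\<eta> s) z"
    and fin: "finite (excursions_between \<eta> z \<epsilon> r)" and card: "card (excursions_between \<eta> z \<epsilon> r) \<le> M"
  shows "card P \<le> 2 * M"
proof -
  obtain t where t: "\<And>j. j \<in> P \<Longrightarrow> l j \<le> t j \<and> t j \<le> u j \<and> dist (\<eta> (t j)) z < \<epsilon>"
    using inner by (simp add: dist_commute Bex_def) metis
  obtain s where s: "\<And>j. j \<in> P \<Longrightarrow> l j \<le> s j \<and> s j \<le> u j \<and> r < dist (\<eta> (s j)) z"
    using outer by (simp add: Bex_def) metis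
  define F where "F j = (last_hit_before \<eta> z r (t j), first_hit_after \<eta> z r (t j))" for j
  have F: "F j \<in> excursions_between \<eta> z \<epsilon> r" if "j \<in> P" for j
    unfolding F_def excursions_between_def using t[OF that] l[OF that] by (force simp: dist_commute)
  define P1 where "P1 = {j \<in> P. t j \<le> s j}"
  define P2 where "P2 = {j \<in> P. s j \<le> t j}"
  have first: "l j < snd (F j)" "snd (F j) < u j" if "j \<in> P1" for j
  proof -
    have j: "j \<in> P" "t j \<le> s j" using that by (auto simp: P1_def)
    have *: "0 \<le> t j" "dist (\<eta> (t j)) z < r" "r \<le> dist (\<eta> (s j)) z"
      using t[OF j(1)] s[OF j(1)] l[OF j(1)] \<open>\<epsilon> < r\<close> by auto
    note f = first_hit_after_properties[OF cont *(1) j(2) *(2,3)]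
    show "l j < snd (F j)" using f(1) t[OF j(1)] by (simp add: F_def)
    have "first_hit_after \<eta> z r (t j) \<noteq> s j" using f(3) s[OF j(1)] by auto
    then show "snd (F j) < u j" using f(2) s[OF j(1)] by (simp add: F_def)
  qed
  have last: "l j < fst (F j)" "fst (F j) < u j" if "j \<in> P2" for j
  proof -
    have j: "j \<in> P" "s j \<le> t j" using that by (auto simp: P2_def)
    have *: "0 \<le> s j" "dist (\<eta> (t j)) z < r" "r \<le> dist (\<eta> (s j)) z"
      using t[OF j(1)] s[OF j(1)] l[OF j(1)] \<open>\<epsilon> < r\<close> by auto
    note f = last_hit_before_properties[OF cont *(1) j(2) *(2,3)]
    show "fst (F j) < u j" using f(1) t[OF j(1)] by (simp add: F_def)
    have "last_hit_before \<eta> z r (t j) \<noteq> s j" using f(3) s[OF j(1)] by auto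
    then show "l j < fst (F j)" using f(2) s[OF j(1)] by (simp add: F_def)
  qed
  have "inj_on F P1"
    by (intro inj_onI) (use first nonover P1_def in \<open>smt (verit) mem_Collect_eq\<close>)
  moreover have "inj_on F P2"
    by (intro inj_onI) (use last nonover P2_def in \<open>smt (verit) mem_Collect_eq\<close>)
  moreover have "F ` P1 \<subseteq> excursions_between \<eta> z \<epsilon> r" "F ` P2 \<subseteq> excursions_between \<eta> z \<epsilon> r"
    using F by (auto simp: P1_def P2_def)
  ultimately have "card P1 \<le> M" "card P2 \<le> M"
    using card_inj_on_le[OF _ _ fin] card le_trans by blast+
  moreover have "P = P1 \<union> P2" by (auto simp: P1_def P2_def)
  ultimately show ?thesis using card_Un_le[of P1 P2] by auto
qed

section \<open>Points of a closed set that are visible from its complement\<close>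

lemma obtain_first_point_on_segment:
  fixes E :: "complex set"
  assumes "closed E" and "x \<in> E"
  obtains a where "a \<in> E" "a \<in> closed_segment y x" "closed_segment y a \<inter> E = {a}"
proof -
  let ?X = "closed_segment y x \<inter> E"
  have "compact ?X" using assms by (simp add: compact_Int_closed)
  moreover have "?X \<noteq> {}" using assms by auto
  moreover have "continuous_on ?X (dist y)" by (intro continuous_intros)
  ultimately obtain a where a: "a \<in> ?X" "\<And>q. q \<in> ?X \<Longrightarrow> dist y a \<le> dist y q"
    using continuous_attains_inf[of ?X "dist y"] by blast
  have "q = a" if q: "q \<in> closed_segment y a" "q \<in> E" for q
  proof -
    have "q \<in> ?X" using q a(1) by (metis Int_iff ends_in_segment(1) subset_closed_segment subsetD)
    then have 1: "dist y a \<le> dist y q" by (rule a)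
    obtain s where s: "0 \<le> s" "s \<le> 1" "q = (1 - s) *\<^sub>R y + s *\<^sub>R a"
      using q by (auto simp: in_segment)
    have "q - y = s *\<^sub>R (a - y)" using s(3) by (simp add: algebra_simps)
    then have "dist y q = s * dist y a" using s(1) by (metis dist_norm dist_commute norm_scaleR abs_of_nonneg)
    then have "s = 1 \<or> y = a" using 1 s(1,2)
      by (metis dist_pos_lt leD less_eq_real_def mult_le_cancel_right1 )
    then show ?thesis using s(3) by (auto simp: algebra_simps)
  qed
  then show ?thesis using a by (intro that[of a]) auto
qed

text \<open>The case of interest is that \<open>E\<close> is the trace of a curve and \<open>A\<close> its excursion at \<open>c\<close>. Follow the
  polygonal path from \<open>y\<close> over \<open>y0\<close> to \<open>a\<close> up to the first point \<open>q\<close> at which it leaves the open set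
  \<open>ball c \<delta> - E\<close>. Then \<open>q\<close> is a frontier point of the component of \<open>y\<close> that is reached without leaving
  \<open>ball y R\<close>, so \<open>q \<in> A\<close> by the tracing hypothesis. In particular \<open>q \<in> E\<close>, and the only point of \<open>E\<close>
  on the path is its end point \<open>a\<close>. This also excludes that the path leaves through the circle
  \<open>sphere c \<delta>\<close> before it reaches \<open>a\<close>.\<close>

lemma first_point_in_excursion:
  fixes E A :: "complex set" and y c :: complex and \<delta> :: real
  defines "C \<equiv> connected_component_set (ball c \<delta> - E) y"
  assumes "closed E" and "A \<subseteq> E" and sub: "ball y \<rho> \<subseteq> ball c \<delta> - E"
    and y0: "y0 \<in> ball y \<rho>" "y0 \<in> ball y R" and a: "a \<in> ball y R"
    and first: "closed_segment y0 a \<inter> E = {a}"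
    and tracing: "\<forall>x \<in> frontier C - A. \<forall>p.
        path p \<and> path_image p \<subseteq> C \<union> {x} \<and> pathstart p = y \<and> pathfinish p = x \<longrightarrow>
        \<not> path_image p \<subseteq> ball y R"
  shows "a \<in> A"
proof -
  let ?W = "ball c \<delta> - E"
  have "open ?W" using \<open>closed E\<close> by auto
  have "\<rho> > 0" using y0(1) by (metis dist_self ball_empty empty_iff not_le)
  then have "y \<in> ball y \<rho>" by simp
  then have "y \<in> ?W" using sub by blast
  define g where "g = linepath y y0 +++ linepath y0 a"
  have g: "path g" "pathstart g = y" "pathfinish g = a"
    "path_image g = closed_segment y y0 \<union> closed_segment y0 a"
    by (auto simp: g_def path_image_join)
  have seg: "closed_segment y y0 \<subseteq> ball y \<rho>"
    using y0(1) \<open>\<rho> > 0\<close> by (intro closed_segment_subset) auto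
  have gR: "path_image g \<subseteq> ball y R"
  proof -
    have "0 \<le> dist y y0" "dist y y0 < R" using y0(2) by auto
    then have "0 < R" by (rule le_less_trans)
    then have "y \<in> ball y R" by simp
    then show ?thesis
      unfolding g(4) using y0 a by (intro Un_least closed_segment_subset convex_ball)
  qed
  have "a \<in> E" using first by blast
  then have gW: "pathstart g \<in> ?W" "pathfinish g \<notin> ?W" using g \<open>y \<in> ?W\<close> by auto
  obtain v where v: "0 \<le> v" "v \<le> 1" "g v \<notin> interior ?W"
    "v = 0 \<or> (\<forall>x. 0 \<le> x \<and> x < 1 \<longrightarrow> subpath 0 v g x \<in> interior ?W) \<and> g v \<in> closure ?W"
    by (rule subpath_to_frontier_strong[OF g(1) gW(2)]) (rule that)
  have "v \<noteq> 0"
    using v(3) gW(1) \<open>open ?W\<close> unfolding pathstart_def by (metis interior_open)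
  then have v_in: "\<And>x. 0 \<le> x \<Longrightarrow> x < 1 \<Longrightarrow> subpath 0 v g x \<in> ?W"
    using v(4) \<open>open ?W\<close> by (simp add: interior_open)
  have v_out: "subpath 0 v g 1 \<notin> ?W"
    using v(3) \<open>open ?W\<close> by (simp add: interior_open subpath_def)
  define h where "h = subpath 0 v g"
  have "path h" unfolding h_def using v(1,2) g(1) by (intro path_subpath) auto
  moreover have "pathstart h = y" using g(2) by (simp add: h_def pathstart_def subpath_def)
  ultimately have h: "path h" "pathstart h = y" .
  have hg: "path_image h \<subseteq> path_image g"
    unfolding h_def using v by (intro path_image_subpath_subset) auto
  define q where "q = pathfinish h"
  have hW: "h ` {0..<1} \<subseteq> ?W" and q: "q \<notin> ?W"
    unfolding h_def q_def pathfinish_def using v_in v_out by fastforce+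
  have conth: "continuous_on {0..1} h" using h(1) by (simp add: path_def)
  have "connected (h ` {0..<1})"
    using conth by (intro connected_continuous_image) (auto elim: continuous_on_subset)
  moreover have "y \<in> h ` {0..<1}" using h(2) by (force simp: pathstart_def)
  ultimately have hC: "h ` {0..<1} \<subseteq> C"
    unfolding C_def using hW by (intro connected_component_maximal)
  have image_h: "path_image h = insert q (h ` {0..<1})"
  proof -
    have "{0..1::real} = insert 1 {0..<1}" by auto
    then show ?thesis by (simp add: path_image_def q_def pathfinish_def)
  qed
  have "q \<in> closure C"
  proof -
    have "closure {0..<1::real} = {0..1}" by simp
    then have "h ` {0..1} \<subseteq> closure (h ` {0..<1})"
      using image_closure_subset[of "{0..<1}" h "closure (h ` {0..<1})"] conth closure_subset
      by (metis closed_closure)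
    moreover have "q \<in> h ` {0..1}" using image_h unfolding path_image_def by simp
    ultimately show ?thesis using closure_mono[OF hC] by blast
  qed
  moreover have "C \<subseteq> ?W" unfolding C_def by (rule connected_component_subset)
  moreover have "open C" unfolding C_def using \<open>open ?W\<close> by (rule open_connected_component)
  ultimately have "q \<in> frontier C" using q by (auto simp: frontier_def interior_open)
  moreover have "path_image h \<subseteq> C \<union> {q}" using hC image_h by auto
  moreover have "path_image h \<subseteq> ball y R" using hg gR by blast
  ultimately have "q \<in> A" using tracing h q_def by blast
  then have "q \<in> E" "q \<in> path_image g" using \<open>A \<subseteq> E\<close> hg image_h by auto
  moreover have "closed_segment y y0 \<inter> E = {}" using seg sub by blast
  ultimately have "q = a" using g(4) first by blast
  then show ?thesis using \<open>q \<in> A\<close> by simp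
qed

text \<open>One visible point \<open>a\<close> is the first point of \<open>E\<close> on a segment that starts at \<open>c\<close>. It could hide all
  other points from \<open>c\<close>, for instance if \<open>E\<close> is a ray starting at \<open>a\<close> and pointing away from \<open>c\<close>.
  So the second point is observed from a base point \<open>yb\<close> near \<open>c\<close> which is not hidden behind \<open>a\<close> when
  looking towards another point \<open>x\<close> of \<open>E\<close>.\<close>

lemma obtain_two_visible_points:
  fixes E :: "complex set"
  assumes "closed E" and "0 < \<rho>" "\<rho> \<le> r"
    and x: "x1 \<in> E \<inter> ball c r" "x2 \<in> E \<inter> ball c r" "x1 \<noteq> x2"
  obtains a b ya yb where "a \<noteq> b" "ya \<in> ball c \<rho>" "yb \<in> ball c \<rho>" "a \<in> ball c r" "b \<in> ball c r"
    "closed_segment ya a \<inter> E = {a}" "closed_segment yb b \<inter> E = {b}"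
proof -
  have seg: "closed_segment y x \<subseteq> ball c r" if "y \<in> ball c \<rho>" "x \<in> ball c r" for x y
    using that \<open>\<rho> \<le> r\<close> by (intro closed_segment_subset) auto
  obtain a where a: "a \<in> E" "a \<in> closed_segment c x1" "closed_segment c a \<inter> E = {a}"
    using obtain_first_point_on_segment[OF \<open>closed E\<close>] x(1) by blast
  obtain x where x': "x \<in> E" "x \<in> ball c r" "x \<noteq> a" using x by blast
  define s where "s = \<rho> / (2 * norm (x - a))"
  have s: "s > 0" "s * norm (x - a) < \<rho>" using \<open>0 < \<rho>\<close> x'(3) by (auto simp: s_def)
  have on_line: "\<exists>k::real. y = a + of_real k * (x - a)" if aseg: "a \<in> closed_segment y x" for y
  proof -
    obtain v where v: "v \<le> 1" "a = (1 - v) *\<^sub>R y + v *\<^sub>R x" using aseg by (auto simp: in_segment)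
    have "v \<noteq> 1" using v x'(3) by auto
    have "of_real (1 - v) * (y - a) = of_real (- v) * (x - a)"
      using v(2) by (simp add: scaleR_conv_of_real algebra_simps)
    then have "y - a = of_real (- v) * (x - a) / of_real (1 - v)"
      using \<open>v \<noteq> 1\<close> by (metis eq_iff_diff_eq_0 nonzero_mult_div_cancel_left of_real_eq_0_iff)
    then have "y - a = of_real (- v / (1 - v)) * (x - a)" by simp
    then have "y = a + of_real (- v / (1 - v)) * (x - a)" by (metis add.commute diff_add_cancel)
    then show ?thesis by blast
  qed
  obtain yb where yb: "yb \<in> ball c \<rho>" "a \<notin> closed_segment yb x"
  proof (cases "a \<in> closed_segment c x")
    case False
    then show ?thesis using that[of c] \<open>0 < \<rho>\<close> by auto
  next
    case True
    \<comment> \<open>Move \<open>c\<close> perpendicularly to the line through \<open>a\<close> and \<open>x\<close>.\<close>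
    let ?y = "c + of_real s * \<i> * (x - a)"
    obtain k where k: "c = a + of_real k * (x - a)" using on_line[OF True] by blast
    have "a \<notin> closed_segment ?y x"
    proof
      assume "a \<in> closed_segment ?y x"
      then obtain k' where "?y = a + of_real k' * (x - a)" using on_line by blast
      then have "(of_real s * \<i> - of_real (k' - k)) * (x - a) = 0" using k by (simp add: algebra_simps)
      then have "of_real s * \<i> = of_real (k' - k)" using x'(3) by simp
      then have "Im (of_real s * \<i>) = Im (of_real (k' - k))" by (rule arg_cong)
      then show False using s(1) by simp
    qed
    moreover have "?y \<in> ball c \<rho>" using s by (simp add: dist_norm norm_mult)
    ultimately show ?thesis using that by blast
  qed
  obtain b where b: "b \<in> E" "b \<in> closed_segment yb x" "closed_segment yb b \<inter> E = {b}"
    using obtain_first_point_on_segment[OF \<open>closed E\<close> x'(1)] by blast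
  show ?thesis
  proof (rule that)
    show "a \<noteq> b" using yb b by blast
    show "c \<in> ball c \<rho>" using \<open>0 < \<rho>\<close> by simp
    show "a \<in> ball c r" using a seg[of c x1] x(1) \<open>0 < \<rho>\<close> by auto
    show "b \<in> ball c r" using b seg[of yb x] x' yb by auto
  qed (use a b yb in auto)
qed

section \<open>Counting pieces of a curve by their diameter\<close>

text \<open>This is the induction step in comparing \<open>\<Sum>i\<le>N. real i powr (-q)\<close> with \<open>2 * N powr (1 - q)\<close>. It rests
  on \<open>(1 - x) powr (1 - q) \<le> sqrt (1 - x) \<le> 1 - x / 2\<close>, which uses \<open>q \<le> 1/2\<close>.\<close>

lemma powr_Suc_increment:
  assumes "0 < q" "q \<le> 1/2" "0 < N"
  shows "real N powr (-q) + 2 * real (N - 1) powr (1 - q) \<le> 2 * real N powr (1 - q)"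
proof -
  define x where "x = 1 / real N"
  have x: "0 < x" "x \<le> 1" using \<open>0 < N\<close> by (auto simp: x_def)
  have "real (N - 1) = real N * (1 - x)" using \<open>0 < N\<close> by (simp add: x_def algebra_simps of_nat_diff)
  then have eq: "real (N - 1) powr (1 - q) = real N powr (1 - q) * (1 - x) powr (1 - q)"
    using x by (simp add: powr_mult)
  have "(1 - x) powr (1 - q) \<le> (1 - x) powr (1/2)"
    using x assms by (intro powr_mono') auto
  also have "\<dots> = sqrt (1 - x)" using x by (simp add: powr_half_sqrt)
  also have "\<dots> \<le> 1 - x / 2"
    using x by (intro real_le_lsqrt) (auto simp: power2_eq_square algebra_simps)
  finally have "real (N - 1) powr (1 - q) \<le> real N powr (1 - q) * (1 - x / 2)"
    unfolding eq by (intro mult_left_mono) auto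
  moreover have "real N powr (1 - q) * x = real N powr (-q)"
    using \<open>0 < N\<close> by (simp add: x_def powr_diff powr_minus field_simps)
  ultimately show ?thesis by (simp add: algebra_simps)
qed

text \<open>All \<open>card P\<close> values are at least as large as the smallest one, so the smallest one is at most
  \<open>(C / card P) powr (1/p)\<close>. Removing it preserves the hypotheses, whence induction.\<close>

lemma sum_le_of_card_superlevel:
  fixes R :: "'i \<Rightarrow> real"
  assumes "finite P" and "2 \<le> p" "0 < C"
    and "\<And>j. j \<in> P \<Longrightarrow> 0 \<le> R j"
    and "\<And>r. 0 < r \<Longrightarrow> real (card {j \<in> P. r \<le> R j}) \<le> C * r powr (-p)"
  shows "(\<Sum>j\<in>P. R j) \<le> 2 * C powr (1/p) * real (card P) powr (1 - 1/p)"
  using assms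
proof (induction "card P" arbitrary: P)
  case 0
  then show ?case by simp
next
  case (Suc n)
  have "P \<noteq> {}" using Suc.hyps(2) by auto
  then obtain i where i: "i \<in> P" "\<And>j. j \<in> P \<Longrightarrow> R i \<le> R j"
    using \<open>finite P\<close> ex_min_if_finite[of "R ` P"]
    by (metis (no_types, lifting) finite_imageI image_iff image_is_empty not_le)
  define N where "N = card P"
  have "N > 0" using Suc.hyps(2) by (simp add: N_def)
  have min: "R i \<le> C powr (1/p) * real N powr (-(1/p))"
  proof (cases "R i = 0")
    case False
    then have pos: "R i > 0" using Suc.prems(4)[OF i(1)] by simp
    have "{j \<in> P. R i \<le> R j} = P" using i by auto
    then have "real N \<le> C * R i powr (-p)" using Suc.prems(5)[OF pos] by (simp add: N_def)
    then have "R i powr p \<le> C / real N"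
      using pos \<open>N > 0\<close> by (simp add: powr_minus field_simps)
    then have "(R i powr p) powr (1/p) \<le> (C / real N) powr (1/p)"
      using \<open>2 \<le> p\<close> by (intro powr_mono2) auto
    then show ?thesis
      using pos \<open>2 \<le> p\<close> \<open>0 < C\<close> \<open>N > 0\<close> by (simp add: powr_powr powr_divide powr_minus field_simps)
  qed (use \<open>0 < C\<close> in auto)
  have "(\<Sum>j\<in>P - {i}. R j) \<le> 2 * C powr (1/p) * real (card (P - {i})) powr (1 - 1/p)"
  proof (rule Suc.hyps(1))
    show "n = card (P - {i})" using Suc.hyps(2) i(1) Suc.prems(1) by simp
    show "real (card {j \<in> P - {i}. r \<le> R j}) \<le> C * r powr (-p)" if "0 < r" for r
    proof -
      have "card {j \<in> P - {i}. r \<le> R j} \<le> card {j \<in> P. r \<le> R j}"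
        using Suc.prems(1) by (intro card_mono) auto
      then show ?thesis using Suc.prems(5)[OF that] by simp
    qed
  qed (use Suc.prems in auto)
  moreover have "card (P - {i}) = N - 1" using i(1) Suc.prems(1) by (simp add: N_def)
  moreover have "(\<Sum>j\<in>P. R j) = R i + (\<Sum>j\<in>P - {i}. R j)"
    using Suc.prems(1) i(1) by (simp add: sum.remove)
  ultimately have "(\<Sum>j\<in>P. R j)
      \<le> C powr (1/p) * (real N powr (-(1/p)) + 2 * real (N - 1) powr (1 - 1/p))"
    using min by (simp add: algebra_simps)
  also have "\<dots> \<le> C powr (1/p) * (2 * real N powr (1 - 1/p))"
    using \<open>2 \<le> p\<close> \<open>N > 0\<close> by (intro mult_left_mono powr_Suc_increment) auto
  finally show ?case by (simp add: N_def mult_ac)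
qed

lemma obtain_quadratic_ball_cover:
  fixes Q :: "complex set"
  assumes Q: "Q \<subseteq> cball 0 R" and "1 \<le> R" "0 < \<epsilon>" "\<epsilon> \<le> 1"
  obtains F where "finite F" "F \<subseteq> Q" "real (card F) \<le> 49 * R\<^sup>2 / \<epsilon>\<^sup>2" "Q \<subseteq> (\<Union>z\<in>F. ball z \<epsilon>)"
proof -
  \<comment> \<open>Choose one point of \<open>Q\<close> in each cell of a grid of mesh \<open>\<epsilon> / 2\<close>. The coordinates of the cells that
    meet \<open>Q\<close> take at most \<open>2 * N + 1 \<le> 7 * R / \<epsilon>\<close> values each.\<close>
  define g where "g z = (\<lfloor>2 * Re z / \<epsilon>\<rfloor>, \<lfloor>2 * Im z / \<epsilon>\<rfloor>)" for z
  define N where "N = \<lceil>2 * R / \<epsilon>\<rceil>"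
  define B where "B = {-N..N} \<times> {-N..N}"
  define rep where "rep k = (SOME z. z \<in> Q \<and> g z = k)" for k
  have rep: "rep (g z) \<in> Q \<and> g (rep (g z)) = g z" if "z \<in> Q" for z
    unfolding rep_def by (rule someI[of _ z]) (use that in auto)
  have gB: "g ` Q \<subseteq> B"
  proof
    fix k assume "k \<in> g ` Q"
    then obtain z where z: "z \<in> Q" "k = g z" by auto
    have bound: "\<lfloor>2 * x / \<epsilon>\<rfloor> \<in> {-N..N}" if "\<bar>x\<bar> \<le> R" for x
    proof -
      have "\<bar>2 * x / \<epsilon>\<bar> \<le> 2 * R / \<epsilon>" using that \<open>0 < \<epsilon>\<close> by (simp add: divide_right_mono)
      then have "- of_int N \<le> 2 * x / \<epsilon>" "2 * x / \<epsilon> \<le> of_int N"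
        unfolding N_def by linarith+
      then show ?thesis by (auto simp: floor_le_iff le_floor_iff)
    qed
    have "norm z \<le> R" using Q z(1) by auto
    then have "\<bar>Re z\<bar> \<le> R" "\<bar>Im z\<bar> \<le> R" using abs_Re_le_cmod abs_Im_le_cmod order_trans by blast+
    then show "k \<in> B" using bound by (simp add: B_def z(2) g_def)
  qed
  have "finite B" by (simp add: B_def)
  have "1 \<le> 2 * R / \<epsilon>" using assms by (simp add: field_simps)
  then have N: "N \<ge> 1" "real_of_int N \<le> 2 * R / \<epsilon> + 1" unfolding N_def by linarith+
  define F where "F = rep ` g ` Q"
  have "card F \<le> card B"
    unfolding F_def using card_mono[OF \<open>finite B\<close> gB] card_image_le[of "g ` Q" rep]
      finite_subset[OF gB \<open>finite B\<close>] by linarith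
  moreover have "real (card B) = (2 * real_of_int N + 1)\<^sup>2"
    using N(1) by (simp add: B_def card_cartesian_product power2_eq_square)
  moreover have "(2 * real_of_int N + 1)\<^sup>2 \<le> (7 * R / \<epsilon>)\<^sup>2"
  proof (rule power_mono)
    have "1 \<le> R / \<epsilon>" using assms by (simp add: field_simps)
    moreover have "2 * R / \<epsilon> = 2 * (R / \<epsilon>)" "7 * R / \<epsilon> = 7 * (R / \<epsilon>)" by simp_all
    ultimately show "2 * real_of_int N + 1 \<le> 7 * R / \<epsilon>" using N(2) by linarith
  qed (use N(1) in auto)
  ultimately have "real (card F) \<le> 49 * R\<^sup>2 / \<epsilon>\<^sup>2"
    by (simp add: power_divide power_mult_distrib)
  moreover have "Q \<subseteq> (\<Union>z\<in>F. ball z \<epsilon>)"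
  proof
    fix z assume z: "z \<in> Q"
    define v where "v = rep (g z)"
    have "v \<in> F" "g v = g z" using rep[OF z] z by (auto simp: v_def F_def)
    have close: "\<bar>x - y\<bar> < \<epsilon> / 2" if "\<lfloor>2 * x / \<epsilon>\<rfloor> = \<lfloor>2 * y / \<epsilon>\<rfloor>" for x y :: real
    proof -
      have "\<bar>2 * x / \<epsilon> - 2 * y / \<epsilon>\<bar> < 1" using that by linarith
      then have "\<bar>2 * (x - y) / \<epsilon>\<bar> < 1" by (simp add: diff_divide_distrib algebra_simps)
      then have "\<bar>2 * (x - y)\<bar> < \<epsilon>" using \<open>0 < \<epsilon>\<close> by (simp add: divide_less_eq)
      then have "2 * \<bar>x - y\<bar> < \<epsilon>" by (simp only: abs_mult abs_numeral)
      moreover have "d < \<epsilon> / 2" if "2 * d < \<epsilon>" for d using that by linarith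
      ultimately show ?thesis by blast
    qed
    have "\<bar>Re (v - z)\<bar> < \<epsilon> / 2" "\<bar>Im (v - z)\<bar> < \<epsilon> / 2"
      using \<open>g v = g z\<close> close by (auto simp: g_def)
    then have "dist v z < \<epsilon>" using cmod_le[of "v - z"] by (simp add: dist_norm)
    then show "z \<in> (\<Union>z\<in>F. ball z \<epsilon>)" using \<open>v \<in> F\<close> by auto
  qed
  ultimately show ?thesis
    using that[of F] rep finite_subset[OF gB \<open>finite B\<close>] by (auto simp: F_def)
qed

text \<open>A piece of diameter at least \<open>r\<close> contains a point of some ball \<open>ball z \<epsilon>\<close> of a cover of the rectangle
  and a point at distance more than \<open>r / 4\<close> from \<open>z\<close>. With \<open>\<beta> = 2 / p\<close> and \<open>\<epsilon> powr \<beta> = r / 4\<close>, each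
  ball allows a bounded number of such pieces, and there are \<open>O(1 / \<epsilon>\<^sup>2) = O(r powr (-p))\<close> balls.\<close>

lemma card_large_pieces_le:
  fixes \<eta> :: "real \<Rightarrow> complex"
  assumes cont: "continuous_on {0..} \<eta>" and bnc: "bounded_number_of_crossings \<eta>"
    and H: "cbox a b \<subseteq> upper_half_plane" and "2 < p"
  shows "\<exists>C>0. \<forall>P \<tau>. \<forall>r>0. finite P \<and> (\<forall>t\<in>P. 0 \<le> t) \<and> (\<forall>t\<in>P. \<forall>u\<in>P. t < u \<longrightarrow> \<tau> t \<le> u) \<longrightarrow>
      real (card {t \<in> P. r \<le> diameter (\<eta> ` {t..\<tau> t} \<inter> cbox a b)}) \<le> C * r powr (-p)"
proof -
  define \<beta> where "\<beta> = 2 / p"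
  have \<beta>: "0 < \<beta>" "\<beta> < 1" using \<open>2 < p\<close> by (auto simp: \<beta>_def)
  obtain M \<epsilon>0 where M: "M > 0" "\<epsilon>0 > 0" "\<And>\<epsilon> z. 0 < \<epsilon> \<Longrightarrow> \<epsilon> < \<epsilon>0 \<Longrightarrow> z \<in> cbox a b \<Longrightarrow>
      finite (excursions_between \<eta> z \<epsilon> (\<epsilon> powr \<beta>)) \<and> card (excursions_between \<eta> z \<epsilon> (\<epsilon> powr \<beta>)) \<le> M"
    using bnc H \<beta> unfolding bounded_number_of_crossings_def by meson
  obtain R where R: "1 \<le> R" "cbox a b \<subseteq> cball 0 R"
  proof -
    obtain R where "\<And>x. x \<in> cbox a b \<Longrightarrow> norm x \<le> R"
      using bounded_cbox[of a b] unfolding bounded_iff by blast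
    then show ?thesis using that[of "max 1 R"] by (force simp: le_max_iff_disj)
  qed
  define \<epsilon>1 where "\<epsilon>1 = min (\<epsilon>0 / 2) (1/2)"
  define r1 where "r1 = 4 * \<epsilon>1 powr \<beta>"
  have \<epsilon>1: "0 < \<epsilon>1" "\<epsilon>1 < \<epsilon>0" "\<epsilon>1 < 1" using M(2) by (auto simp: \<epsilon>1_def)
  then have "r1 > 0" by (simp add: r1_def)
  define C0 where "C0 = 2 * real M * 49 * R\<^sup>2 * 4 powr p"
  have "C0 > 0" using M(1) R(1) by (simp add: C0_def)
  let ?D = "\<lambda>\<tau> t. \<eta> ` {t..\<tau> t} \<inter> cbox a b"
  have small: "real (card {t \<in> P. r \<le> diameter (?D \<tau> t)}) \<le> C0 * r powr (-p)"
    if "finite P" and P0: "\<forall>t\<in>P. 0 \<le> t" and Pnon: "\<forall>t\<in>P. \<forall>u\<in>P. t < u \<longrightarrow> \<tau> t \<le> u"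
      and r: "0 < r" "r \<le> r1" for P \<tau> r
  proof -
    define P' where "P' = {t \<in> P. r \<le> diameter (?D \<tau> t)}"
    define \<epsilon> where "\<epsilon> = (r / 4) powr (1/\<beta>)"
    have \<epsilon>\<beta>: "\<epsilon> powr \<beta> = r / 4" using r \<beta> by (simp add: \<epsilon>_def powr_powr)
    have "\<epsilon> \<le> (\<epsilon>1 powr \<beta>) powr (1/\<beta>)"
      unfolding \<epsilon>_def using r \<beta> by (intro powr_mono2) (auto simp: r1_def)
    also have "\<dots> = \<epsilon>1" using \<epsilon>1 \<beta> by (simp add: powr_powr)
    finally have "\<epsilon> \<le> \<epsilon>1" .
    have "0 < \<epsilon>" using r by (simp add: \<epsilon>_def)
    have "\<epsilon> powr 1 < \<epsilon> powr \<beta>" using \<open>0 < \<epsilon>\<close> \<open>\<epsilon> \<le> \<epsilon>1\<close> \<epsilon>1 \<beta> by (intro powr_less_mono') auto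
    then have "\<epsilon> < r / 4" using \<open>0 < \<epsilon>\<close> \<epsilon>\<beta> by simp
    obtain F where F: "finite F" "F \<subseteq> cbox a b" "real (card F) \<le> 49 * R\<^sup>2 / \<epsilon>\<^sup>2"
      "cbox a b \<subseteq> (\<Union>z\<in>F. ball z \<epsilon>)"
      using obtain_quadratic_ball_cover[OF R(2,1) \<open>0 < \<epsilon>\<close>] \<open>\<epsilon> \<le> \<epsilon>1\<close> \<epsilon>1 by force
    define Pz where "Pz z = {t \<in> P'. \<exists>s\<in>{t..\<tau> t}. \<eta> s \<in> ball z \<epsilon> \<and> (\<exists>s'\<in>{t..\<tau> t}. r \<le> dist (\<eta> s) (\<eta> s'))}" for z
    have "P' \<subseteq> (\<Union>z\<in>F. Pz z)"
    proof
      fix t assume t: "t \<in> P'"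
      have "continuous_on {t..\<tau> t} \<eta>"
        using cont by (rule continuous_on_subset) (use t P0 in \<open>auto simp: P'_def\<close>)
      then have "compact (?D \<tau> t)"
        by (intro compact_Int_closed compact_continuous_image) auto
      moreover have "?D \<tau> t \<noteq> {}" using t r by (auto simp: P'_def diameter_def split: if_splits)
      ultimately obtain x y where xy: "x \<in> ?D \<tau> t" "y \<in> ?D \<tau> t" "dist x y = diameter (?D \<tau> t)"
        using diameter_compact_attained by blast
      then obtain s s' where s: "s \<in> {t..\<tau> t}" "x = \<eta> s" "s' \<in> {t..\<tau> t}" "y = \<eta> s'" by blast
      obtain z where z: "z \<in> F" "x \<in> ball z \<epsilon>" using F(4) xy(1) by blast
      have "r \<le> dist (\<eta> s) (\<eta> s')" using t xy(3) s by (simp add: P'_def)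
      then have "t \<in> Pz z" unfolding Pz_def using t s z by blast
      then show "t \<in> (\<Union>z\<in>F. Pz z)" using z(1) by blast
    qed
    moreover have "card (Pz z) \<le> 2 * M" if "z \<in> F" for z
    proof (rule card_nonoverlapping_crossings_le[OF cont, where \<epsilon> = \<epsilon> and r = "\<epsilon> powr \<beta>" and z = z
            and l = "\<lambda>t. t" and u = \<tau>])
      show "finite (Pz z)" using \<open>finite P\<close> by (simp add: Pz_def P'_def)
      show "\<epsilon> < \<epsilon> powr \<beta>" using \<open>\<epsilon> < r / 4\<close> \<epsilon>\<beta> by simp
      show "\<exists>s\<in>{j..\<tau> j}. \<epsilon> powr \<beta> < dist (\<eta> s) z" if "j \<in> Pz z" for j
      proof -
        from that obtain s s' where s: "s' \<in> {j..\<tau> j}" "dist z (\<eta> s) < \<epsilon>" "r \<le> dist (\<eta> s) (\<eta> s')"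
          by (auto simp: Pz_def)
        have "dist (\<eta> s) (\<eta> s') \<le> dist z (\<eta> s) + dist (\<eta> s') z" by (metis dist_commute dist_triangle)
        then have "\<epsilon> powr \<beta> < dist (\<eta> s') z" using s \<open>\<epsilon> < r / 4\<close> r unfolding \<epsilon>\<beta> by linarith
        then show ?thesis using s(1) by blast
      qed
      show "\<tau> j \<le> k \<or> \<tau> k \<le> j" if "j \<in> Pz z" "k \<in> Pz z" "j \<noteq> k" for j k
        using that Pnon by (auto simp: Pz_def P'_def) (meson not_less_iff_gr_or_eq)
    qed (use M(3)[of \<epsilon> z] F(2) that \<open>0 < \<epsilon>\<close> \<open>\<epsilon> \<le> \<epsilon>1\<close> \<epsilon>1 P0 in \<open>auto simp: Pz_def P'_def\<close>)
    moreover have "finite (\<Union>z\<in>F. Pz z)" using \<open>finite P\<close> F(1) by (auto simp: Pz_def P'_def)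
    ultimately have "card P' \<le> card F * (2 * M)"
      using card_mono[of "\<Union>z\<in>F. Pz z" P'] card_UN_le[OF F(1), of Pz]
        sum_bounded_above[of F "\<lambda>z. card (Pz z)" "2 * M"] by fastforce
    then have "real (card P') \<le> real (card F) * (2 * real M)"
      by (metis of_nat_le_iff of_nat_mult of_nat_numeral)
    also have "\<dots> \<le> (49 * R\<^sup>2 / \<epsilon>\<^sup>2) * (2 * real M)" using F(3) by (intro mult_right_mono) auto
    also have "\<dots> = (2 * real M * 49 * R\<^sup>2) * (1 / \<epsilon>\<^sup>2)" by simp
    also have "1 / \<epsilon>\<^sup>2 = 4 powr p * r powr (-p)"
    proof -
      have "\<epsilon>\<^sup>2 = \<epsilon> powr 2" using \<open>0 < \<epsilon>\<close> by (simp add: powr_numeral)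
      also have "\<dots> = (r / 4) powr p" using \<open>2 < p\<close> by (simp add: \<epsilon>_def \<beta>_def powr_powr)
      also have "\<dots> = r powr p / 4 powr p" using r by (simp add: powr_divide)
      finally show ?thesis by (simp add: powr_minus divide_inverse)
    qed
    also have "2 * real M * 49 * R\<^sup>2 * (4 powr p * r powr (-p)) = C0 * r powr (-p)"
      by (simp add: C0_def)
    finally show ?thesis by (simp add: P'_def)
  qed
  \<comment> \<open>For \<open>r1 < r \<le> 2 * R\<close> the bound at \<open>r1\<close> is used, at the cost of a larger constant; no piece has a
    diameter above \<open>2 * R\<close>.\<close>
  define C where "C = C0 * max 1 ((2 * R / r1) powr p)"
  have "C > 0" using \<open>C0 > 0\<close> by (simp add: C_def)
  have "real (card {t \<in> P. r \<le> diameter (?D \<tau> t)}) \<le> C * r powr (-p)"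
    if "finite P" and P0: "\<forall>t\<in>P. 0 \<le> t" and Pnon: "\<forall>t\<in>P. \<forall>u\<in>P. t < u \<longrightarrow> \<tau> t \<le> u"
      and r: "0 < r" for P \<tau> r
  proof (cases "r \<le> r1")
    case True
    have "C0 * r powr (-p) \<le> C * r powr (-p)"
      using \<open>C0 > 0\<close> by (intro mult_right_mono) (auto simp: C_def)
    then show ?thesis using small[OF that True] by simp
  next
    case False
    show ?thesis
    proof (cases "r \<le> 2 * R")
      case True
      have "{t \<in> P. r \<le> diameter (?D \<tau> t)} \<subseteq> {t \<in> P. r1 \<le> diameter (?D \<tau> t)}" using False by auto
      then have "real (card {t \<in> P. r \<le> diameter (?D \<tau> t)}) \<le> real (card {t \<in> P. r1 \<le> diameter (?D \<tau> t)})"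
        using \<open>finite P\<close> by (intro of_nat_mono card_mono) auto
      also have "\<dots> \<le> C0 * r1 powr (-p)" using small[OF that(1-3) \<open>0 < r1\<close>] by simp
      also have "r1 powr (-p) = (r / r1) powr p * r powr (-p)"
        using r \<open>0 < r1\<close> by (simp add: powr_divide powr_minus field_simps)
      also have "C0 * ((r / r1) powr p * r powr (-p)) \<le> C0 * (max 1 ((2 * R / r1) powr p) * r powr (-p))"
      proof (intro mult_left_mono mult_right_mono)
        have "(r / r1) powr p \<le> (2 * R / r1) powr p"
          using True r \<open>0 < r1\<close> \<open>2 < p\<close> by (intro powr_mono2 divide_right_mono) auto
        then show "(r / r1) powr p \<le> max 1 ((2 * R / r1) powr p)" by simp
      qed (use \<open>C0 > 0\<close> in auto)
      finally show ?thesis by (simp add: C_def mult.assoc)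
    next
      case False
      have "{t \<in> P. r \<le> diameter (?D \<tau> t)} = {}"
      proof -
        have "diameter (?D \<tau> t) \<le> 2 * R" for t
        proof -
          have "diameter (?D \<tau> t) \<le> diameter (cball (0::complex) R)"
            by (rule diameter_subset) (use R(2) in blast, rule bounded_cball)
          then show ?thesis using R(1) by simp
        qed
        then have "diameter (?D \<tau> t) < r" for t using False by (meson le_less_trans not_le)
        then show ?thesis by (auto simp: not_le)
      qed
      then have "real (card {t \<in> P. r \<le> diameter (?D \<tau> t)}) = 0" by (simp only: card.empty of_nat_0)
      moreover have "0 \<le> C * r powr (-p)" using \<open>C > 0\<close> by simp
      ultimately show ?thesis by linarith
    qed
  qed
  note bound = this
  show ?thesis
    by (rule exI[of _ C], rule conjI, rule \<open>C > 0\<close>, intro allI impI, elim conjE, rule bound)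
qed

section \<open>Curves and compact sets in the half-plane\<close>

lemma closure_upper_half_plane_real:
  "z \<in> closure upper_half_plane \<Longrightarrow> z \<notin> upper_half_plane \<Longrightarrow> z \<in> \<real>"
proof -
  assume z: "z \<in> closure upper_half_plane" "z \<notin> upper_half_plane"
  have "closure upper_half_plane \<subseteq> {z. 0 \<le> Im z}"
    by (intro closure_minimal closed_halfspace_Im_ge) (auto simp: upper_half_plane_def)
  then show "z \<in> \<real>" using z by (force simp: upper_half_plane_def complex_is_Real_iff)
qed

lemma open_upper_half_plane: "open upper_half_plane"
  unfolding upper_half_plane_def by (rule open_halfspace_Im_gt)

lemma curve_trace_closed:
  assumes "curve_from_0_to_infinity \<eta>"
  shows "closed (curve_trace \<eta>)"
proof -
  have "continuous_on {0..} \<eta>" "filterlim \<eta> at_infinity at_top"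
    using assms by (auto simp: curve_from_0_to_infinity_def)
  have "closed (curve_trace \<eta> \<inter> cball 0 r)" for r
  proof -
    have "\<forall>\<^sub>F t in at_top. r + 1 \<le> norm (\<eta> t)"
      using \<open>filterlim \<eta> at_infinity at_top\<close> filterlim_at_infinity[of "-1" \<eta>] filterlim_at_infinity_imp_norm_at_top
      by (metis filterlim_at_top)
    then obtain T where T: "\<And>t. T \<le> t \<Longrightarrow> r + 1 \<le> norm (\<eta> t)"
      by (auto simp: eventually_at_top_linorder)
    have "compact (\<eta> ` {0..T})"
      using \<open>continuous_on {0..} \<eta>\<close>
      by (intro compact_continuous_image) (auto elim: continuous_on_subset)
    moreover have "curve_trace \<eta> \<inter> cball 0 r = \<eta> ` {0..T} \<inter> cball 0 r"
    proof -
      have "t \<le> T" if "norm (\<eta> t) \<le> r" for t using T[of t] that by linarith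
      then show ?thesis by (auto simp: curve_trace_def)
    qed
    ultimately show ?thesis by (simp add: closed_Int compact_imp_closed)
  qed
  note closed_part = this
  have "z \<in> curve_trace \<eta>" if z: "z \<in> closure (curve_trace \<eta>)" for z
  proof -
    let ?r = "norm z + 1"
    have "z \<in> closure (ball 0 ?r \<inter> curve_trace \<eta>)"
      using open_Int_closure_subset[of "ball 0 ?r" "curve_trace \<eta>"] z by auto
    also have "\<dots> \<subseteq> curve_trace \<eta> \<inter> cball 0 ?r"
      using ball_subset_cball by (intro closure_minimal closed_part) blast
    finally show ?thesis by blast
  qed
  then show ?thesis by (metis closure_subset closure_subset_eq subsetI)
qed

lemma compact_subset_box_in_half_plane:
  assumes "compact V" "V \<subseteq> upper_half_plane"
  obtains R \<mu> where "0 < \<mu>" "V \<subseteq> cbox (Complex (-R) \<mu>) (Complex R R)"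
proof (cases "V = {}")
  case True then show ?thesis using that[of 1 1] by auto
next
  case False
  obtain z where z: "z \<in> V" "\<And>w. w \<in> V \<Longrightarrow> Im z \<le> Im w"
    using continuous_attains_inf[OF assms(1) False continuous_on_Im[OF continuous_on_id]] by auto
  obtain R where R: "\<And>w. w \<in> V \<Longrightarrow> norm w \<le> R"
    using compact_imp_bounded[OF assms(1)] by (auto simp: bounded_iff)
  show ?thesis
  proof (rule that)
    show "0 < Im z" using z(1) assms(2) by (auto simp: upper_half_plane_def)
    show "V \<subseteq> cbox (Complex (-R) (Im z)) (Complex R R)"
    proof
      fix w assume w: "w \<in> V"
      then show "w \<in> cbox (Complex (-R) (Im z)) (Complex R R)"
        using R[OF w] z(2)[OF w] abs_Re_le_cmod[of w] abs_Im_le_cmod[of w]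
        by (auto simp: in_cbox_complex_iff abs_le_iff)
    qed
  qed
qed

lemma cbox_in_half_plane: "0 < \<mu> \<Longrightarrow> cbox (Complex x \<mu>) w \<subseteq> upper_half_plane"
  by (auto simp: in_cbox_complex_iff upper_half_plane_def)

lemma cball_in_enlarged_cbox:
  assumes "z \<in> cbox (Complex (-R) \<mu>) (Complex R R)" "r \<le> \<mu> / 2"
  shows "cball z r \<subseteq> cbox (Complex (-R-\<mu>) (\<mu>/2)) (Complex (R+\<mu>) (R+\<mu>))"
proof
  fix w assume "w \<in> cball z r"
  then have "norm (z - w) \<le> \<mu> / 2" using assms(2) by (simp add: dist_norm)
  then have "\<bar>Re z - Re w\<bar> \<le> \<mu> / 2" "\<bar>Im z - Im w\<bar> \<le> \<mu> / 2"
    using abs_Re_le_cmod[of "z - w"] abs_Im_le_cmod[of "z - w"] by auto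
  then have "Re z - \<mu> / 2 \<le> Re w" "Re w \<le> Re z + \<mu> / 2" "Im z - \<mu> / 2 \<le> Im w" "Im w \<le> Im z + \<mu> / 2"
    by (simp_all only: abs_le_iff) linarith+
  moreover have "0 \<le> \<mu>" using \<open>norm (z - w) \<le> \<mu> / 2\<close> norm_ge_zero[of "z - w"] by linarith
  ultimately show "w \<in> cbox (Complex (-R-\<mu>) (\<mu>/2)) (Complex (R+\<mu>) (R+\<mu>))"
    using assms(1) unfolding in_cbox_complex_iff by simp
qed

lemma eventually_small_cover:
  fixes A B :: "complex set"
  assumes "\<not> bounded A" "B \<subseteq> A" "bounded B" "upper_minkowski_dim A < ereal d"
  shows "\<forall>\<^sub>F \<epsilon> in at_right 0. \<exists>C. finite C \<and> real (card C) \<le> \<epsilon> powr (-d) \<and> B \<subseteq> (\<Union>c\<in>C. ball c \<epsilon>)"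
proof -
  have "upper_minkowski_dim_bounded B \<le> upper_minkowski_dim A"
    unfolding upper_minkowski_dim_def using assms(1-3) by (auto intro: SUP_upper)
  then have "Limsup (at_right 0) (\<lambda>\<epsilon>. ereal (ln (real (covering_number B \<epsilon>)) / ln (1 / \<epsilon>))) < ereal d"
    using assms(4) unfolding upper_minkowski_dim_bounded_def by simp
  then have "\<forall>\<^sub>F \<epsilon> in at_right 0. ereal (ln (real (covering_number B \<epsilon>)) / ln (1 / \<epsilon>)) < ereal d"
    by (rule Limsup_lessD)
  moreover have "\<forall>\<^sub>F \<epsilon>::real in at_right 0. \<epsilon> \<in> {0<..<1}"
    by (rule eventually_at_right_real) simp
  ultimately show ?thesis
  proof eventually_elim
    case (elim \<epsilon>)
    have "compact (closure B)" using assms(3) by (simp add: compact_closure)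
    then obtain k where "finite k" "closure B \<subseteq> (\<Union>x\<in>k. ball x \<epsilon>)"
      using elim by (metis compact_imp_seq_compact greaterThanLessThan_iff seq_compact_imp_totally_bounded)
    then have "finite k \<and> card k = card k \<and> B \<subseteq> (\<Union>x\<in>k. ball x \<epsilon>)" using closure_subset by blast
    then have "\<exists>n C. finite C \<and> card C = n \<and> B \<subseteq> (\<Union>c\<in>C. ball c \<epsilon>)" by blast
    then have "\<exists>C. finite C \<and> card C = covering_number B \<epsilon> \<and> B \<subseteq> (\<Union>c\<in>C. ball c \<epsilon>)"
      unfolding covering_number_def by (rule LeastI_ex)
    moreover have "real (covering_number B \<epsilon>) \<le> \<epsilon> powr (-d)"
    proof (cases "covering_number B \<epsilon> = 0")
      case False
      have "ln (1 / \<epsilon>) > 0" using elim by (simp add: ln_div)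
      then have "ln (real (covering_number B \<epsilon>)) \<le> d * ln (1 / \<epsilon>)"
        using elim by (simp add: divide_less_eq)
      also have "\<dots> = ln (\<epsilon> powr (-d))" using elim by (simp add: ln_powr ln_div)
      finally show ?thesis using False elim by (subst (asm) ln_le_cancel_iff) auto
    qed simp
    ultimately show ?case by metis
  qed
qed

lemma finite_cball_cover: "\<exists>F. finite F \<and> cball (0::complex) 3 \<subseteq> (\<Union>f\<in>F. ball f (1/2))"
proof -
  have "\<exists>k. finite k \<and> k \<subseteq> cball (0::complex) 3 \<and> cball 0 3 \<subseteq> (\<Union>x\<in>k. ball x (1/2))"
    using seq_compact_imp_totally_bounded[OF compact_imp_seq_compact[OF compact_cball[of "0::complex" 3]]]
    by simp
  then show ?thesis by blast
qed

section \<open>Covering the curve by pieces with small images\<close>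

locale curve_homeomorphism =
  fixes \<eta> \<eta>' :: "real \<Rightarrow> complex" and \<phi> \<psi> :: "complex \<Rightarrow> complex"
  assumes curve: "curve_from_0_to_infinity \<eta>" and curve': "curve_from_0_to_infinity \<eta>'"
    and hom: "homeomorphism upper_half_plane upper_half_plane \<phi> \<psi>"
    and image: "is_image_curve \<phi> \<eta> \<eta>'"
    and crossings: "bounded_number_of_crossings \<eta>"
begin

lemma cont: "continuous_on {0..} \<eta>" "continuous_on {0..} \<eta>'"
  using curve curve' by (auto simp: curve_from_0_to_infinity_def)

lemma image_point:
  assumes "0 \<le> t" "\<eta> t \<in> upper_half_plane"
  shows "\<eta>' t = \<phi> (\<eta> t)" "\<eta>' t \<in> upper_half_plane"
proof -
  show 1: "\<eta>' t = \<phi> (\<eta> t)" using image assms by (auto simp: is_image_curve_def)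
  have "\<phi> ` upper_half_plane = upper_half_plane" using hom by (simp add: homeomorphism_def)
  then show "\<eta>' t \<in> upper_half_plane" using assms 1 by auto
qed

lemma preimage_point:
  assumes "0 \<le> t" "\<eta>' t \<in> upper_half_plane"
  shows "\<eta> t \<in> upper_half_plane" "\<eta> t = \<psi> (\<eta>' t)"
proof -
  have "\<eta> t \<in> closure upper_half_plane"
    using curve assms by (auto simp: curve_from_0_to_infinity_def curve_trace_def)
  moreover have "\<eta> t \<notin> \<real>"
    using assms image by (auto simp: is_image_curve_def upper_half_plane_def complex_is_Real_iff)
  ultimately show 1: "\<eta> t \<in> upper_half_plane" using closure_upper_half_plane_real by blast
  show "\<eta> t = \<psi> (\<eta>' t)"
    using image_point(1)[OF assms(1) 1] hom 1 by (simp add: homeomorphism_def)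
qed

text \<open>Each of the disjoint time intervals contains a time at which \<open>\<eta>\<close> is at \<open>\<psi> a\<close> and one at which it is at
  \<open>\<psi> b\<close>. Hence it contains a crossing of the annulus around \<open>\<psi> a\<close> with radii \<open>\<epsilon>\<close> and \<open>sqrt \<epsilon>\<close>, for any
  \<open>\<epsilon>\<close> so small that \<open>\<psi> b\<close> lies outside its outer circle. The bound on the number of crossings is uniform
  in \<open>\<epsilon>\<close>, so \<open>M\<close> depends neither on \<open>a\<close> and \<open>b\<close> nor on their distance.\<close>

lemma card_common_points_le:
  assumes "compact V" "V \<subseteq> upper_half_plane"
  obtains M where "\<And>(P::real set) l u a b. finite P \<Longrightarrow> a \<noteq> b \<Longrightarrow> a \<in> V \<Longrightarrow> b \<in> V \<Longrightarrow>
    (\<And>j. j \<in> P \<Longrightarrow> 0 \<le> l j \<and> a \<in> \<eta>' ` {l j..u j} \<and> b \<in> \<eta>' ` {l j..u j}) \<Longrightarrow>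
    (\<And>j k. j \<in> P \<Longrightarrow> k \<in> P \<Longrightarrow> j < k \<Longrightarrow> u j < l k) \<Longrightarrow> card P \<le> M"
proof -
  have \<psi>: "continuous_on upper_half_plane \<psi>" "\<psi> ` upper_half_plane = upper_half_plane"
    using hom by (auto simp: homeomorphism_def)
  have "compact (\<psi> ` V)"
    using assms continuous_on_subset[OF \<psi>(1)] by (intro compact_continuous_image) auto
  moreover have "\<psi> ` V \<subseteq> upper_half_plane" using \<psi>(2) assms(2) by blast
  ultimately obtain R \<mu> where R: "0 < \<mu>" "\<psi> ` V \<subseteq> cbox (Complex (-R) \<mu>) (Complex R R)"
    using compact_subset_box_in_half_plane by metis
  obtain M \<epsilon>0 where M: "\<epsilon>0 > 0" "\<And>\<epsilon> z. 0 < \<epsilon> \<Longrightarrow> \<epsilon> < \<epsilon>0 \<Longrightarrow> z \<in> cbox (Complex (-R) \<mu>) (Complex R R) \<Longrightarrow>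
      finite (excursions_between \<eta> z \<epsilon> (\<epsilon> powr (1/2))) \<and> card (excursions_between \<eta> z \<epsilon> (\<epsilon> powr (1/2))) \<le> M"
  proof -
    have half: "0 < (1/2::real) \<and> 1/2 < (1::real)" by simp
    show ?thesis
      using that crossings[unfolded bounded_number_of_crossings_def, rule_format,
        OF cbox_in_half_plane[OF R(1)] half, of "-R" "Complex R R"] by meson
  qed
  show ?thesis
  proof (rule that[of "2 * M"])
    fix P :: "real set" and l u a b
    assume P: "finite P" "a \<noteq> b" "a \<in> V" "b \<in> V"
      "\<And>j. j \<in> P \<Longrightarrow> 0 \<le> l j \<and> a \<in> \<eta>' ` {l j..u j} \<and> b \<in> \<eta>' ` {l j..u j}"
      "\<And>j k. j \<in> P \<Longrightarrow> k \<in> P \<Longrightarrow> j < k \<Longrightarrow> u j < l k"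
    have H: "a \<in> upper_half_plane" "b \<in> upper_half_plane" using P assms by auto
    have "\<psi> a \<noteq> \<psi> b" using P(2) H hom by (metis homeomorphism_def)
    define d where "d = dist (\<psi> b) (\<psi> a)"
    have "d > 0" using \<open>\<psi> a \<noteq> \<psi> b\<close> by (simp add: d_def)
    define \<epsilon> where "\<epsilon> = min (\<epsilon>0 / 2) (min (1/4) (d\<^sup>2 / 4))"
    have \<epsilon>: "0 < \<epsilon>" "\<epsilon> < \<epsilon>0" "\<epsilon> \<le> 1/4" "\<epsilon> \<le> d\<^sup>2 / 4" using M(1) \<open>d > 0\<close> by (auto simp: \<epsilon>_def)
    have "sqrt \<epsilon> \<le> sqrt (d\<^sup>2 / 4)" using \<epsilon>(4) by simp
    also have "\<dots> = d / 2" using \<open>d > 0\<close> by (simp add: real_sqrt_divide)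
    finally have "\<epsilon> powr (1/2) < d" using \<open>d > 0\<close> \<epsilon>(1) by (simp add: powr_half_sqrt)
    have "\<epsilon> powr 1 < \<epsilon> powr (1/2)" using \<epsilon> by (intro powr_less_mono') auto
    then have "\<epsilon> < \<epsilon> powr (1/2)" using \<epsilon>(1) by simp
    have at: "\<exists>t\<in>{l j..u j}. \<eta> t = \<psi> x" if jx: "j \<in> P" "x \<in> \<eta>' ` {l j..u j}" "x \<in> upper_half_plane" for j x
    proof -
      obtain t where t: "t \<in> {l j..u j}" "x = \<eta>' t" using jx(2) by blast
      then have "0 \<le> t" using P(5)[OF jx(1)] by auto
      then show ?thesis using preimage_point(2)[of t] t jx(3) by blast
    qed
    show "card P \<le> 2 * M"
    proof (rule card_nonoverlapping_crossings_le[OF cont(1) P(1) \<open>\<epsilon> < \<epsilon> powr (1/2)\<close>, where l = l and u = u and z = "\<psi> a"])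
      show "u j \<le> l k \<or> u k \<le> l j" if "j \<in> P" "k \<in> P" "j \<noteq> k" for j k
        using P(6)[OF that(1,2)] P(6)[OF that(2,1)] that(3) by linarith
      show "0 \<le> l j" if "j \<in> P" for j using P(5)[OF that] by simp
      show "\<exists>t\<in>{l j..u j}. \<eta> t \<in> ball (\<psi> a) \<epsilon>" if "j \<in> P" for j
        using at[OF that, of a] P(5)[OF that] H \<epsilon>(1) by force
      show "\<exists>s\<in>{l j..u j}. \<epsilon> powr (1/2) < dist (\<eta> s) (\<psi> a)" if "j \<in> P" for j
        using at[OF that, of b] P(5)[OF that] H \<open>\<epsilon> powr (1/2) < d\<close> unfolding d_def by force
      have "\<psi> a \<in> cbox (Complex (-R) \<mu>) (Complex R R)" using R(2) P(3) by blast
      from M(2)[OF \<epsilon>(1,2) this]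
      show "finite (excursions_between \<eta> (\<psi> a) \<epsilon> (\<epsilon> powr (1/2)))"
        "card (excursions_between \<eta> (\<psi> a) \<epsilon> (\<epsilon> powr (1/2))) \<le> M" by auto
    qed
  qed
qed

text \<open>The waiting radius \<open>4 * \<delta>\<close> makes the excursions at scale \<open>\<delta>\<close> of the selected times disjoint: if
  the one at \<open>u\<close> began before the one at an earlier \<open>t\<close> ended, then both the end point of the latter,
  at distance \<open>\<delta>\<close> from \<open>\<eta>' t\<close>, and \<open>\<eta>' (\<tau> t)\<close>, at distance \<open>4 * \<delta>\<close>, would be within \<open>\<delta>\<close> of \<open>\<eta>' u\<close>.\<close>

lemma obtain_excursion_times:
  assumes H: "cbox a b \<subseteq> upper_half_plane" and "0 < \<delta>"
    and sub: "\<And>t. 0 \<le> t \<Longrightarrow> \<eta> t \<in> cbox a b \<Longrightarrow> cball (\<eta>' t) (4 * \<delta>) \<subseteq> upper_half_plane"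
  defines "\<tau> \<equiv> \<lambda>t. first_hit_after \<eta>' (\<eta>' t) (4 * \<delta>) t"
  obtains P where "finite P" "P \<subseteq> {t. 0 < t \<and> \<eta> t \<in> cbox a b}"
    "{t. 0 \<le> t \<and> \<eta> t \<in> cbox a b} \<subseteq> (\<Union>t\<in>P. {t..\<tau> t})"
    "\<And>t u. t \<in> P \<Longrightarrow> u \<in> P \<Longrightarrow> t < u \<Longrightarrow> \<tau> t \<le> u"
    "\<And>t s. t \<in> P \<Longrightarrow> s \<in> {t..\<tau> t} \<Longrightarrow> dist (\<eta>' s) (\<eta>' t) \<le> 4 * \<delta>"
    "\<And>t. t \<in> P \<Longrightarrow> 0 \<le> last_hit_before \<eta>' (\<eta>' t) \<delta> t"
    "\<And>t u. t \<in> P \<Longrightarrow> u \<in> P \<Longrightarrow> t < u \<Longrightarrow>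
        first_hit_after \<eta>' (\<eta>' t) \<delta> t < last_hit_before \<eta>' (\<eta>' u) \<delta> u"
    "\<And>t. t \<in> P \<Longrightarrow> excursion_at \<eta>' t \<delta> \<subseteq> cball (\<eta>' t) \<delta>"
proof -
  define S where "S = {t. 0 \<le> t \<and> \<eta> t \<in> cbox a b}"
  have "S = {0..} \<inter> \<eta> -` cbox a b" by (auto simp: S_def)
  moreover have "closed ({0..} \<inter> \<eta> -` cbox a b)"
    using cont(1) by (intro continuous_closed_preimage) auto
  ultimately have "closed S" by simp
  have far: "\<exists>T. \<forall>t\<ge>T. r \<le> norm (\<gamma> t)" if "curve_from_0_to_infinity \<gamma>" for r \<gamma>
    using that filterlim_at_infinity_imp_norm_at_top[of \<gamma> at_top]
    unfolding curve_from_0_to_infinity_def filterlim_at_top eventually_at_top_linorder by blast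
  obtain R where R: "\<And>x. x \<in> cbox a b \<Longrightarrow> norm x \<le> R"
    using bounded_cbox[of a b] unfolding bounded_iff by blast
  obtain T0 where T0: "\<And>t. T0 \<le> t \<Longrightarrow> R + 1 \<le> norm (\<eta> t)" using far[OF curve] by blast
  define T where "T = max 0 T0"
  have T: "t \<le> T" if "t \<in> S" for t
    using that T0[of t] R[of "\<eta> t"] by (force simp: S_def T_def)
  have zero: "4 * \<delta> \<le> dist (\<eta>' 0) (\<eta>' t)" if "t \<in> S" for t
  proof -
    have "\<eta>' 0 = 0" using curve' by (simp add: curve_from_0_to_infinity_def)
    then have "\<eta>' 0 \<notin> upper_half_plane" by (simp add: upper_half_plane_def)
    moreover have "cball (\<eta>' t) (4 * \<delta>) \<subseteq> upper_half_plane" using sub that by (simp add: S_def)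
    ultimately have "\<eta>' 0 \<notin> cball (\<eta>' t) (4 * \<delta>)" by blast
    then show ?thesis by (simp add: dist_commute)
  qed
  have later: "\<exists>v\<ge>t. 4 * \<delta> \<le> dist (\<eta>' v) (\<eta>' t)" for t
  proof -
    obtain T1 where "\<And>s. T1 \<le> s \<Longrightarrow> norm (\<eta>' t) + 4 * \<delta> \<le> norm (\<eta>' s)" using far[OF curve'] by blast
    then have "norm (\<eta>' t) + 4 * \<delta> \<le> norm (\<eta>' (max T1 t))" by simp
    then have "4 * \<delta> \<le> dist (\<eta>' (max T1 t)) (\<eta>' t)"
      using norm_triangle_ineq2[of "\<eta>' (max T1 t)" "\<eta>' t"] by (simp add: dist_norm)
    then show ?thesis by (meson max.cobounded2)
  qed
  have hit: "t < first_hit_after \<eta>' (\<eta>' t) r t"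
      "dist (\<eta>' (first_hit_after \<eta>' (\<eta>' t) r t)) (\<eta>' t) = r"
      "\<And>s. t \<le> s \<Longrightarrow> s \<le> first_hit_after \<eta>' (\<eta>' t) r t \<Longrightarrow> dist (\<eta>' s) (\<eta>' t) \<le> r"
      "\<And>s. t \<le> s \<Longrightarrow> r \<le> dist (\<eta>' s) (\<eta>' t) \<Longrightarrow> first_hit_after \<eta>' (\<eta>' t) r t \<le> s"
    if t: "t \<in> S" and r: "0 < r" "r \<le> 4 * \<delta>" for t r
  proof -
    have "0 \<le> t" using t by (simp add: S_def)
    have c: "dist (\<eta>' t) (\<eta>' t) < r" using r by simp
    obtain v where v: "t \<le> v" "4 * \<delta> \<le> dist (\<eta>' v) (\<eta>' t)" using later by blast
    then have "r \<le> dist (\<eta>' v) (\<eta>' t)" using r by simp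
    note f = first_hit_after_properties[OF cont(2) \<open>0 \<le> t\<close> v(1) c this]
    show "t < first_hit_after \<eta>' (\<eta>' t) r t" "dist (\<eta>' (first_hit_after \<eta>' (\<eta>' t) r t)) (\<eta>' t) = r"
      using f by auto
    show "dist (\<eta>' s) (\<eta>' t) \<le> r" if "t \<le> s" "s \<le> first_hit_after \<eta>' (\<eta>' t) r t" for s
      using f(3) f(4)[of s] that by (cases "s = first_hit_after \<eta>' (\<eta>' t) r t") auto
    show "first_hit_after \<eta>' (\<eta>' t) r t \<le> s" if "t \<le> s" "r \<le> dist (\<eta>' s) (\<eta>' t)" for s
      using first_hit_after_properties(2)[OF cont(2) \<open>0 \<le> t\<close> that(1) c that(2)] .
  qed
  have lhit: "0 \<le> last_hit_before \<eta>' (\<eta>' t) \<delta> t" "last_hit_before \<eta>' (\<eta>' t) \<delta> t < t"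
      "\<And>s. last_hit_before \<eta>' (\<eta>' t) \<delta> t \<le> s \<Longrightarrow> s \<le> t \<Longrightarrow> dist (\<eta>' s) (\<eta>' t) \<le> \<delta>"
    if t: "t \<in> S" for t
  proof -
    have "0 \<le> t" using t by (simp add: S_def)
    have c: "dist (\<eta>' t) (\<eta>' t) < \<delta>" using \<open>0 < \<delta>\<close> by simp
    have "\<delta> \<le> dist (\<eta>' 0) (\<eta>' t)" using zero[OF t] \<open>0 < \<delta>\<close> by simp
    note f = last_hit_before_properties[OF cont(2) order_refl \<open>0 \<le> t\<close> c this]
    show "0 \<le> last_hit_before \<eta>' (\<eta>' t) \<delta> t" "last_hit_before \<eta>' (\<eta>' t) \<delta> t < t" using f by auto
    show "dist (\<eta>' s) (\<eta>' t) \<le> \<delta>" if "last_hit_before \<eta>' (\<eta>' t) \<delta> t \<le> s" "s \<le> t" for s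
      using f(3) f(4)[of s] that by (cases "s = last_hit_before \<eta>' (\<eta>' t) \<delta> t") auto
  qed
  have "uniformly_continuous_on {0..T+1} \<eta>'"
    using cont(2) by (intro compact_uniformly_continuous) (auto elim: continuous_on_subset)
  then obtain c where c: "c > 0" "\<And>x y. x \<in> {0..T+1} \<Longrightarrow> y \<in> {0..T+1} \<Longrightarrow> dist x y < c \<Longrightarrow> dist (\<eta>' x) (\<eta>' y) < 4 * \<delta>"
    using \<open>0 < \<delta>\<close> unfolding uniformly_continuous_on_def by (metis mult_pos_pos zero_less_numeral)
  define c0 where "c0 = min 1 (c / 2)"
  have step: "t + c0 \<le> \<tau> t" if t: "t \<in> S" for t
  proof (rule ccontr)
    assume "\<not> t + c0 \<le> \<tau> t"
    moreover have "t < \<tau> t" "dist (\<eta>' (\<tau> t)) (\<eta>' t) = 4 * \<delta>"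
      using hit(1,2)[OF t, of "4 * \<delta>"] \<open>0 < \<delta>\<close> by (auto simp: \<tau>_def)
    moreover have "0 \<le> t" "t \<le> T" using t T by (auto simp: S_def)
    ultimately have "\<tau> t \<in> {0..T+1}" "t \<in> {0..T+1}" "dist (\<tau> t) t < c"
      using c(1) by (auto simp: c0_def dist_real_def)
    from c(2)[OF this] show False using \<open>dist (\<eta>' (\<tau> t)) (\<eta>' t) = 4 * \<delta>\<close> by simp
  qed
  have "c0 > 0" using c(1) by (simp add: c0_def)
  from greedy_nonoverlapping_cover[OF \<open>closed S\<close> T this step, of 0]
  obtain P where P: "finite P" "P \<subseteq> S \<inter> {0..}" "S \<inter> {0..} \<subseteq> (\<Union>t\<in>P. {t..\<tau> t})"
    "\<And>t u. t \<in> P \<Longrightarrow> u \<in> P \<Longrightarrow> t < u \<Longrightarrow> \<tau> t \<le> u" by blast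
  have PS: "t \<in> S" if "t \<in> P" for t using P(2) that by auto
  show ?thesis
  proof (rule that[OF P(1) _ _ P(4)])
    have "S \<subseteq> {0<..}"
    proof
      fix t assume t: "t \<in> S"
      have "t \<noteq> 0" using zero[OF t] \<open>0 < \<delta>\<close> by auto
      then show "t \<in> {0<..}" using t by (auto simp: S_def)
    qed
    then show "P \<subseteq> {t. 0 < t \<and> \<eta> t \<in> cbox a b}" using P(2) by (auto simp: S_def)
    have "S \<inter> {0..} = S" by (auto simp: S_def)
    then show "{t. 0 \<le> t \<and> \<eta> t \<in> cbox a b} \<subseteq> (\<Union>t\<in>P. {t..\<tau> t})" using P(3) by (simp add: S_def)
    show "dist (\<eta>' s) (\<eta>' t) \<le> 4 * \<delta>" if "t \<in> P" "s \<in> {t..\<tau> t}" for t s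
      using hit(3)[OF PS[OF that(1)], of "4 * \<delta>" s] that(2) \<open>0 < \<delta>\<close> by (auto simp: \<tau>_def)
    show "0 \<le> last_hit_before \<eta>' (\<eta>' t) \<delta> t" if "t \<in> P" for t using lhit(1)[OF PS[OF that]] .
    show "excursion_at \<eta>' t \<delta> \<subseteq> cball (\<eta>' t) \<delta>" if "t \<in> P" for t
    proof -
      have "dist (\<eta>' s) (\<eta>' t) \<le> \<delta>"
        if "last_hit_before \<eta>' (\<eta>' t) \<delta> t \<le> s" "s \<le> first_hit_after \<eta>' (\<eta>' t) \<delta> t" for s
        using lhit(3)[OF PS[OF \<open>t \<in> P\<close>], of s] hit(3)[OF PS[OF \<open>t \<in> P\<close>], of \<delta> s] that \<open>0 < \<delta>\<close>
        by (cases "s \<le> t") auto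
      then show ?thesis by (auto simp: excursion_at_def dist_commute)
    qed
    show "first_hit_after \<eta>' (\<eta>' t) \<delta> t < last_hit_before \<eta>' (\<eta>' u) \<delta> u" if tu: "t \<in> P" "u \<in> P" "t < u" for t u
    proof (rule ccontr)
      let ?f = "first_hit_after \<eta>' (\<eta>' t) \<delta> t" and ?l = "last_hit_before \<eta>' (\<eta>' u) \<delta> u"
      assume "\<not> ?f < ?l"
      then have "?l \<le> ?f" by simp
      have \<tau>: "t < \<tau> t" "dist (\<eta>' (\<tau> t)) (\<eta>' t) = 4 * \<delta>"
        using hit(1,2)[OF PS[OF tu(1)], of "4 * \<delta>"] \<open>0 < \<delta>\<close> by (auto simp: \<tau>_def)
      then have "?f \<le> \<tau> t" using hit(4)[OF PS[OF tu(1)], of \<delta> "\<tau> t"] \<open>0 < \<delta>\<close> by simp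
      have "\<tau> t \<le> u" using P(4)[OF tu] .
      have f: "dist (\<eta>' ?f) (\<eta>' t) = \<delta>" using hit(2)[OF PS[OF tu(1)], of \<delta>] \<open>0 < \<delta>\<close> by simp
      have "dist (\<eta>' ?f) (\<eta>' u) \<le> \<delta>" "dist (\<eta>' (\<tau> t)) (\<eta>' u) \<le> \<delta>"
        using \<open>?l \<le> ?f\<close> \<open>?f \<le> \<tau> t\<close> \<open>\<tau> t \<le> u\<close> by (auto intro!: lhit(3)[OF PS[OF tu(2)]])
      moreover have "dist (\<eta>' (\<tau> t)) (\<eta>' t) \<le> dist (\<eta>' (\<tau> t)) (\<eta>' u) + dist (\<eta>' ?f) (\<eta>' u) + dist (\<eta>' ?f) (\<eta>' t)"
        by (metis dist_commute dist_triangle_le dist_triangle add_mono order_refl add.commute)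
      ultimately show False using f \<tau>(2) \<open>0 < \<delta>\<close> by simp
    qed
  qed
qed

end

lemma unbounded_curve_trace:
  assumes "curve_from_0_to_infinity \<eta>"
  shows "\<not> bounded (curve_trace \<eta>)"
proof
  assume "bounded (curve_trace \<eta>)"
  then obtain R where R: "\<And>x. x \<in> curve_trace \<eta> \<Longrightarrow> norm x \<le> R" by (auto simp: bounded_iff)
  have "filterlim (\<lambda>t. norm (\<eta> t)) at_top at_top"
    using assms filterlim_at_infinity_imp_norm_at_top by (auto simp: curve_from_0_to_infinity_def)
  then have "\<forall>\<^sub>F t in at_top. R + 1 \<le> norm (\<eta> t)" by (simp add: filterlim_at_top)
  then obtain T where T: "\<And>t. T \<le> t \<Longrightarrow> R + 1 \<le> norm (\<eta> t)" by (auto simp: eventually_at_top_linorder)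
  have "\<eta> (max T 0) \<in> curve_trace \<eta>" by (auto simp: curve_trace_def)
  from R[OF this] T[of "max T 0"] show False by simp
qed

lemma islimpt_curve_trace:
  assumes "curve_from_0_to_infinity \<eta>" "x \<in> curve_trace \<eta>"
  shows "x islimpt curve_trace \<eta>"
proof (rule connected_imp_perfect)
  show "connected (curve_trace \<eta>)"
    using assms unfolding curve_trace_def curve_from_0_to_infinity_def
    by (intro connected_continuous_image) auto
  show "curve_trace \<eta> \<noteq> {a}" for a using unbounded_curve_trace[OF assms(1)] by force
qed fact

context curve_homeomorphism
begin

text \<open>The points \<open>y t\<close> that the non-self-tracing property attaches to the excursions lie within
  \<open>3 * \<delta> powr \<alpha>\<close> of the centres of a cover of \<open>\<eta>'\<close> by \<open>\<delta> powr (-(\<alpha> * d))\<close> balls of radius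
  \<open>\<delta> powr \<alpha>\<close>. Each of the enlarged balls is divided into a fixed number of cells. Two points that are
  visible from near the centre of a cell are visited by every excursion whose \<open>y t\<close> lies in this cell,
  so the number of excursions in a cell is bounded.\<close>

lemma card_excursion_times_le:
  assumes nst: "non_self_tracing \<eta>'" and dim: "upper_minkowski_dim (curve_trace \<eta>') < ereal d"
    and "1 < \<alpha>" "0 < \<mu>"
  shows "\<exists>C>0. \<forall>\<^sub>F \<delta> in at_right 0. \<forall>P. finite P \<longrightarrow>
    (\<forall>t\<in>P. 0 < t \<and> \<eta>' t \<in> cbox (Complex (-R) \<mu>) (Complex R R) \<and>
        0 \<le> last_hit_before \<eta>' (\<eta>' t) \<delta> t \<and> excursion_at \<eta>' t \<delta> \<subseteq> cball (\<eta>' t) \<delta>) \<longrightarrow>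
    (\<forall>t\<in>P. \<forall>u\<in>P. t < u \<longrightarrow> first_hit_after \<eta>' (\<eta>' t) \<delta> t < last_hit_before \<eta>' (\<eta>' u) \<delta> u) \<longrightarrow>
    real (card P) \<le> C * \<delta> powr (-(\<alpha> * d))"
proof -
  define W where "W = cbox (Complex (-R) \<mu>) (Complex R R)"
  define V where "V = cbox (Complex (-R-\<mu>) (\<mu>/2)) (Complex (R+\<mu>) (R+\<mu>))"
  define E where "E = curve_trace \<eta>'"
  have "closed E" unfolding E_def using curve' by (rule curve_trace_closed)
  have V: "compact V" "V \<subseteq> upper_half_plane" "bounded V"
    unfolding V_def using \<open>0 < \<mu>\<close> by (auto intro!: cbox_in_half_plane compact_imp_bounded)
  obtain M where M: "\<And>(P::real set) l u a b. finite P \<Longrightarrow> a \<noteq> b \<Longrightarrow> a \<in> V \<Longrightarrow> b \<in> V \<Longrightarrow>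
    (\<And>j. j \<in> P \<Longrightarrow> 0 \<le> l j \<and> a \<in> \<eta>' ` {l j..u j} \<and> b \<in> \<eta>' ` {l j..u j}) \<Longrightarrow>
    (\<And>j k. j \<in> P \<Longrightarrow> k \<in> P \<Longrightarrow> j < k \<Longrightarrow> u j < l k) \<Longrightarrow> card P \<le> M"
    using card_common_points_le[OF V(1,2)] by blast
  obtain F where F: "finite F" "cball (0::complex) 3 \<subseteq> (\<Union>f\<in>F. ball f (1/2))"
    using finite_cball_cover by blast
  define \<xi> where "\<xi> = (1 + \<alpha>) / 2"
  have \<xi>: "\<alpha> > \<xi> \<and> \<xi> > 1" using \<open>1 < \<alpha>\<close> by (simp add: \<xi>_def)
  note tracing = nst[unfolded non_self_tracing_def Let_def, rule_format,
      OF cbox_in_half_plane[OF \<open>0 < \<mu>\<close>] \<xi>, of "-R" "Complex R R", folded W_def E_def]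
  obtain \<delta>0 where \<delta>0: "\<delta>0 > 0" "\<forall>\<delta> t. 0 < \<delta> \<and> \<delta> < \<delta>0 \<and> t > 0 \<and> \<eta>' t \<in> W \<longrightarrow>
          (\<exists>y. ball y (\<delta> powr \<alpha>) \<subseteq> ball (\<eta>' t) \<delta> - E \<and> ball y (2 * \<delta> powr \<alpha>) \<inter> E \<noteq> {} \<and>
                (\<forall>x \<in> frontier (connected_component_set (ball (\<eta>' t) \<delta> - E) y) - excursion_at \<eta>' t \<delta>. \<forall>p.
                  path p \<and> path_image p \<subseteq> connected_component_set (ball (\<eta>' t) \<delta> - E) y \<union> {x} \<and>
                  pathstart p = y \<and> pathfinish p = x \<longrightarrow>
                  \<not> path_image p \<subseteq> ball y (\<delta> powr \<xi>)))"
    by (rule exE[OF tracing]) (elim conjE, rule that)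
  define C where "C = (real M + 1) * (real (card F) + 1)"
  have "C > 0" by (simp add: C_def add_pos_nonneg)
  have "\<forall>\<^sub>F \<epsilon> in at_right 0. \<exists>C. finite C \<and> real (card C) \<le> \<epsilon> powr (-d) \<and> E \<inter> V \<subseteq> (\<Union>c\<in>C. ball c \<epsilon>)"
    using unbounded_curve_trace[OF curve'] dim V(3) unfolding E_def
    by (intro eventually_small_cover[where A = "curve_trace \<eta>'"]) (auto intro: bounded_Int)
  moreover have "filterlim (\<lambda>\<delta>::real. \<delta> powr \<alpha>) (at_right 0) (at_right 0)"
    using \<open>1 < \<alpha>\<close> by real_asymp
  ultimately have "\<forall>\<^sub>F \<delta> in at_right 0. \<exists>C. finite C \<and> real (card C) \<le> (\<delta> powr \<alpha>) powr (-d) \<and>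
      E \<inter> V \<subseteq> (\<Union>c\<in>C. ball c (\<delta> powr \<alpha>))"
    by (rule eventually_compose_filterlim)
  moreover have "\<forall>\<^sub>F \<delta>::real in at_right 0. \<delta> \<in> {0<..<min \<delta>0 (min 1 (\<mu> / 8))}"
    using \<delta>0(1) \<open>0 < \<mu>\<close> by (intro eventually_at_right_real) auto
  moreover have "\<forall>\<^sub>F \<delta>::real in at_right 0. 4 * \<delta> powr \<alpha> \<le> \<delta> powr \<xi>"
    using \<xi> by real_asymp
  moreover have "\<forall>\<^sub>F \<delta>::real in at_right 0. \<delta> powr \<alpha> \<le> \<delta>"
    using \<open>1 < \<alpha>\<close> by real_asymp
  ultimately have "\<forall>\<^sub>F \<delta> in at_right 0. \<forall>P. finite P \<longrightarrow>
    (\<forall>t\<in>P. 0 < t \<and> \<eta>' t \<in> W \<and>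
        0 \<le> last_hit_before \<eta>' (\<eta>' t) \<delta> t \<and> excursion_at \<eta>' t \<delta> \<subseteq> cball (\<eta>' t) \<delta>) \<longrightarrow>
    (\<forall>t\<in>P. \<forall>u\<in>P. t < u \<longrightarrow> first_hit_after \<eta>' (\<eta>' t) \<delta> t < last_hit_before \<eta>' (\<eta>' u) \<delta> u) \<longrightarrow>
    real (card P) \<le> C * \<delta> powr (-(\<alpha> * d))"
  proof eventually_elim
    case (elim \<delta>)
    define \<rho> where "\<rho> = \<delta> powr \<alpha>"
    have \<delta>: "0 < \<delta>" "\<delta> < \<delta>0" "\<delta> < \<mu> / 8" and \<rho>: "0 < \<rho>" "\<rho> \<le> \<delta>" "4 * \<rho> \<le> \<delta> powr \<xi>"
      using elim by (auto simp: \<rho>_def)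
    obtain Cc where Cc: "finite Cc" "real (card Cc) \<le> \<rho> powr (-d)" "E \<inter> V \<subseteq> (\<Union>c\<in>Cc. ball c \<rho>)"
      using elim unfolding \<rho>_def by blast
    show ?case
    proof (intro allI impI)
      fix P assume "finite P"
        and P: "\<forall>t\<in>P. 0 < t \<and> \<eta>' t \<in> W \<and>
          0 \<le> last_hit_before \<eta>' (\<eta>' t) \<delta> t \<and> excursion_at \<eta>' t \<delta> \<subseteq> cball (\<eta>' t) \<delta>"
        and disj: "\<forall>t\<in>P. \<forall>u\<in>P. t < u \<longrightarrow> first_hit_after \<eta>' (\<eta>' t) \<delta> t < last_hit_before \<eta>' (\<eta>' u) \<delta> u"
      have near_V: "cball (\<eta>' t) (3 * \<delta>) \<subseteq> V" if "t \<in> P" for t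
        using P that \<delta> unfolding V_def W_def by (intro cball_in_enlarged_cbox) auto
      have "\<forall>t\<in>P. \<exists>y. ball y \<rho> \<subseteq> ball (\<eta>' t) \<delta> - E \<and> ball y (2 * \<rho>) \<inter> E \<noteq> {} \<and>
          (\<forall>x \<in> frontier (connected_component_set (ball (\<eta>' t) \<delta> - E) y) - excursion_at \<eta>' t \<delta>. \<forall>p.
                  path p \<and> path_image p \<subseteq> connected_component_set (ball (\<eta>' t) \<delta> - E) y \<union> {x} \<and>
                  pathstart p = y \<and> pathfinish p = x \<longrightarrow>
                  \<not> path_image p \<subseteq> ball y (\<delta> powr \<xi>))" (is "\<forall>t\<in>P. ?Y t")
      proof
        fix t assume "t \<in> P"
        with P \<delta> have "0 < \<delta> \<and> \<delta> < \<delta>0 \<and> t > 0 \<and> \<eta>' t \<in> W" by blast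
        then show "?Y t" unfolding \<rho>_def by (rule \<delta>0(2)[rule_format])
      qed
      from bchoice[OF this] obtain y where
        y: "\<And>t. t \<in> P \<Longrightarrow> ball (y t) \<rho> \<subseteq> ball (\<eta>' t) \<delta> - E" "\<And>t. t \<in> P \<Longrightarrow> ball (y t) (2 * \<rho>) \<inter> E \<noteq> {}"
        and y_tracing: "\<And>t. t \<in> P \<Longrightarrow>
          (\<forall>x \<in> frontier (connected_component_set (ball (\<eta>' t) \<delta> - E) (y t)) - excursion_at \<eta>' t \<delta>. \<forall>p.
                  path p \<and> path_image p \<subseteq> connected_component_set (ball (\<eta>' t) \<delta> - E) (y t) \<union> {x} \<and>
                  pathstart p = y t \<and> pathfinish p = x \<longrightarrow>
                  \<not> path_image p \<subseteq> ball (y t) (\<delta> powr \<xi>))"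
        by (elim exE) (rule that; blast)
      \<comment> \<open>Cells have radius \<open>\<rho> / 2\<close>, so that each of them lies in the ball \<open>ball (y t) \<rho>\<close> off the curve,
        for every \<open>t\<close> that belongs to it.\<close>
      define cell where "cell = (\<lambda>(c, f). {t \<in> P. y t \<in> ball (c + of_real \<rho> * f) (\<rho> / 2)})"
      have cover: "P \<subseteq> (\<Union>k\<in>Cc \<times> F. cell k)"
      proof
        fix t assume t: "t \<in> P"
        obtain x where x: "x \<in> E" "dist (y t) x < 2 * \<rho>" using y(2)[OF t] by auto
        have "y t \<in> ball (y t) \<rho>" using \<rho> by simp
        then have "y t \<in> ball (\<eta>' t) \<delta>" using y(1)[OF t] by blast
        then have "dist (\<eta>' t) (y t) < \<delta>" by simp
        then have "x \<in> cball (\<eta>' t) (3 * \<delta>)"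
          using x(2) dist_triangle[of "\<eta>' t" x "y t"] \<rho> by simp
        then obtain c where c: "c \<in> Cc" "dist c x < \<rho>" using near_V[OF t] Cc(3) x(1) by fastforce
        then have "norm (y t - c) \<le> 3 * \<rho>"
          using x(2) dist_triangle3[of "y t" c x] by (simp add: dist_norm norm_minus_commute)
        then have "(y t - c) / of_real \<rho> \<in> cball 0 3" using \<rho> by (simp add: norm_divide field_simps)
        then obtain f where f: "f \<in> F" "dist f ((y t - c) / of_real \<rho>) < 1 / 2" using F(2) by auto
        have "c + of_real \<rho> * f - y t = of_real \<rho> * (f - (y t - c) / of_real \<rho>)"
          using \<rho> by (simp add: field_simps)
        then have "dist (c + of_real \<rho> * f) (y t) = \<rho> * dist f ((y t - c) / of_real \<rho>)"
          using \<rho> by (simp add: dist_norm norm_mult)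
        also have "\<dots> < \<rho> * (1 / 2)" using f(2) \<rho>(1) by (intro mult_strict_left_mono) auto
        finally have "t \<in> cell (c, f)" using t by (simp add: cell_def)
        then show "t \<in> (\<Union>k\<in>Cc \<times> F. cell k)" using c(1) f(1) by blast
      qed
      have small_cell: "card (cell k) \<le> M + 1" if "k \<in> Cc \<times> F" for k
      proof (cases "cell k = {}")
        case False
        obtain c f where k: "k = (c, f)" by (cases k)
        define c0 where "c0 = c + of_real \<rho> * f"
        have cell: "t \<in> P \<and> dist c0 (y t) < \<rho> / 2" if "t \<in> cell k" for t
          using that by (simp add: k cell_def c0_def)
        obtain t0 where t0: "t0 \<in> cell k" using False by blast
        obtain x where x: "x \<in> E" "dist (y t0) x < 2 * \<rho>" using y(2)[of t0] cell[OF t0] by auto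
        then have xb: "x \<in> ball c0 (3 * \<rho>)"
          using cell[OF t0] dist_triangle[of c0 x "y t0"] \<rho>(1) by simp
        \<comment> \<open>The trace is connected and not a single point, so a second point is available nearby.\<close>
        have "x islimpt E" using islimpt_curve_trace[OF curve'] x(1) by (simp add: E_def)
        then obtain x2 where x2: "x2 \<in> E" "x2 \<in> ball c0 (3 * \<rho>)" "x2 \<noteq> x"
          using xb unfolding islimpt_def by (metis open_ball)
        have "0 < \<rho> / 2" "\<rho> / 2 \<le> 3 * \<rho>" using \<rho> by auto
        from obtain_two_visible_points[OF \<open>closed E\<close> this, of x c0 x2]
        obtain a b ya yb where ab: "a \<noteq> b" "ya \<in> ball c0 (\<rho> / 2)" "yb \<in> ball c0 (\<rho> / 2)"
          "a \<in> ball c0 (3 * \<rho>)" "b \<in> ball c0 (3 * \<rho>)"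
          "closed_segment ya a \<inter> E = {a}" "closed_segment yb b \<inter> E = {b}"
          using x xb x2 by blast
        have in_exc: "z \<in> excursion_at \<eta>' t \<delta>"
          if t: "t \<in> cell k" and z: "z \<in> ball c0 (3 * \<rho>)" "yz \<in> ball c0 (\<rho> / 2)" "closed_segment yz z \<inter> E = {z}"
          for t z yz
        proof (rule first_point_in_excursion[OF \<open>closed E\<close> _ y(1) _ _ _ z(3) y_tracing])
          show "t \<in> P" "t \<in> P" using cell[OF t] by auto
          have 0: "0 \<le> last_hit_before \<eta>' (\<eta>' t) \<delta> t" using P cell[OF t] by auto
          then show "excursion_at \<eta>' t \<delta> \<subseteq> E" by (auto simp: excursion_at_def E_def curve_trace_def)
          have c0: "dist (y t) c0 < \<rho> / 2" using cell[OF t] by (simp add: dist_commute)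
          show 1: "yz \<in> ball (y t) \<rho>" using z(2) c0 dist_triangle[of "y t" yz c0] by simp
          then show "yz \<in> ball (y t) (\<delta> powr \<xi>)" using \<rho> by simp
          show "z \<in> ball (y t) (\<delta> powr \<xi>)" using z(1) c0 dist_triangle[of "y t" z c0] \<rho> by simp
        qed
        have in_V: "z \<in> V" if "t \<in> cell k" "z \<in> excursion_at \<eta>' t \<delta>" for t z
        proof -
          have "t \<in> P" using cell[OF that(1)] by simp
          then have "z \<in> cball (\<eta>' t) \<delta>" using P that(2) by blast
          then have "z \<in> cball (\<eta>' t) (3 * \<delta>)" using \<delta>(1) by simp
          then show ?thesis using near_V[OF \<open>t \<in> P\<close>] by blast
        qed
        have "card (cell k) \<le> M"
        proof (rule M[OF _ ab(1)])
          show "finite (cell k)" using \<open>finite P\<close> by (simp add: k cell_def)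
          show "a \<in> V" "b \<in> V" using in_V[OF t0] in_exc[OF t0] ab by blast+
          show "0 \<le> last_hit_before \<eta>' (\<eta>' t) \<delta> t \<and>
              a \<in> \<eta>' ` {last_hit_before \<eta>' (\<eta>' t) \<delta> t..first_hit_after \<eta>' (\<eta>' t) \<delta> t} \<and>
              b \<in> \<eta>' ` {last_hit_before \<eta>' (\<eta>' t) \<delta> t..first_hit_after \<eta>' (\<eta>' t) \<delta> t}"
            if "t \<in> cell k" for t
            using in_exc[OF that] ab P cell[OF that] unfolding excursion_at_def by blast
          show "first_hit_after \<eta>' (\<eta>' t) \<delta> t < last_hit_before \<eta>' (\<eta>' u) \<delta> u"
            if "t \<in> cell k" "u \<in> cell k" "t < u" for t u
            using disj cell that by blast
        qed
        then show ?thesis by simp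
      qed simp
      have "finite (\<Union>k\<in>Cc \<times> F. cell k)"
        using \<open>finite P\<close> by (rule finite_subset[rotated]) (auto simp: cell_def)
      then have "card P \<le> card (\<Union>k\<in>Cc \<times> F. cell k)" using cover by (rule card_mono)
      also have "\<dots> \<le> (\<Sum>k\<in>Cc \<times> F. card (cell k))" using Cc(1) F(1) by (intro card_UN_le) auto
      also have "\<dots> \<le> card (Cc \<times> F) * (M + 1)"
        using sum_bounded_above[of "Cc \<times> F" "\<lambda>k. card (cell k)" "M + 1"] small_cell by simp
      finally have "card P \<le> card Cc * card F * (M + 1)" by (simp add: card_cartesian_product)
      then have "real (card P) \<le> real (card Cc * card F * (M + 1))" by (simp only: of_nat_le_iff)
      also have "\<dots> = real (card Cc) * ((real M + 1) * real (card F))" by (simp add: algebra_simps)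
      also have "\<dots> \<le> \<rho> powr (-d) * C"
        using Cc(2) unfolding C_def by (intro mult_mono) (auto simp: algebra_simps)
      also have "\<rho> powr (-d) = \<delta> powr (-(\<alpha> * d))" by (simp add: \<rho>_def powr_powr)
      finally show "real (card P) \<le> C * \<delta> powr (-(\<alpha> * d))" by (simp add: mult.commute)
    qed
  qed
  then show ?thesis using \<open>C > 0\<close> unfolding W_def by blast
qed

end

context curve_homeomorphism
begin

text \<open>The number of pieces is \<open>O(\<delta> powr (-s))\<close> with \<open>s = \<alpha> * d\<close>, and the sum of their diameters is
  \<open>O(card P powr (1 - q))\<close> with \<open>q = 1 / p\<close> for any \<open>p > 2\<close>. As \<open>\<phi>\<close> maps each piece into a ball of radius
  \<open>4 * \<delta>\<close>, the weighted sum is \<open>O(\<delta> powr (1 - s * (1 - q)))\<close>.\<close>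

lemma small_weighted_cover:
  assumes nst: "non_self_tracing \<eta>'" and dim: "upper_minkowski_dim (curve_trace \<eta>') < 2"
    and H: "cbox a b \<subseteq> upper_half_plane" and "0 < e"
  shows "\<exists>(J::real set) D w. finite J \<and> 0 \<le> w \<and>
    (\<forall>j\<in>J. compact (D j) \<and> D j \<subseteq> cbox a b \<and> (\<forall>x\<in>D j. \<forall>y\<in>D j. norm (\<phi> x - \<phi> y) \<le> w)) \<and>
    cbox a b \<inter> curve_trace \<eta> \<subseteq> (\<Union>j\<in>J. D j) \<and> (\<Sum>j\<in>J. w * diameter (D j)) < e"
proof -
  obtain d where d: "1 \<le> d" "d < 2" "upper_minkowski_dim (curve_trace \<eta>') < ereal d"
  proof -
    obtain r where "upper_minkowski_dim (curve_trace \<eta>') < ereal r" "ereal r < 2"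
      using dim ereal_dense2 by blast
    moreover from this(1) have "upper_minkowski_dim (curve_trace \<eta>') < ereal (max 1 r)"
      by (rule less_le_trans) simp
    ultimately show ?thesis using that[of "max 1 r"] by simp
  qed
  \<comment> \<open>The choice \<open>1 < \<alpha> < 2 / d\<close> makes \<open>s < 2\<close>. Then \<open>1 - 1 / s < 1 / 2\<close>, which leaves room for \<open>q\<close> with
    \<open>s * (1 - q) < 1\<close> and \<open>p = 1 / q > 2\<close>.\<close>
  define \<alpha> where "\<alpha> = (1 + 2 / d) / 2"
  define s where "s = \<alpha> * d"
  have s: "s = (d + 2) / 2" using d by (simp add: s_def \<alpha>_def field_simps)
  have "1 < \<alpha>" using d by (simp add: \<alpha>_def field_simps)
  have s12: "1 < s" "s < 2" using d by (auto simp: s)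
  define q where "q = ((1 - 1 / s) + 1 / 2) / 2"
  define p where "p = 1 / q"
  have q: "1 - 1 / s < q" "q < 1 / 2" "0 < q" using s12 by (auto simp: q_def field_simps)
  then have "2 < p" by (simp add: p_def field_simps)
  have "1 - q < 1 / s" using q by simp
  then have "s * (1 - q) < 1" using s12 by (simp add: field_simps)
  define x where "x = 1 - s * (1 - q)"
  have "x > 0" using \<open>s * (1 - q) < 1\<close> by (simp add: x_def)
  obtain R \<mu> where R: "0 < \<mu>" "\<phi> ` cbox a b \<subseteq> cbox (Complex (-R) \<mu>) (Complex R R)"
  proof -
    have \<phi>: "continuous_on upper_half_plane \<phi>" "\<phi> ` upper_half_plane = upper_half_plane"
      using hom by (auto simp: homeomorphism_def)
    have "compact (\<phi> ` cbox a b)"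
      using continuous_on_subset[OF \<phi>(1) H] compact_cbox by (rule compact_continuous_image)
    moreover have "\<phi> ` cbox a b \<subseteq> upper_half_plane" using \<phi>(2) H by blast
    ultimately show ?thesis by (rule compact_subset_box_in_half_plane) (rule that)
  qed
  obtain C1 where C1: "C1 > 0"
    "\<forall>P \<tau>. \<forall>r>0. finite P \<and> (\<forall>t\<in>P. 0 \<le> t) \<and> (\<forall>t\<in>P. \<forall>u\<in>P. t < u \<longrightarrow> \<tau> t \<le> u) \<longrightarrow>
      real (card {t \<in> P. r \<le> diameter (\<eta> ` {t..\<tau> t} \<inter> cbox a b)}) \<le> C1 * r powr (-p)"
    using card_large_pieces_le[OF cont(1) crossings H \<open>2 < p\<close>] by (elim exE conjE) (rule that)
  define few where "few C \<delta> \<longleftrightarrow> (\<forall>P. finite P \<longrightarrow>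
    (\<forall>t\<in>P. 0 < t \<and> \<eta>' t \<in> cbox (Complex (-R) \<mu>) (Complex R R) \<and>
        0 \<le> last_hit_before \<eta>' (\<eta>' t) \<delta> t \<and> excursion_at \<eta>' t \<delta> \<subseteq> cball (\<eta>' t) \<delta>) \<longrightarrow>
    (\<forall>t\<in>P. \<forall>u\<in>P. t < u \<longrightarrow> first_hit_after \<eta>' (\<eta>' t) \<delta> t < last_hit_before \<eta>' (\<eta>' u) \<delta> u) \<longrightarrow>
    real (card P) \<le> C * \<delta> powr (-s))" for C \<delta>
  obtain C2 where "C2 > 0" and ev: "\<forall>\<^sub>F \<delta> in at_right 0. few C2 \<delta>"
    using card_excursion_times_le[OF nst d(3) \<open>1 < \<alpha>\<close> R(1), of R]
    unfolding few_def s_def by blast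
  define K where "K = 16 * C1 powr q * C2 powr (1 - q)"
  have "((\<lambda>\<delta>. K * \<delta> powr x) \<longlongrightarrow> 0) (at_right 0)" using \<open>x > 0\<close> by real_asymp
  then have "\<forall>\<^sub>F \<delta> in at_right 0. K * \<delta> powr x < e" using \<open>0 < e\<close> by (rule order_tendstoD)
  moreover have "\<forall>\<^sub>F \<delta>::real in at_right 0. \<delta> \<in> {0<..<\<mu> / 8}"
    using R(1) by (intro eventually_at_right_real) auto
  ultimately have "\<forall>\<^sub>F \<delta> in at_right 0. K * \<delta> powr x < e \<and> \<delta> \<in> {0<..<\<mu> / 8} \<and> few C2 \<delta>"
    using ev by eventually_elim blast
  then obtain \<delta> where \<delta>: "K * \<delta> powr x < e" "0 < \<delta>" "\<delta> < \<mu> / 8" and count: "few C2 \<delta>"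
    using eventually_happens'[OF trivial_limit_at_right_real]
    by (metis (no_types, lifting) greaterThanLessThan_iff)
  have in_box: "\<eta>' t = \<phi> (\<eta> t)" "\<eta>' t \<in> cbox (Complex (-R) \<mu>) (Complex R R)"
    if "0 \<le> t" "\<eta> t \<in> cbox a b" for t
    using image_point(1)[of t] R(2) H that by auto
  have sub: "cball (\<eta>' t) (4 * \<delta>) \<subseteq> upper_half_plane" if "0 \<le> t" "\<eta> t \<in> cbox a b" for t
  proof -
    have "cball (\<eta>' t) (4 * \<delta>) \<subseteq> cbox (Complex (-R-\<mu>) (\<mu>/2)) (Complex (R+\<mu>) (R+\<mu>))"
      using in_box(2)[OF that] \<delta>(3) by (intro cball_in_enlarged_cbox) auto
    also have "\<dots> \<subseteq> upper_half_plane" using R(1) by (intro cbox_in_half_plane) simp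
    finally show ?thesis .
  qed
  define \<tau> where "\<tau> t = first_hit_after \<eta>' (\<eta>' t) (4 * \<delta>) t" for t
  obtain P where P: "finite P" "P \<subseteq> {t. 0 < t \<and> \<eta> t \<in> cbox a b}"
    "{t. 0 \<le> t \<and> \<eta> t \<in> cbox a b} \<subseteq> (\<Union>t\<in>P. {t..\<tau> t})"
    "\<And>t u. t \<in> P \<Longrightarrow> u \<in> P \<Longrightarrow> t < u \<Longrightarrow> \<tau> t \<le> u"
    "\<And>t s. t \<in> P \<Longrightarrow> s \<in> {t..\<tau> t} \<Longrightarrow> dist (\<eta>' s) (\<eta>' t) \<le> 4 * \<delta>"
    "\<And>t. t \<in> P \<Longrightarrow> 0 \<le> last_hit_before \<eta>' (\<eta>' t) \<delta> t"
    "\<And>t u. t \<in> P \<Longrightarrow> u \<in> P \<Longrightarrow> t < u \<Longrightarrow>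
        first_hit_after \<eta>' (\<eta>' t) \<delta> t < last_hit_before \<eta>' (\<eta>' u) \<delta> u"
    "\<And>t. t \<in> P \<Longrightarrow> excursion_at \<eta>' t \<delta> \<subseteq> cball (\<eta>' t) \<delta>"
    unfolding \<tau>_def
  proof (rule obtain_excursion_times[OF H \<delta>(2)], goal_cases)
    case (1 t)
    show ?case by (rule sub[OF 1(2,3)])
  next
    case (2 P)
    show ?case by (rule 2(1)[OF 2(2-9)])
  qed
  define D where "D t = \<eta> ` {t..\<tau> t} \<inter> cbox a b" for t
  have Ppos: "0 < t" "\<eta> t \<in> cbox a b" if "t \<in> P" for t using P(2) that by auto
  have "real (card P) \<le> C2 * \<delta> powr (-s)"
    using P(1,6,7,8) Ppos in_box(2)
    by (intro count[unfolded few_def, rule_format]) (auto simp: less_imp_le)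
  then have "real (card P) powr (1 - q) \<le> (C2 * \<delta> powr (-s)) powr (1 - q)"
    using q by (intro powr_mono2) auto
  also have "\<dots> = C2 powr (1 - q) * \<delta> powr (-s * (1 - q))"
    using \<open>C2 > 0\<close> by (simp add: powr_mult powr_powr)
  finally have card: "real (card P) powr (1 - q) \<le> C2 powr (1 - q) * \<delta> powr (-s * (1 - q))" .
  have diam0: "0 \<le> diameter (D t)" for t
    by (intro diameter_ge_0 bounded_subset[OF bounded_cbox[of a b]]) (auto simp: D_def)
  have "(\<Sum>t\<in>P. diameter (D t)) \<le> 2 * C1 powr (1/p) * real (card P) powr (1 - 1/p)"
  proof (rule sum_le_of_card_superlevel)
    show "real (card {j \<in> P. r \<le> diameter (D j)}) \<le> C1 * r powr (-p)" if "0 < r" for r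
      unfolding D_def using P(1,4) Ppos by (intro C1(2)[rule_format, OF that]) (auto simp: less_imp_le)
  qed (use P(1) \<open>2 < p\<close> C1(1) diam0 in auto)
  also have "\<dots> = 2 * C1 powr q * real (card P) powr (1 - q)" by (simp add: p_def)
  also have "\<dots> \<le> 2 * C1 powr q * (C2 powr (1 - q) * \<delta> powr (-s * (1 - q)))"
    using card by (intro mult_left_mono) auto
  finally have "8 * \<delta> * (\<Sum>t\<in>P. diameter (D t)) \<le> 8 * \<delta> * (2 * C1 powr q * (C2 powr (1 - q) * \<delta> powr (-s * (1 - q))))"
    using \<delta>(2) by (intro mult_left_mono) auto
  also have "\<dots> = K * (\<delta> powr 1 * \<delta> powr (-s * (1 - q)))"
    using \<delta>(2) by (simp add: K_def)
  also have "\<dots> = K * \<delta> powr x" unfolding x_def powr_add[symmetric] by (simp add: algebra_simps)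
  finally have sum: "(\<Sum>t\<in>P. 8 * \<delta> * diameter (D t)) < e" using \<delta>(1) by (simp add: sum_distrib_left)
  show ?thesis
  proof (intro exI[of _ P] exI[of _ D] exI[of _ "8 * \<delta>"] conjI ballI)
    show "compact (D t)" if "t \<in> P" for t
    proof -
      have "continuous_on {t..\<tau> t} \<eta>"
        using cont(1) by (rule continuous_on_subset) (use Ppos[OF that] in auto)
      then show ?thesis unfolding D_def by (intro compact_Int_closed compact_continuous_image) auto
    qed
    show "D t \<subseteq> cbox a b" for t by (auto simp: D_def)
    show "norm (\<phi> x - \<phi> y) \<le> 8 * \<delta>" if "t \<in> P" "x \<in> D t" "y \<in> D t" for t x y
    proof -
      have close: "dist (\<phi> z) (\<eta>' t) \<le> 4 * \<delta>" if z: "z \<in> D t" for z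
      proof -
        obtain s where s: "s \<in> {t..\<tau> t}" "z = \<eta> s" "z \<in> cbox a b" using z by (auto simp: D_def)
        then show ?thesis using P(5)[OF \<open>t \<in> P\<close> s(1)] in_box(1)[of s] Ppos[OF \<open>t \<in> P\<close>] by auto
      qed
      show ?thesis
        using close[OF that(2)] close[OF that(3)] dist_triangle2[of "\<phi> x" "\<phi> y" "\<eta>' t"] by (simp add: dist_norm)
    qed
    show "cbox a b \<inter> curve_trace \<eta> \<subseteq> (\<Union>t\<in>P. D t)"
    proof
      fix z assume z: "z \<in> cbox a b \<inter> curve_trace \<eta>"
      then obtain s where "0 \<le> s" "z = \<eta> s" by (auto simp: curve_trace_def)
      then have "s \<in> (\<Union>t\<in>P. {t..\<tau> t})" using P(3) z by blast
      then obtain t where "t \<in> P" "s \<in> {t..\<tau> t}" by blast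
      then have "z \<in> D t" unfolding D_def using z \<open>z = \<eta> s\<close> by blast
      then show "z \<in> (\<Union>t\<in>P. D t)" using \<open>t \<in> P\<close> by blast
    qed
  qed (use P(1) \<delta>(2) sum in auto)
qed

end

section \<open>Conformal removability\<close>

theorem theorem1p2:
  fixes \<eta> \<eta>' :: "real \<Rightarrow> complex" and \<phi> \<psi> :: "complex \<Rightarrow> complex"
  assumes "curve_from_0_to_infinity \<eta>" and "non_self_crossing \<eta>"
    and "homeomorphism upper_half_plane upper_half_plane \<phi> \<psi>"
    and "conformal_on (upper_half_plane - curve_trace \<eta>) \<phi>"
    and "is_image_curve \<phi> \<eta> \<eta>'"
    and "curve_from_0_to_infinity \<eta>'" and "non_self_crossing \<eta>'"
    and "bounded_number_of_crossings \<eta>"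
    and "curve_trace \<eta> \<in> null_sets lebesgue"
    and "non_self_tracing \<eta>'"
    and "upper_minkowski_dim (curve_trace \<eta>') < 2"
  shows "conformal_automorphism upper_half_plane \<phi>"
proof -
  interpret curve_homeomorphism \<eta> \<eta>' \<phi> \<psi>
    using assms by unfold_locales
  let ?H = upper_half_plane and ?E = "curve_trace \<eta>"
  have hol: "\<phi> holomorphic_on ?H - ?E" using assms(4) by (simp add: conformal_on_def)
  have \<phi>: "continuous_on ?H \<phi>" "inj_on \<phi> ?H" "\<phi> ` ?H = ?H"
    using hom by (auto simp: homeomorphism_def intro: inj_on_inverseI)
  have "closed ?E" using curve by (rule curve_trace_closed)
  then have op: "open (?H - ?E)" using open_upper_half_plane by (simp add: open_Diff)
  have "\<phi> holomorphic_on ?H"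
  proof (rule Morera_rectangle[OF open_upper_half_plane \<phi>(1)])
    fix p q assume pq: "Re p \<le> Re q" "Im p \<le> Im q" "cbox p q \<subseteq> ?H"
    show "vanishing_rectangle_integral \<phi> p q"
    proof (rule vanishing_rectangle_integral_off_thin_set[OF pq(1,2) _ _ \<open>closed ?E\<close>, where d\<phi> = "deriv \<phi>" and 'j = real])
      show "continuous_on (cbox p q) \<phi>" "inj_on \<phi> (cbox p q)"
        using \<phi> pq(3) by (auto elim: continuous_on_subset inj_on_subset)
      have "?E \<in> sets lborel" using \<open>closed ?E\<close> by simp
      then show "?E \<in> null_sets lborel" using assms(9) by (simp add: null_sets_completion_iff)
      show "(\<phi> has_field_derivative deriv \<phi> z) (at z)" if "z \<in> cbox p q - ?E" for z
        using holomorphic_derivI[OF hol op] that pq(3) by blast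
      have "continuous_on (?H - ?E) (deriv \<phi>)"
        using holomorphic_deriv[OF hol op] by (rule holomorphic_on_imp_continuous_on)
      then show "continuous_on (cbox p q - ?E) (deriv \<phi>)"
        by (rule continuous_on_subset) (use pq(3) in blast)
      show "\<exists>(J::real set) D w. finite J \<and> 0 \<le> w \<and>
          (\<forall>j\<in>J. compact (D j) \<and> (\<forall>x\<in>D j. \<forall>y\<in>D j. norm (\<phi> x - \<phi> y) \<le> w)) \<and>
          cbox p q \<inter> ?E \<subseteq> (\<Union>j\<in>J. D j) \<and> (\<Sum>j\<in>J. w * diameter (D j)) < e" if e: "e > 0" for e
      proof -
        obtain J :: "real set" and D w where "finite J" "0 \<le> w"
          "\<forall>j\<in>J. compact (D j) \<and> D j \<subseteq> cbox p q \<and> (\<forall>x\<in>D j. \<forall>y\<in>D j. norm (\<phi> x - \<phi> y) \<le> w)"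
          "cbox p q \<inter> ?E \<subseteq> (\<Union>j\<in>J. D j)" "(\<Sum>j\<in>J. w * diameter (D j)) < e"
          using small_weighted_cover[OF assms(10,11) pq(3) e] by (elim exE conjE) (rule that)
        then show ?thesis by (intro exI[of _ J] exI[of _ D] exI[of _ w] conjI) auto
      qed
    qed
  qed
  then show ?thesis using \<phi> by (simp add: conformal_automorphism_def conformal_on_def)
qed

end
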